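(* Every locally finite, $2$-connected, claw-free and net-free graph is Hamiltonian.
   Context: Graphs are undirected and simple, finite or infinite. A graph is locally finite if every vertex has finite degree. A graph is $2$-connected if it has more than two vertices and deleting fewer than two vertices always leaves it connected. A graph is $H$-free if it has no induced subgraph isomorphic to $H$. The claw is $K_{1,3}$. The net is the graph on six vertices obtained from a triangle by attaching one new pendant (degree $1$) vertex to each of the three vertices of the triangle. Ends: a ray is a one-way infinite path; two rays in $G$ are equivalent if for every finite $S\subseteq V(G)$ they have tails in the same component of $G-S$; the equivalence classes are the ends of $G$, and $\Omega(G)$ is the set of ends. For an end $\omega$ and finite $S\subseteq V(G)$ let $C(S,\omega)$ be the component of $G-S$ containing a tail of every ray in $\omega$. The space $|G|$: for a locally finite connected graph $G$, $|G|$ is the Freudenthal compactification of $G$ regarded as a $1$-complex. Its points are the points of the $1$-complex $G$ together with the ends of $G$; the open sets of the $1$-complex remain open, and basic open neighbourhoods of an end $\omega$ consist, for a finite $S\subseteq V(G)$, of $C(S,\omega)$, all ends $\omega'$ with $C(S,\omega')=C(S,\omega)$, and, for each edge between $S$ and $C(S,\omega)$, a half-open partial edge containing its endvertex in $C(S,\omega)$. For finite $G$, $|G|$ is just the $1$-complex $G$. A circle of $G$ is a homeomorphic image of the unit circle $S^1$ in $|G|$. A locally finite connected graph $G$ is Hamiltonian if there is a circle in $|G|$ containing all vertices of $G$ (a Hamilton circle); for finite graphs this is the usual notion of having a Hamilton cycle. *)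

theory Defs
  imports "HOL-Analysis.Analysis"
begin

section \<open>Graphs\<close>

record 'a sgraph =
  verts :: "'a set"
  edges :: "'a set set"

definition simple_graph :: "'a sgraph \<Rightarrow> bool" where
  "simple_graph G \<longleftrightarrow> (\<forall>e\<in>edges G. e \<subseteq> verts G \<and> card e = 2)"

definition locally_finite :: "'a sgraph \<Rightarrow> bool" where
  "locally_finite G \<longleftrightarrow> (\<forall>v\<in>verts G. finite {w. {v, w} \<in> edges G})"

definition induced_subgraph :: "'a sgraph \<Rightarrow> 'a set \<Rightarrow> 'a sgraph" where
  "induced_subgraph G W = \<lparr>verts = W, edges = {e \<in> edges G. e \<subseteq> W}\<rparr>"

definition delete_verts :: "'a sgraph \<Rightarrow> 'a set \<Rightarrow> 'a sgraph" where
  "delete_verts G S = induced_subgraph G (verts G - S)"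

text \<open>Two vertices are related if there is a (finite) walk between them.\<close>

definition conn_rel :: "'a sgraph \<Rightarrow> ('a \<times> 'a) set" where
  "conn_rel G = {(u, v). u \<in> verts G \<and> v \<in> verts G \<and> (u, v) \<in> {(x, y). {x, y} \<in> edges G}\<^sup>*}"

definition graph_connected :: "'a sgraph \<Rightarrow> bool" where
  "graph_connected G \<longleftrightarrow> (\<forall>u\<in>verts G. \<forall>v\<in>verts G. (u, v) \<in> conn_rel G)"

text \<open>Components are given by their vertex sets; as subgraphs they are the subgraphs
  induced on these sets.\<close>

definition graph_components :: "'a sgraph \<Rightarrow> 'a set set" where
  "graph_components G = verts G // conn_rel G"

text \<open>The finiteness conditions are there because the library's cardinality of an infinite
  set is 0.\<close>

definition two_connected :: "'a sgraph \<Rightarrow> bool" where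
  "two_connected G \<longleftrightarrow>
     (finite (verts G) \<longrightarrow> card (verts G) > 2) \<and>
     (\<forall>S. S \<subseteq> verts G \<and> finite S \<and> card S < 2 \<longrightarrow> graph_connected (delete_verts G S))"

definition graph_isomorphic :: "'a sgraph \<Rightarrow> 'b sgraph \<Rightarrow> bool" where
  "graph_isomorphic G H \<longleftrightarrow>
     (\<exists>f. bij_betw f (verts G) (verts H) \<and>
          (\<forall>u\<in>verts G. \<forall>v\<in>verts G. {u, v} \<in> edges G \<longleftrightarrow> {f u, f v} \<in> edges H))"

definition induced_free :: "'b sgraph \<Rightarrow> 'a sgraph \<Rightarrow> bool" where
  "induced_free H G \<longleftrightarrow> \<not> (\<exists>W\<subseteq>verts G. graph_isomorphic (induced_subgraph G W) H)"

definition claw :: "nat sgraph" where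
  "claw = \<lparr>verts = {0, 1, 2, 3}, edges = {{0, 1}, {0, 2}, {0, 3}}\<rparr>"

definition net :: "nat sgraph" where
  "net = \<lparr>verts = {0, 1, 2, 3, 4, 5},
          edges = {{0, 1}, {1, 2}, {0, 2}, {0, 3}, {1, 4}, {2, 5}}\<rparr>"

section \<open>Ends\<close>

text \<open>A one-way infinite path determines the sequence of its vertices, starting from its
  only vertex of degree 1, so rays are injective vertex sequences.\<close>

definition rays :: "'a sgraph \<Rightarrow> (nat \<Rightarrow> 'a) set" where
  "rays G = {r. inj r \<and> range r \<subseteq> verts G \<and> (\<forall>i. {r i, r (Suc i)} \<in> edges G)}"

definition has_tail_in :: "(nat \<Rightarrow> 'a) \<Rightarrow> 'a set \<Rightarrow> bool" where
  "has_tail_in r C \<longleftrightarrow> (\<exists>n. \<forall>m\<ge>n. r m \<in> C)"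

definition ray_equiv :: "'a sgraph \<Rightarrow> ((nat \<Rightarrow> 'a) \<times> (nat \<Rightarrow> 'a)) set" where
  "ray_equiv G = {(r, r'). r \<in> rays G \<and> r' \<in> rays G \<and>
     (\<forall>S. finite S \<and> S \<subseteq> verts G \<longrightarrow>
        (\<exists>C\<in>graph_components (delete_verts G S). has_tail_in r C \<and> has_tail_in r' C))}"

definition graph_ends :: "'a sgraph \<Rightarrow> (nat \<Rightarrow> 'a) set set" where
  "graph_ends G = rays G // ray_equiv G"

definition end_component :: "'a sgraph \<Rightarrow> 'a set \<Rightarrow> (nat \<Rightarrow> 'a) set \<Rightarrow> 'a set" where
  "end_component G S \<omega> =
     (THE C. C \<in> graph_components (delete_verts G S) \<and> (\<forall>r\<in>\<omega>. has_tail_in r C))"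

section \<open>The space |G|\<close>

text \<open>The points of the 1-complex are given by barycentric coordinates: a vertex is the
  indicator function of itself, and the edge uv is the segment of convex combinations of the
  indicator functions of u and v. No orientation of the edges has to be chosen.\<close>

definition vert_pt :: "'a \<Rightarrow> 'a \<Rightarrow> real" where
  "vert_pt v = (\<lambda>w. of_bool (w = v))"

definition edge_pt :: "'a \<Rightarrow> 'a \<Rightarrow> real \<Rightarrow> 'a \<Rightarrow> real" where
  "edge_pt u v t = (\<lambda>w. (1 - t) * vert_pt u w + t * vert_pt v w)"

definition complex_pts :: "'a sgraph \<Rightarrow> ('a \<Rightarrow> real) set" where
  "complex_pts G = vert_pt ` verts G \<union> {edge_pt u v t | u v t. {u, v} \<in> edges G \<and> 0 \<le> t \<and> t \<le> 1}"

text \<open>Open sets of the 1-complex (CW topology): the trace on every edge, as a copy of the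
  unit interval, is open.\<close>

definition complex_open :: "'a sgraph \<Rightarrow> ('a \<Rightarrow> real) set \<Rightarrow> bool" where
  "complex_open G U \<longleftrightarrow> U \<subseteq> complex_pts G \<and>
     (\<forall>u v. {u, v} \<in> edges G \<longrightarrow>
        openin (top_of_set {0..1}) {t \<in> {0..1}. edge_pt u v t \<in> U})"

datatype 'a fpoint = Point "'a \<Rightarrow> real" | End "(nat \<Rightarrow> 'a) set"

text \<open>In a basic neighbourhood of an end, the edge e between S and the component C contributes
  its half-open part of length l e at its endvertex in C.\<close>

definition end_nbhd ::
    "'a sgraph \<Rightarrow> 'a set \<Rightarrow> (nat \<Rightarrow> 'a) set \<Rightarrow> ('a set \<Rightarrow> real) \<Rightarrow> 'a fpoint set" where
  "end_nbhd G S \<omega> l =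
     (let C = end_component G S \<omega> in
        Point ` complex_pts (induced_subgraph G C) \<union>
        End ` {\<omega>' \<in> graph_ends G. end_component G S \<omega>' = C} \<union>
        Point ` {edge_pt c s t | c s t. c \<in> C \<and> s \<in> S \<and> {c, s} \<in> edges G \<and> 0 \<le> t \<and> t < l {c, s}})"

definition freudenthal :: "'a sgraph \<Rightarrow> 'a fpoint topology" where
  "freudenthal G = topology_generated_by
     ({Point ` U | U. complex_open G U} \<union>
      {end_nbhd G S \<omega> l | S \<omega> l. finite S \<and> S \<subseteq> verts G \<and> \<omega> \<in> graph_ends G \<and>
         (\<forall>e. 0 < l e \<and> l e < 1)})"

definition graph_circle :: "'a sgraph \<Rightarrow> 'a fpoint set \<Rightarrow> bool" where
  "graph_circle G C \<longleftrightarrow> C \<subseteq> topspace (freudenthal G) \<and>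
     top_of_set (sphere (0 :: complex) 1) homeomorphic_space subtopology (freudenthal G) C"

definition hamiltonian :: "'a sgraph \<Rightarrow> bool" where
  "hamiltonian G \<longleftrightarrow> (\<exists>C. graph_circle G C \<and> (\<forall>v\<in>verts G. Point (vert_pt v) \<in> C))"

end

theory Submission
  imports Defs
begin

text \<open>The proof treats finite and infinite graphs separately, but both parts rest on the same local
observation. Arrange the vertices of a claw-free and net-free graph in layers so that every edge
joins vertices of the same or of consecutive layers and every vertex has a parent in the previous
layer. If two vertices of one layer are distinct and non-adjacent, then so are their parents
(\<open>parents_apart\<close>): a common parent is the centre of a claw, and two adjacent parents
yield a net if they have a common parent and a claw otherwise. This needs three further layers
behind the two vertices. So as soon as the lines of ancestors are bound to meet, all layers are
cliques.

Finite graphs. Let \<open>C\<close> be a longest cycle and suppose that it misses a vertex. A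
shortest ear of \<open>C\<close> joins two vertices \<open>u\<close>, \<open>w\<close> of
\<open>C\<close>, and its first and last inner vertex have no other neighbours on \<open>C\<close>
(\<open>at_most_two_attachments\<close>). As \<open>C\<close> is longest, \<open>G[C]\<close> has no
Hamilton path from \<open>u\<close> to \<open>w\<close>. The ear provides a layer behind
\<open>u\<close>, so the distance layers of \<open>C - w\<close> from \<open>u\<close> are cliques.
Claws and nets at the neighbours of \<open>w\<close> show that \<open>w\<close> has a neighbour
\<open>q\<close> in the last layer (\<open>no_cycle_with_clean_ear\<close>). Since every vertex has
a parent, the clique layers can be traversed one after the other from \<open>u\<close> to
\<open>q\<close>, and adding \<open>w\<close> gives the forbidden Hamilton path.

Infinite graphs. The level sets of the Busemann function \<open>b\<close> of a geodesic ray are such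
layers, without a first layer, and the ancestors of any two vertices of equal level eventually meet
on the ray. Hence the whole graph is a chain of finite cliques (\<open>clique_levels_exist\<close>),
infinite downwards and possibly also upwards. By 2-connectedness there are two disjoint edges
between consecutive levels, and claw-freeness allows them to be chosen so that every level splits
into two paths that continue each other from level to level (\<open>strands\<close>). If the levels
are unbounded above, this gives two disjoint double rays which cover all vertices and which both run
from the one end of the graph to the other. If there is a top level, a path through it joins the two
strands to a single double ray, both of whose tails belong to the only end.

Topology. The compactification is Hausdorff, so an injective closed curve in it is a circle
(\<open>circle_of_closed_curve\<close>). A double ray together with the ends of its tails is an arc
or a closed curve; one such curve, or two arcs with the same endpoints, form the Hamilton circle.\<close>

section \<open>Paths and cycles in claw-free and net-free graphs\<close>

text \<open>The forbidden subgraphs are given by adjacencies alone: in \<open>net\<close> the triangle is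
\<open>a b c\<close> with pendants \<open>x\<close>, \<open>y\<close>, \<open>z\<close>, and the
listed adjacencies and non-adjacencies force the six vertices to be distinct.\<close>
locale claw_net_free =
  fixes E :: "'a \<Rightarrow> 'a \<Rightarrow> bool"
  assumes sym: "E x y \<Longrightarrow> E y x"
    and irrefl: "\<not> E x x"
    and claw: "\<lbrakk>E x a; E x b; E x c; a \<noteq> b; a \<noteq> c; b \<noteq> c; \<not> E a b; \<not> E a c; \<not> E b c\<rbrakk> \<Longrightarrow> False"
    and net: "\<lbrakk>E a b; E b c; E a c; E a x; E b y; E c z; \<not> E x b; \<not> E x c; \<not> E y a; \<not> E y c;
      \<not> E z a; \<not> E z b; \<not> E x y; \<not> E x z; \<not> E y z\<rbrakk> \<Longrightarrow> False"
begin

definition path_on :: "'a set \<Rightarrow> 'a list \<Rightarrow> bool" where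
  "path_on X Q \<longleftrightarrow> distinct Q \<and> successively E Q \<and> set Q = X"

definition hamilton_path_between :: "'a set \<Rightarrow> 'a \<Rightarrow> 'a \<Rightarrow> bool" where
  "hamilton_path_between X a b \<longleftrightarrow> (\<exists>Q. Q \<noteq> [] \<and> path_on X Q \<and> hd Q = a \<and> last Q = b)"

text \<open>Length 2 is admitted, so an edge traversed back and forth counts as a cycle. This degenerate
cycle is the starting point for longest cycles; it too has a longer cycle through any ear.\<close>
definition cycle_on :: "'a set \<Rightarrow> 'a list \<Rightarrow> bool" where
  "cycle_on X Q \<longleftrightarrow> path_on X Q \<and> length Q \<ge> 2 \<and> E (last Q) (hd Q)"

lemma E_flip: "(\<lambda>x y. E y x) = E"
  using sym by blast

lemma succ_flip: "successively (\<lambda>x y. E y x) xs = successively E xs"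
  by (simp only: E_flip)

lemma succ_rev: "successively E (rev xs) = successively E xs"
  unfolding successively_rev E_flip ..

lemmas succ_simps = succ_rev succ_flip successively_append_iff successively_Cons hd_rev last_rev hd_append last_append

lemma hamilton_path_betweenI:
  "Q \<noteq> [] \<Longrightarrow> distinct Q \<Longrightarrow> successively E Q \<Longrightarrow> set Q = X \<Longrightarrow> hd Q = a \<Longrightarrow> last Q = b
    \<Longrightarrow> hamilton_path_between X a b"
  unfolding hamilton_path_between_def path_on_def by blast

lemma cycle_rotate:
  assumes "cycle_on X (A @ B)"
  shows "cycle_on X (B @ A)"
  using assms unfolding cycle_on_def path_on_def
  by (cases "A = []"; cases "B = []") (auto simp: succ_simps)

lemma cycle_rev:
  assumes "cycle_on X (u # A @ w # D)"
  shows "cycle_on X (u # rev D @ w # rev A)"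
  using assms unfolding cycle_on_def path_on_def
  using sym[of u "hd A"] sym[of u w] sym[of "last A" w] sym[of w "hd D"] sym[of "last D" u] sym[of w u]
  by (auto simp: succ_simps split: if_splits)

lemma cycle_split:
  assumes "cycle_on X Q" "u \<in> X" "w \<in> X" "u \<noteq> w"
  obtains A D where "cycle_on X (u # A @ w # D)"
proof -
  have "u \<in> set Q" using assms unfolding cycle_on_def path_on_def by auto
  then obtain Q1 Q2 where "Q = Q1 @ u # Q2" by (meson split_list)
  then have c: "cycle_on X (u # Q2 @ Q1)" using cycle_rotate[of X Q1 "u # Q2"] assms by simp
  then have "w \<in> set (Q2 @ Q1)" using assms unfolding cycle_on_def path_on_def by auto
  then obtain A D where "Q2 @ Q1 = A @ w # D" by (meson split_list)
  then show thesis using c that by simp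
qed

section \<open>Ears of a cycle\<close>

text \<open>If an ear joins the vertices \<open>u\<close> and \<open>w\<close> of a longest cycle, then the
cycle has no Hamilton path from \<open>u\<close> to \<open>w\<close>. Each of the excluded
configurations would allow such a path: omit an empty arc, or reverse one of the two arcs between
\<open>u\<close> and \<open>w\<close> and use the chord to join the arcs.\<close>
lemma attachments_apart:
  assumes C: "cycle_on X (u # A @ w # D)" and nh: "\<not> hamilton_path_between X u w"
  shows "A \<noteq> []" "D \<noteq> []" "\<not> E (hd A) (hd D)" "\<not> E (last A) (last D)"
proof -
  note d = C[unfolded cycle_on_def path_on_def] sym[of u "hd A"] sym[of u w] sym[of "last A" w]
    sym[of w "hd D"] sym[of "last D" u] sym[of w u] sym[of "hd A" "hd D"]
  show A: "A \<noteq> []"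
  proof
    assume "A = []"
    then have "hamilton_path_between X u w"
      using d by (intro hamilton_path_betweenI[of "u # rev D @ [w]"]) (auto simp: succ_simps split: if_splits)
    then show False using nh by simp
  qed
  show D: "D \<noteq> []"
  proof
    assume "D = []"
    then have "hamilton_path_between X u w"
      using d by (intro hamilton_path_betweenI[of "u # A @ [w]"]) (auto simp: succ_simps split: if_splits)
    then show False using nh by simp
  qed
  show "\<not> E (hd A) (hd D)"
  proof
    assume "E (hd A) (hd D)"
    then have "hamilton_path_between X u w"
      using d A D by (intro hamilton_path_betweenI[of "u # rev D @ A @ [w]"]) (auto simp: succ_simps split: if_splits)
    then show False using nh by simp
  qed
  show "\<not> E (last A) (last D)"
  proof
    assume "E (last A) (last D)"
    then have "hamilton_path_between X u w"
      using d A D by (intro hamilton_path_betweenI[of "u # A @ rev D @ [w]"]) (auto simp: succ_simps split: if_splits)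
    then show False using nh by simp
  qed
qed

lemma claw_clique:
  "\<lbrakk>E v x; E v a; E v b; a \<noteq> b; \<not> E x a; \<not> E x b; x \<noteq> a; x \<noteq> b\<rbrakk> \<Longrightarrow> E a b"
  using claw[of v x a b] by blast

lemma attachments_nbrs:
  assumes C: "cycle_on X (u # A @ w # D)" and nh: "\<not> hamilton_path_between X u w"
    and x: "E u x" "x \<notin> X" "\<forall>c\<in>X. E x c \<longrightarrow> c = u \<or> c = w"
  shows "E (hd A) (last D)"
proof -
  note n = attachments_apart[OF C nh]
  note d = C[unfolded cycle_on_def path_on_def] sym[of u "hd A"] sym[of u w] sym[of "last A" w]
    sym[of w "hd D"] sym[of "last D" u] sym[of w u] sym[of "hd A" "hd D"]
  have "hd A \<in> set A" "last D \<in> set D" using n by auto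
  moreover have "E u (hd A)" "E u (last D)" using d n by (auto simp: succ_simps split: if_splits)
  moreover have "hd A \<noteq> last D" "hd A \<in> X" "last D \<in> X" "hd A \<notin> {u, w}" "last D \<notin> {u, w}"
    using calculation d by auto
  ultimately show ?thesis using claw_clique[of u x "hd A" "last D"] x by auto
qed

lemma hamilton_path_between_sym: "hamilton_path_between X u w \<Longrightarrow> hamilton_path_between X w u"
proof -
  assume "hamilton_path_between X u w"
  then obtain Q where "Q \<noteq> []" "path_on X Q" "hd Q = u" "last Q = w"
    unfolding hamilton_path_between_def by blast
  then show ?thesis
    by (intro hamilton_path_betweenI[of "rev Q"]) (auto simp: path_on_def succ_simps)
qed

text \<open>A common neighbour \<open>q\<close> of \<open>u\<close> and \<open>w\<close> splits its arc into
\<open>A1\<close> and \<open>A2\<close>. The claw at \<open>q\<close> with its two neighbours on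
the cycle and \<open>u\<close> provides a further edge; in each case it lets a path from
\<open>u\<close> traverse both arcs completely and enter \<open>w\<close> last. The outer vertices
\<open>x\<close> and \<open>x'\<close> make the neighbours of \<open>u\<close> and of
\<open>w\<close> on the cycle pairwise adjacent.\<close>
lemma no_common_neighbour_arc:
  assumes C: "cycle_on X (u # A @ w # D)" and nh: "\<not> hamilton_path_between X u w"
    and x: "E u x" "x \<notin> X" "\<forall>c\<in>X. E x c \<longrightarrow> c = u \<or> c = w"
    and x': "E w x'" "x' \<notin> X" "\<forall>c\<in>X. E x' c \<longrightarrow> c = u \<or> c = w"
    and q: "q \<in> set A" "E u q" "E w q"
  shows False
proof -
  note n = attachments_apart[OF C nh]
  note d = C[unfolded cycle_on_def path_on_def] sym[of u "hd A"] sym[of u w] sym[of "last A" w]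
    sym[of w "hd D"] sym[of "last D" u] sym[of w u] sym[of "hd A" "hd D"]
  have uu: "E (hd A) (last D)" using attachments_nbrs[OF C nh x] .
  have C': "cycle_on X (w # D @ u # A)" using cycle_rotate[of X "u # A" "w # D"] C by simp
  have nh': "\<not> hamilton_path_between X w u" using nh hamilton_path_between_sym by blast
  have ww: "E (hd D) (last A)" using attachments_nbrs[OF C' nh' x'(1,2)] x'(3) by blast
  have inX: "set A \<union> set D \<subseteq> X" "u \<notin> set A" "w \<notin> set A" "u \<notin> set D" "w \<notin> set D" using d by auto
  obtain A1 A2 where A: "A = A1 @ q # A2" using q by (meson split_list)
  have hD: "hd D \<in> set D" "last D \<in> set D" using n by auto
  have eD: "E w (hd D)" "E u (last D)" "E u (hd A)" "E w (last A)" using d n by (auto simp: succ_simps split: if_splits)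
  have qD: "q \<notin> set D" using d q by auto
  have qhD: "E q (hd D)"
    using claw_clique[of w x' q "hd D"] eD q x' hD inX qD by auto
  have qlD: "E q (last D)"
    using claw_clique[of u x q "last D"] eD q x hD inX qD by auto
  have A1: "A1 \<noteq> []" using qhD n A by auto
  have A2: "A2 \<noteq> []" using qlD n A by auto
  have ne: "last A1 \<in> set A" "hd A2 \<in> set A" "last A1 \<noteq> hd A2" "last A1 \<noteq> q" "hd A2 \<noteq> q" "hd A \<noteq> q"
  proof -
    have l: "last A1 \<in> set A1" "hd A2 \<in> set A2" "hd A1 \<in> set A1" using A1 A2 by auto
    have dis: "set A1 \<inter> set A2 = {}" "q \<notin> set A1" "q \<notin> set A2" using d A by auto
    show "last A1 \<noteq> hd A2" using l dis by (metis disjoint_iff)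
    show "last A1 \<noteq> q" "hd A2 \<noteq> q" using l dis by metis+
    show "last A1 \<in> set A" "hd A2 \<in> set A" "hd A \<noteq> q"
      using l dis A A1 by auto
  qed
  have qhA: "E q (hd A)"
  proof -
    have "hd A \<in> X - {u, w}" "q \<in> X - {u, w}" using hd_in_set[OF n(1)] inX q by blast+
    then have "\<not> E x (hd A)" "\<not> E x q" "x \<noteq> hd A" "x \<noteq> q" using x by blast+
    then show ?thesis using claw_clique[of u x q "hd A"] eD(3) q(2) x(1) ne(6) by metis
  qed
  note syms = sym[of "last A1" q] sym[of q "hd A2"] sym[of "hd A2" u] sym[of "last A1" u] sym[of w q]
    sym[of q "hd A1"] sym[of "hd D" "last A"] sym[of q "hd D"] sym[of "hd A" "last D"]
  have "E q (last A1)" "E q (hd A2)" using d A A1 A2 syms by (auto simp: succ_simps split: if_splits)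
  then have "E (last A1) (hd A2) \<or> E (last A1) u \<or> E (hd A2) u"
    using claw[of q "last A1" "hd A2" u] q(2) sym[of u q] ne inX by metis
  then have "hamilton_path_between X u w"
  proof (elim disjE)
    assume "E (last A1) u"
    then show ?thesis using d A A1 A2 q uu ww n syms
      by (intro hamilton_path_betweenI[of "u # rev A1 @ rev D @ rev A2 @ [q, w]"])
         (auto simp: succ_simps split: if_splits)
  next
    assume "E (hd A2) u"
    then show ?thesis using d A A1 A2 q uu ww n syms
      by (intro hamilton_path_betweenI[of "u # A2 @ D @ A1 @ [q, w]"])
         (auto simp: succ_simps split: if_splits)
  next
    assume "E (last A1) (hd A2)"
    then show ?thesis using d A A1 A2 q qhA qhD n syms
      by (intro hamilton_path_betweenI[of "u # rev D @ q # A1 @ A2 @ [w]"])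
         (auto simp: succ_simps split: if_splits)
  qed
  then show False using nh by simp
qed

lemma no_common_neighbour:
  assumes C: "cycle_on X (u # A @ w # D)" and nh: "\<not> hamilton_path_between X u w"
    and x: "E u x" "x \<notin> X" "\<forall>c\<in>X. E x c \<longrightarrow> c = u \<or> c = w"
    and x': "E w x'" "x' \<notin> X" "\<forall>c\<in>X. E x' c \<longrightarrow> c = u \<or> c = w"
    and q: "q \<in> X" "q \<noteq> u" "q \<noteq> w" "E u q" "E w q"
  shows False
proof -
  consider "q \<in> set A" | "q \<in> set (rev D)"
    using q C unfolding cycle_on_def path_on_def by auto
  then show False
  proof cases
    case 1
    show False by (rule no_common_neighbour_arc[OF C nh x x' 1 q(4,5)])
  next
    case 2
    show False by (rule no_common_neighbour_arc[OF cycle_rev[OF C] nh x x' 2 q(4,5)])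
  qed
qed

section \<open>Layers\<close>

definition linked :: "'a set \<Rightarrow> bool" where
  "linked X \<longleftrightarrow> (\<forall>x\<in>X. \<forall>y\<in>X. (\<lambda>a b. E a b \<and> a \<in> X \<and> b \<in> X)\<^sup>*\<^sup>* x y)"

definition layering :: "'a set \<Rightarrow> 'a \<Rightarrow> ('a \<Rightarrow> nat) \<Rightarrow> bool" where
  "layering X u l \<longleftrightarrow> l u = 0 \<and> (\<forall>c\<in>X. l c = 0 \<longrightarrow> c = u) \<and>
     (\<forall>c\<in>X. c \<noteq> u \<longrightarrow> (\<exists>p\<in>X. E p c \<and> l c = Suc (l p))) \<and>
     (\<forall>a\<in>X. \<forall>b\<in>X. E a b \<longrightarrow> l b \<le> Suc (l a))"

lemma distance_layers:
  assumes "\<And>c. c \<in> X \<Longrightarrow> (\<lambda>a b. E a b \<and> a \<in> X \<and> b \<in> X)\<^sup>*\<^sup>* u c"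
  shows "\<exists>l. layering X u l"
proof -
  let ?R = "\<lambda>a b. E a b \<and> a \<in> X \<and> b \<in> X"
  define l where "l c = (LEAST n. (?R ^^ n) u c)" for c
  have ex: "(?R ^^ l c) u c" if "c \<in> X" for c
    using assms[OF that] unfolding l_def by (metis (mono_tags, lifting) LeastI_ex rtranclp_power)
  have le: "l c \<le> n" if "(?R ^^ n) u c" for c n
    unfolding l_def by (rule Least_le) (rule that)
  have step: "l b \<le> Suc (l a)" if "a \<in> X" "b \<in> X" "E a b" for a b
    using ex[OF that(1)] that by (intro le) auto
  have "layering X u l"
    unfolding layering_def
  proof (intro conjI ballI impI)
    show "l u = 0" using le[of 0 u] by simp
    show "c = u" if "c \<in> X" "l c = 0" for c
      using ex[OF that(1)] that(2) by simp
    show "\<exists>p\<in>X. E p c \<and> l c = Suc (l p)" if c: "c \<in> X" "c \<noteq> u" for c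
    proof -
      obtain m where m: "l c = Suc m"
        using ex[OF c(1)] c(2) by (cases "l c") auto
      then obtain p where p: "(?R ^^ m) u p" "?R p c" using ex[OF c(1)] by auto
      have "l p \<le> m" using le[OF p(1)] .
      moreover have "l c \<le> Suc (l p)" using step p(2) by blast
      ultimately show ?thesis using p(2) m by auto
    qed
    show "l b \<le> Suc (l a)" if "a \<in> X" "b \<in> X" "E a b" for a b using step that by blast
  qed
  then show ?thesis by blast
qed

lemma clique_successively:
  assumes "distinct xs" "\<And>a b. a \<in> set xs \<Longrightarrow> b \<in> set xs \<Longrightarrow> a \<noteq> b \<Longrightarrow> E a b"
  shows "successively E xs"
  using assms
proof (induction xs)
  case (Cons a xs)
  then show ?case by (cases xs) (auto simp: successively_Cons)
qed simp

lemma clique_hamilton_path_between: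
  assumes "finite X" "\<And>a b. a \<in> X \<Longrightarrow> b \<in> X \<Longrightarrow> a \<noteq> b \<Longrightarrow> E a b" "a \<in> X" "b \<in> X"
    "a \<noteq> b \<or> X = {a}"
  shows "hamilton_path_between X a b"
proof (cases "a = b")
  case True
  then show ?thesis using assms by (intro hamilton_path_betweenI[of "[a]"]) auto
next
  case False
  obtain xs where xs: "set xs = X - {a, b}" "distinct xs"
    using finite_distinct_list[of "X - {a,b}"] assms(1) by auto
  have "successively E (a # xs @ [b])"
    using xs assms False by (intro clique_successively) auto
  then show ?thesis using xs assms False by (intro hamilton_path_betweenI[of "a # xs @ [b]"]) auto
qed

lemma hamilton_path_between_append:
  assumes "hamilton_path_between X a b" "hamilton_path_between Y c d" "E b c" "X \<inter> Y = {}"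
  shows "hamilton_path_between (X \<union> Y) a d"
proof -
  obtain P Q where "P \<noteq> []" "path_on X P" "hd P = a" "last P = b" "Q \<noteq> []" "path_on Y Q" "hd Q = c" "last Q = d"
    using assms unfolding hamilton_path_between_def by blast
  then show ?thesis using assms
    by (intro hamilton_path_betweenI[of "P @ Q"]) (auto simp: path_on_def succ_simps)
qed

text \<open>Each clique is entered at a vertex \<open>e\<close> different from the vertex where it is left,
unless it is a singleton. The vertex \<open>e\<close> can be chosen freely, because it has a parent
in the previous layer, which then serves as the exit there.\<close>
lemma clique_layers_hamilton_path_between:
  assumes fin: "finite X" and u: "u \<in> X" "\<And>c. c \<in> X \<Longrightarrow> l c = (0::nat) \<longleftrightarrow> c = u"
    and par: "\<And>c. c \<in> X \<Longrightarrow> c \<noteq> u \<Longrightarrow> \<exists>p\<in>X. E p c \<and> l c = Suc (l p)"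
    and cl: "\<And>a b. a \<in> X \<Longrightarrow> b \<in> X \<Longrightarrow> l a = l b \<Longrightarrow> a \<noteq> b \<Longrightarrow> E a b"
  shows "c \<in> X \<Longrightarrow> hamilton_path_between {y\<in>X. l y \<le> l c} u c"
proof (induction "l c" arbitrary: c)
  case 0
  then have c: "c = u" and lu: "l u = 0" using u(2)[of c] by auto
  moreover have "{y\<in>X. l y \<le> l c} = {u}" using u unfolding c lu by auto
  ultimately have "{y\<in>X. l y \<le> l c} = {u}" "c = u" by auto
  then show ?case by (intro hamilton_path_betweenI[of "[u]"]) simp_all
next
  case (Suc n)
  let ?L = "{y\<in>X. l y = Suc n}"
  have cL: "c \<in> ?L" using Suc by auto
  obtain e where e: "e \<in> ?L" "e \<noteq> c \<or> ?L = {e}"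
  proof (cases "?L = {c}")
    case False
    then show ?thesis using that cL by blast
  qed (use that cL in blast)
  have "e \<noteq> u" using e u(2)[of u] u(1) by auto
  then obtain p where p: "p \<in> X" "E p e" "l p = n" using par[of e] e by auto
  have "hamilton_path_between {y\<in>X. l y \<le> l p} u p" using Suc(1)[of p] p by auto
  moreover have "hamilton_path_between ?L e c"
    using e Suc fin cl by (intro clique_hamilton_path_between) auto
  moreover have "{y\<in>X. l y \<le> l p} \<inter> ?L = {}" using p by auto
  ultimately have "hamilton_path_between ({y\<in>X. l y \<le> l p} \<union> ?L) u c"
    using hamilton_path_between_append p by blast
  moreover have "{y\<in>X. l y \<le> l p} \<union> ?L = {y\<in>X. l y \<le> l c}" using Suc(2) p by auto
  ultimately show ?case by simp
qed

text \<open>The key local step; \<open>g\<close>, \<open>g'\<close> and \<open>h\<close> lie one and two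
layers behind the parents \<open>p\<close>, \<open>q\<close>. A common parent of \<open>a\<close>
and \<open>b\<close> is the centre of a claw with \<open>a\<close>, \<open>b\<close> and its own
parent. If \<open>p\<close> and \<open>q\<close> are adjacent, then either \<open>g\<close> is a
common parent of them and \<open>p q g\<close> is the triangle of a net, or \<open>p\<close> is the
centre of a claw with leaves \<open>a\<close>, \<open>q\<close>, \<open>g\<close>.\<close>
lemma parents_apart:
  assumes X: "{a, b, p, q, g, g', h} \<subseteq> X"
    and lip: "\<And>x y. x \<in> X \<Longrightarrow> y \<in> X \<Longrightarrow> E x y \<Longrightarrow> \<bar>l x - l y\<bar> \<le> (1::int)"
    and lv: "l b = l a" "l p = l a - 1" "l q = l a - 1" "l g = l a - 2" "l g' = l a - 2" "l h = l a - 3"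
    and ab: "a \<noteq> b" "\<not> E a b" and e: "E a p" "E b q" "E p g" "E q g'" "E g h"
  shows "p \<noteq> q \<and> \<not> E p q"
proof -
  have far: "\<not> E x y" if "x \<in> X" "y \<in> X" "\<bar>l x - l y\<bar> > 1" for x y
    using lip that by force
  have no: "\<not> E g a" "\<not> E g b" "\<not> E g' a" "\<not> E g' b" "\<not> E h a" "\<not> E h b" "\<not> E h p" "\<not> E h q"
    by (rule far; use X lv in simp)+
  have ne: "a \<noteq> g" "b \<noteq> g" "a \<noteq> g'" "b \<noteq> g'" "a \<noteq> q" "b \<noteq> p" "g \<noteq> q" using lv by auto
  have pb: "\<not> E p b" using claw[of p a b g] ab e no ne sym by metis
  have qa: "\<not> E q a" using claw[of q a b g'] ab e no ne sym by metis
  have "\<not> E p q"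
  proof
    assume pq: "E p q"
    show False
    proof (cases "E g q")
      case True
      then show False using net[of g p q h a b] pq e no pb qa ab sym by metis
    next
      case False
      then show False using claw[of p a q g] pq e no qa ne sym by metis
    qed
  qed
  then show ?thesis using pb e sym by blast
qed

lemma successively_reaches:
  assumes "successively E (u # xs)" "set (u # xs) \<subseteq> X" "c \<in> set (u # xs)"
  shows "(\<lambda>a b. E a b \<and> a \<in> X \<and> b \<in> X)\<^sup>*\<^sup>* u c"
  using assms
proof (induction xs arbitrary: u)
  case (Cons y ys)
  show ?case
  proof (cases "c = u")
    case False
    then have "(\<lambda>a b. E a b \<and> a \<in> X \<and> b \<in> X)\<^sup>*\<^sup>* y c"
      using Cons by (auto simp: successively_Cons)
    moreover have "E u y \<and> u \<in> X \<and> y \<in> X" using Cons by (auto simp: successively_Cons)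
    ultimately show ?thesis by (metis (no_types, lifting) converse_rtranclp_into_rtranclp)
  qed simp
qed simp

text \<open>The vertex \<open>x\<close>, attached to \<open>u\<close> only, acts as a layer behind the first
one. It is given level -1 and supplies the parent that \<open>parents_apart\<close> needs behind
\<open>u\<close>.\<close>
lemma layers_are_cliques:
  assumes x: "x \<notin> X" "E u x" "u \<in> X" "\<And>c. c \<in> X \<Longrightarrow> E x c \<Longrightarrow> c = u"
    and l0: "\<And>c. c \<in> X \<Longrightarrow> l c = (0::nat) \<longleftrightarrow> c = u"
    and par: "\<And>c. c \<in> X \<Longrightarrow> c \<noteq> u \<Longrightarrow> \<exists>p\<in>X. E p c \<and> l c = Suc (l p)"
    and lip: "\<And>a b. a \<in> X \<Longrightarrow> b \<in> X \<Longrightarrow> E a b \<Longrightarrow> l b \<le> Suc (l a)"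
  shows "\<And>a b. l a = n \<Longrightarrow> a \<in> X \<Longrightarrow> b \<in> X \<Longrightarrow> l b = n \<Longrightarrow> a \<noteq> b \<Longrightarrow> E a b"
proof (induction n)
  case 0
  then show ?case using l0 by metis
next
  case (Suc n)
  define L where "L y = (if y \<in> X then int (l y) else -1)" for y
  have lip': "\<bar>L y - L z\<bar> \<le> 1" if "y \<in> insert x X" "z \<in> insert x X" "E y z" for y z
  proof -
    have "E z y" using that sym by blast
    then show ?thesis using that lip[of y z] lip[of z y] l0[of z] l0[of y] x irrefl[of x]
      unfolding L_def by (auto dest: x(4))
  qed
  have parent: "\<exists>p\<in>X. E c p \<and> l p = k" if "c \<in> X" "l c = Suc k" for c k
    using par[of c] l0[of c] that sym by force
  show ?case
  proof (rule ccontr)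
    assume nab: "\<not> E a b"
    obtain p q where p: "p \<in> X" "E a p" "l p = n" and q: "q \<in> X" "E b q" "l q = n"
      using parent Suc.prems by metis
    show False
    proof (cases n)
      case 0
      then have "p = u" "q = u" using p q l0 by auto
      moreover have "\<not> E x a" "\<not> E x b" using x(4) Suc.prems l0 by force+
      moreover have "x \<noteq> a" "x \<noteq> b" using Suc.prems x by auto
      ultimately show False
        using claw_clique[of u x a b] nab p q x Suc.prems sym by blast
    next
      case (Suc k)
      obtain g g' where g: "g \<in> X" "E p g" "l g = k" and g': "g' \<in> X" "E q g'" "l g' = k"
        using parent p q Suc by metis
      obtain h where h: "h \<in> insert x X" "E g h" "L h = int k - 1"
      proof (cases k)
        case 0
        then have "g = u" using g l0 by auto
        then show ?thesis using x 0 that[of x] unfolding L_def by auto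
      next
        case (Suc j)
        then obtain h where "h \<in> X" "E g h" "l h = j" using parent g by metis
        then show ?thesis using that[of h] Suc unfolding L_def by auto
      qed
      have "p \<noteq> q \<and> \<not> E p q"
        by (rule parents_apart[of a b p q g g' h "insert x X" L, OF _ lip'])
           (use p q g g' h Suc.prems Suc nab in \<open>auto simp: L_def\<close>)
      then show False using Suc.IH p q by blast
    qed
  qed
qed

section \<open>A longest cycle is a Hamilton cycle\<close>

text \<open>Here \<open>x\<close> and \<open>x'\<close> are the first and the last inner vertex of an ear
(they coincide if there is only one). The layers of \<open>R = C - w\<close> from \<open>u\<close> are
cliques, and the set \<open>Q\<close> of neighbours of \<open>w\<close> in \<open>R\<close> other than
\<open>u\<close> is a clique with levels in \<open>{t - 1, t}\<close> for some \<open>t \<ge> 2\<close>.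
The heart of the proof is that no level exceeds \<open>t\<close>.\<close>
lemma no_cycle_with_clean_ear:
  assumes C: "cycle_on X (u # A @ w # D)" and nh: "\<not> hamilton_path_between X u w"
    and x: "E u x" "x \<notin> X" "\<forall>c\<in>X. E x c \<longrightarrow> c = u \<or> c = w"
    and x': "E w x'" "x' \<notin> X" "\<forall>c\<in>X. E x' c \<longrightarrow> c = u \<or> c = w"
  shows False
proof -
  note n = attachments_apart[OF C nh]
  note d = C[unfolded cycle_on_def path_on_def]
  define R where "R = X - {w}"
  have fin: "finite R" and uR: "u \<in> R" and XR: "X = insert w R" "w \<notin> R" using d unfolding R_def by auto
  have sA: "successively E (u # A)" "set (u # A) \<subseteq> R" using d unfolding R_def by (auto simp: succ_simps)
  have sD: "successively E (u # rev D)" "set (u # rev D) \<subseteq> R"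
    using d sym[of "last D" u] n unfolding R_def by (auto simp: succ_simps)
  have conn: "(\<lambda>a b. E a b \<and> a \<in> R \<and> b \<in> R)\<^sup>*\<^sup>* u c" if "c \<in> R" for c
  proof -
    have "c \<in> set (u # A) \<or> c \<in> set (u # rev D)" using that d unfolding R_def by auto
    then show ?thesis using successively_reaches[OF sA] successively_reaches[OF sD] by blast
  qed
  have "\<exists>l. layering R u l" by (rule distance_layers) (rule conn)
  then obtain l where l: "layering R u l" ..
  note l = l[unfolded layering_def]
  have lu: "l u = 0" using l by blast
  have l0: "l c = 0 \<longleftrightarrow> c = u" if "c \<in> R" for c using l that by metis
  have par: "\<exists>p\<in>R. E p c \<and> l c = Suc (l p)" if "c \<in> R" "c \<noteq> u" for c using l that by blast
  have lip: "l b \<le> Suc (l a)" if "a \<in> R" "b \<in> R" "E a b" for a b using l that by blast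
  have xu: "c = u" if "c \<in> R" "E x c" for c using x that unfolding R_def by auto
  have x'u: "c = u" if "c \<in> R" "E x' c" for c using x' that unfolding R_def by auto
  have xR: "x \<notin> R" "x' \<notin> R" using x x' unfolding R_def by auto
  have cl: "E a b" if "a \<in> R" "b \<in> R" "l a = l b" "a \<noteq> b" for a b
    by (rule layers_are_cliques[where x=x and X=R and u=u and l=l, OF xR(1) x(1) uR xu l0 par lip refl])
       (use that in auto)
  have far: "\<not> E a b" if "a \<in> R" "b \<in> R" "l a \<ge> l b + 2 \<or> l b \<ge> l a + 2" for a b
    using lip[of a b] lip[of b a] sym[of a b] that by force
  have parent: "\<exists>p\<in>R. E c p \<and> E p c \<and> l c = Suc (l p)" if "c \<in> R" "l c > 0" for c
    using par[of c] l0[of c] that sym by fastforce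
  define Q where "Q = {q\<in>R. q \<noteq> u \<and> E w q}"
  have Ql: "l q \<ge> 2" if qQ: "q \<in> Q" for q
  proof (rule ccontr)
    assume "\<not> l q \<ge> 2"
    moreover have "l q > 0" using qQ l0[of q] unfolding Q_def by auto
    ultimately have "l q = 1" by simp
    then obtain p where "p \<in> R" "E p q" "l p = 0" using parent[of q] qQ unfolding Q_def by auto
    then have "E u q" using l0 by auto
    then show False
      using no_common_neighbour[OF C nh x x', of q] qQ unfolding Q_def R_def by auto
  qed
  have hdD: "hd D \<in> Q"
  proof -
    have "hd D \<in> set D" using n by simp
    then have "hd D \<in> R" "hd D \<noteq> u" using d unfolding R_def by auto
    moreover have "E w (hd D)" using d n by (auto simp: succ_simps split: if_splits)
    ultimately show ?thesis unfolding Q_def by auto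
  qed
  have hdA: "hd A \<in> R" "l (hd A) = 1"
  proof -
    have "hd A \<in> set A" using n by simp
    then show *: "hd A \<in> R" using d unfolding R_def by auto
    have "hd A \<noteq> u" using \<open>hd A \<in> set A\<close> d by auto
    moreover have "E u (hd A)" using d n by (auto simp: succ_simps split: if_splits)
    ultimately show "l (hd A) = 1" using lip[OF uR *] l0[OF *] lu by simp
  qed
  have Qcl: "E a b" if "a \<in> Q" "b \<in> Q" "a \<noteq> b" for a b
  proof -
    have "\<not> E x' a" "\<not> E x' b" "x' \<noteq> a" "x' \<noteq> b" using that x'u xR unfolding Q_def by auto
    then show ?thesis using claw_clique[of w x' a b] that x' unfolding Q_def by auto
  qed
  have finQ: "finite Q" using fin unfolding Q_def by auto
  define t where "t = Max (l ` Q)"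
  have Qt: "l q \<le> t" if "q \<in> Q" for q using finQ that unfolding t_def by auto
  obtain q0 where q0: "q0 \<in> Q" "l q0 = t"
    using Max_in[of "l ` Q"] finQ hdD unfolding t_def by fastforce
  have t2: "t \<ge> 2" using Ql q0 by metis
  have low: "l q + 1 \<ge> t" if "q \<in> Q" for q
    using Qcl[OF that q0(1)] far[of q q0] that q0 unfolding Q_def by force
  have notw: "\<not> E w c" if "c \<in> R" "l c > 0" "c \<notin> Q" for c
    using that lu unfolding Q_def by auto
  have top: "l y \<le> t" if y: "y \<in> R" for y
  proof (rule ccontr)
    assume "\<not> l y \<le> t"
    then have "\<exists>d\<in>R. l d = Suc t" using y
    proof (induction "l y" arbitrary: y)
      case (Suc k)
      show ?case
      proof (cases "k = t")
        case False
        obtain p where "p \<in> R" "l y = Suc (l p)" using parent[of y] Suc by auto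
        then show ?thesis using Suc False by auto
      qed (use Suc in auto)
    qed simp
    then obtain d where d: "d \<in> R" "l d = Suc t" by blast
    have Rne: "w \<noteq> c" if "c \<in> R" for c using that unfolding R_def by auto
    have nwd: "\<not> E w d" using notw[of d] d Qt[of d] by auto
    have low_far: "\<not> E w c" if "c \<in> R" "l c > 0" "l c + 2 = t" for c
      using notw[of c] low[of c] that by auto
    show False
    proof (cases "\<exists>q\<in>Q. \<exists>d'\<in>R. l q = t \<and> l d' = Suc t \<and> E q d'")
      case True
      \<comment> \<open>If some \<open>q\<close> in \<open>Q\<close> of level \<open>t\<close> has a child \<open>d'\<close>, then the parent \<open>g\<close> of \<open>q\<close> is in \<open>Q\<close> as well, and the triangle \<open>g q w\<close> has the pendants \<open>gp\<close>, \<open>d'\<close>, \<open>x'\<close>.\<close>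
      then obtain q d' where q: "q \<in> Q" "l q = t" and d': "d' \<in> R" "l d' = Suc t" "E q d'" by blast
      have nwd': "\<not> E w d'" using notw[of d'] d' Qt[of d'] by auto
      have qR: "q \<in> R" "E w q" using q unfolding Q_def by auto
      obtain g where g: "g \<in> R" "E q g" "E g q" "t = Suc (l g)" using parent[of q] qR q t2 by auto
      have "\<not> E d' g" "d' \<noteq> g" using far[of d' g] g d' by auto
      then have wg: "E w g"
        using claw[of q w d' g] qR g d' nwd' Rne sym by metis
      then have gQ: "g \<in> Q" using g t2 lu unfolding Q_def by auto
      then have "l g \<ge> 2" using Ql by blast
      then obtain gp where gp: "gp \<in> R" "E g gp" "l g = Suc (l gp)" using parent[of g] g by auto
      have gpw: "\<not> E w gp" using low_far[of gp] gp g \<open>l g \<ge> 2\<close> by auto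
      have "\<not> E gp q" "\<not> E gp d'" "\<not> E d' g" by (rule far; use gp g q d' qR in simp)+
      moreover have "\<not> E x' g" "\<not> E x' q" "\<not> E x' gp" "\<not> E x' d'"
        using x'u[of g] x'u[of q] x'u[of gp] x'u[of d'] g q gp d' lu \<open>l g \<ge> 2\<close> t2 qR by auto
      ultimately show False
        using net[of g q w gp d' x'] g qR gp d' x'(1) gpw nwd' wg sym by metis
    next
      case False
      then have nochild: "\<not> E q d'" if "q \<in> Q" "l q = t" "d' \<in> R" "l d' = Suc t" for q d'
        using that by blast
      \<comment> \<open>Otherwise the parent \<open>r\<close> of a vertex \<open>d\<close> of level \<open>t + 1\<close> is not adjacent to \<open>w\<close>.\<close>
      obtain r where r: "r \<in> R" "E r d" "l r = t" using parent[of d] d by auto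
      then have "r \<notin> Q" using nochild d by blast
      then have nwr: "\<not> E w r" using notw[of r] r t2 by auto
      obtain q where q: "q \<in> Q" "l q = t" "t = 2 \<Longrightarrow> q = hd D"
      proof (cases "t = 2")
        case True
        then have "l (hd D) = t" using Qt[OF hdD] Ql[OF hdD] by simp
        then show ?thesis using that[of "hd D"] hdD by simp
      next
        case False
        then show ?thesis using that[of q0] q0 by simp
      qed
      have qR: "q \<in> R" "E w q" using q unfolding Q_def by auto
      have qd: "\<not> E q d" using nochild q d by blast
      have "r \<noteq> q" using qd r by auto
      then have qr: "E q r" using cl[of q r] qR r q by auto
      obtain g where g: "g \<in> R" "E q g" "E g q" "t = Suc (l g)" using parent[of q] qR q t2 by auto
      have gd: "\<not> E g d" by (rule far; use g d in simp)
      show False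
      proof (cases "E w g")
        case wg: False
        have "g \<noteq> r" "g \<noteq> w" "w \<noteq> r" using g r Rne by auto
        then have gr: "E g r"
          using claw[of q g w r] g(2) qR(2) qr wg nwr sym by metis
        show False
        \<comment> \<open>The triangle \<open>g q r\<close> has the pendants \<open>w\<close> at \<open>q\<close>, \<open>d\<close> at \<open>r\<close>, and at \<open>g\<close> its parent. For \<open>t = 2\<close> this parent is \<open>u\<close>, which may be adjacent to \<open>w\<close>; then the successor of \<open>u\<close> on the cycle takes its place.\<close>
        proof (cases "t = 2")
          case True
          have "q = hd D" using q True by simp
          then have upq: "\<not> E (hd A) q" using n by simp
          then have "hd A \<noteq> g" using g by auto
          then have upg: "E g (hd A)" using cl[of g "hd A"] hdA g True by auto
          have upd: "\<not> E (hd A) d" using far[of "hd A" d] hdA d True by auto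
          have "hd A \<noteq> q" "hd A \<noteq> d" "q \<noteq> d" using hdA True q d by auto
          then have upr: "\<not> E (hd A) r"
            using claw[of r "hd A" q d] upq upd qd qr r sym by metis
          have "hd A \<notin> Q" using Ql[of "hd A"] hdA by auto
          then have "\<not> E w (hd A)" using notw[of "hd A"] hdA by auto
          then show False
            using net[of g q r "hd A" w d] g gr qr upg qR r upq upr wg nwr gd qd upd nwd sym by metis
        next
          case False
          then obtain gp where gp: "gp \<in> R" "E g gp" "l g = Suc (l gp)" using parent[of g] g t2 by auto
          have "\<not> E w gp" using low_far[of gp] gp g t2 False by auto
          moreover have "\<not> E gp q" "\<not> E gp r" "\<not> E gp d" by (rule far; use gp g q r d qR in simp)+
          ultimately show False
            using net[of g q r gp w d] g gr qr gp qR r wg nwr gd qd nwd sym by metis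
        qed
      next
        case wg: True
        \<comment> \<open>Now \<open>g w q\<close> is a triangle with pendants \<open>gp\<close>, \<open>x'\<close>, \<open>r\<close>.\<close>
        then have gQ: "g \<in> Q" using g t2 lu unfolding Q_def by auto
        then have "l g \<ge> 2" using Ql by blast
        then obtain gp where gp: "gp \<in> R" "E g gp" "l g = Suc (l gp)" using parent[of g] g by auto
        have gpw: "\<not> E w gp" using low_far[of gp] gp g \<open>l g \<ge> 2\<close> by auto
        have gpf: "\<not> E gp r" "\<not> E gp q" by (rule far; use gp g r q qR in simp)+
        have "gp \<noteq> w" "gp \<noteq> r" "w \<noteq> r" using Rne gp g r by auto
        then have gr: "\<not> E g r"
          using claw[of g gp w r] gp gpw gpf nwr wg sym by metis
        have "\<not> E x' g" "\<not> E x' q" "\<not> E x' gp" "\<not> E x' r"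
          using x'u[of g] x'u[of q] x'u[of gp] x'u[of r] g q gp r lu \<open>l g \<ge> 2\<close> t2 qR by auto
        then show False
          using net[of g w q gp x' r] wg qR g gp x'(1) qr gpw gpf gr nwr sym by metis
      qed
    qed
  qed
  have all: "{y\<in>R. l y \<le> l q0} = R" using top q0 by auto
  have q0R: "q0 \<in> R" "E q0 w" using q0 sym[of w q0] unfolding Q_def by auto
  have "hamilton_path_between {y\<in>R. l y \<le> l q0} u q0"
    by (rule clique_layers_hamilton_path_between[of R u l, OF fin uR l0 par cl q0R(1)])
  moreover have "hamilton_path_between {w} w w" by (rule hamilton_path_betweenI[of "[w]"]) auto
  ultimately have "hamilton_path_between (R \<union> {w}) u w"
    using hamilton_path_between_append[of R u q0 "{w}" w w] q0R XR unfolding all by auto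
  then show False using nh XR by simp
qed

text \<open>For a single outer vertex \<open>x\<close>, any two of its neighbours on the cycle are the feet of an
ear, so its neighbours are spread out on the cycle and their successors are independent private
neighbours.\<close>
lemma attachments_of_vertex:
  assumes C: "cycle_on X (u # A @ w # D)" and x: "x \<notin> X" "E x u" "E x w"
    and nh: "\<And>p q. p \<in> X \<Longrightarrow> q \<in> X \<Longrightarrow> E x p \<Longrightarrow> E x q \<Longrightarrow> p \<noteq> q \<Longrightarrow> \<not> hamilton_path_between X p q"
  shows "A \<noteq> []" "D \<noteq> []" "\<not> E (hd A) (hd D)" "\<not> E (hd A) w" "\<not> E (hd D) u"
    "E u (hd A)" "\<not> E x (hd A)" "\<not> E x (hd D)"
proof -
  note d = C[unfolded cycle_on_def path_on_def]
  have "u \<in> X" "w \<in> X" "u \<noteq> w" using d by auto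
  note nhs = nh[OF \<open>u \<in> X\<close> \<open>w \<in> X\<close> x(2,3) \<open>u \<noteq> w\<close>]
  note n = attachments_apart[OF C nhs]
  show ne: "A \<noteq> []" "D \<noteq> []" and ad: "\<not> E (hd A) (hd D)" using n by blast+
  obtain a A' where A: "A = a # A'" using ne by (cases A) auto
  obtain e D' where D: "D = e # D'" using ne by (cases D) auto
  have X: "a \<in> X" "e \<in> X" "a \<noteq> u" "e \<noteq> w" "a \<noteq> w" "e \<noteq> u" "a \<noteq> e" using d A D by auto
  show ua: "E u (hd A)" using d A by auto
  have we: "E w e" using d A D by (auto simp: succ_simps)
  show xa: "\<not> E x (hd A)"
    using attachments_apart(1)[of X u "[]" a "A' @ w # D"] C nh[of u a] X x A \<open>u \<in> X\<close> by auto
  have "cycle_on X (w # [] @ e # (D' @ u # A))"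
    using cycle_rotate[of X "u # A" "w # D"] C D by simp
  then show xe: "\<not> E x (hd D)"
    using attachments_apart(1)[of X w "[]" e "D' @ u # A"] nh[of w e] X x D \<open>w \<in> X\<close> by auto
  have xne: "x \<noteq> a" "x \<noteq> e" using x X by auto
  have ua': "E u a" using ua A by simp
  have ad': "\<not> E a e" using ad A D by simp
  have xa': "\<not> E x a" "\<not> E x e" using xa xe A D by auto
  have xu: "E u x" "E w x" using x sym by blast+
  show "\<not> E (hd A) w"
  proof
    assume "E (hd A) w"
    then have "E w a" using A sym by auto
    then show False using claw_clique[OF xu(2) _ we X(7) xa' xne] ad' by blast
  qed
  show "\<not> E (hd D) u"
  proof
    assume "E (hd D) u"
    then have "E u e" using D sym by auto
    then show False using claw_clique[OF xu(1) ua' _ X(7) xa' xne] ad' by blast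
  qed
qed

text \<open>With three neighbours on a longest cycle, \<open>x\<close>, these neighbours and their successors
contain a claw or a net: which one depends only on the number of edges between the three
neighbours.\<close>
lemma at_most_two_attachments:
  assumes C: "cycle_on X (a # A @ b # B @ c # D)" and x: "x \<notin> X" "E x a" "E x b" "E x c"
    and nh: "\<And>p q. p \<in> X \<Longrightarrow> q \<in> X \<Longrightarrow> E x p \<Longrightarrow> E x q \<Longrightarrow> p \<noteq> q \<Longrightarrow> \<not> hamilton_path_between X p q"
  shows False
proof -
  have C2: "cycle_on X (b # B @ c # (D @ a # A))"
    using cycle_rotate[of X "a # A" "b # B @ c # D"] C by simp
  have C3: "cycle_on X (c # D @ a # (A @ b # B))"
    using cycle_rotate[of X "a # A @ b # B" "c # D"] C by simp
  note f1 = attachments_of_vertex[OF C x(1,2,3) nh]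
  note f2 = attachments_of_vertex[OF C2 x(1,3,4) nh]
  note f3 = attachments_of_vertex[OF C3 x(1,4,2) nh]
  have ne: "A \<noteq> []" "B \<noteq> []" "D \<noteq> []" using f1(1) f2(1) f3(1) by blast+
  define r where "r = hd A"
  define s where "s = hd B"
  define t where "t = hd D"
  have rst: "\<not> E r s" "\<not> E s t" "\<not> E t r" "\<not> E r b" "\<not> E s c" "\<not> E t a" "\<not> E s a" "\<not> E t b" "\<not> E r c"
     "E a r" "E b s" "E c t" "\<not> E x r" "\<not> E x s" "\<not> E x t"
    unfolding r_def s_def t_def using f1 f2 f3 ne by (auto simp: hd_append)
  have "a \<noteq> b" "b \<noteq> c" "a \<noteq> c" using C unfolding cycle_on_def path_on_def by auto
  note ne = this
  note sy = sym[of a b] sym[of b c] sym[of a c] sym[of b a] sym[of c b] sym[of c a] sym[of r s] sym[of s r]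
     sym[of s t] sym[of t s] sym[of t r] sym[of r t] sym[of x r] sym[of r x] sym[of x s] sym[of s x]
     sym[of x t] sym[of t x] sym[of c r] sym[of c s] sym[of a s] sym[of a t] sym[of b r] sym[of b t]
     sym[of x a] sym[of x b] sym[of x c]
  have rne: "r \<noteq> b" "r \<noteq> c" "s \<noteq> a" "s \<noteq> c" "t \<noteq> a" "t \<noteq> b" using rst x by auto
  consider "E a b" "E b c" "E a c" | "E a b" "E b c" "\<not> E a c" | "E a b" "\<not> E b c" "E a c"
    | "E a b" "\<not> E b c" "\<not> E a c" | "\<not> E a b" "E b c" "E a c" | "\<not> E a b" "E b c" "\<not> E a c"
    | "\<not> E a b" "\<not> E b c" "E a c" | "\<not> E a b" "\<not> E b c" "\<not> E a c" by blast
  then show False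
  proof cases
    case 1 then show False using net[of a b c r s t] rst sy by blast
  next
    case 2 then show False using claw[of b s a c] rst sy ne rne by blast
  next
    case 3 then show False using claw[of a r b c] rst sy ne rne by blast
  next
    case 4 then show False using net[of x a b c r s] rst sy x by blast
  next
    case 5 then show False using claw[of c t a b] rst sy ne rne by blast
  next
    case 6 then show False using net[of x b c a s t] rst sy x by blast
  next
    case 7 then show False using net[of x a c b r t] rst sy x by blast
  next
    case 8 then show False using claw[of x a b c] x ne by blast
  qed
qed

definition ear :: "'a set \<Rightarrow> 'a set \<Rightarrow> 'a list \<Rightarrow> 'a \<Rightarrow> 'a \<Rightarrow> bool" where
  "ear V X P a b \<longleftrightarrow> P \<noteq> [] \<and> distinct P \<and> successively E P \<and> set P \<subseteq> V - X \<and>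
     a \<in> X \<and> b \<in> X \<and> a \<noteq> b \<and> E a (hd P) \<and> E (last P) b"

lemma path_to_set:
  assumes "(\<lambda>a b. E a b \<and> a \<in> Y \<and> b \<in> Y)\<^sup>*\<^sup>* x c" "c \<in> X" "x \<notin> X"
  shows "\<exists>P b. P \<noteq> [] \<and> distinct P \<and> successively E P \<and> set P \<subseteq> Y - X \<and> hd P = x \<and> b \<in> X \<inter> Y \<and> E (last P) b"
  using assms
proof (induction rule: converse_rtranclp_induct)
  case (step y z)
  show ?case
  proof (cases "z \<in> X")
    case True
    then show ?thesis using step by (intro exI[of _ "[y]"] exI[of _ z]) auto
  next
    case False
    then obtain P b where P: "P \<noteq> []" "distinct P" "successively E P" "set P \<subseteq> Y - X" "hd P = z"
        "b \<in> X \<inter> Y" "E (last P) b" using step by blast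
    show ?thesis
    proof (cases "y \<in> set P")
      case True
      then obtain P1 P2 where "P = P1 @ y # P2" by (meson split_list)
      then show ?thesis using P by (intro exI[of _ "y # P2"] exI[of _ b]) (auto simp: succ_simps split: if_splits)
    next
      case False
      then show ?thesis using P step by (intro exI[of _ "y # P"] exI[of _ b]) (auto simp: succ_simps)
    qed
  qed
qed simp

lemma linked_crossing:
  assumes "linked V" "X \<subseteq> V" "X \<noteq> {}" "X \<noteq> V"
  obtains c x where "c \<in> X" "x \<in> V - X" "E c x"
proof -
  obtain a b where ab: "a \<in> X" "b \<in> V - X" using assms by blast
  then have "(\<lambda>a b. E a b \<and> a \<in> V \<and> b \<in> V)\<^sup>*\<^sup>* a b" using assms unfolding linked_def by blast
  then have "b \<in> X \<or> (\<exists>c x. c \<in> X \<and> x \<in> V - X \<and> E c x)"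
    by (induction rule: rtranclp_induct) (use ab in auto)
  then show thesis using that ab by blast
qed

text \<open>A longest cycle that misses a vertex has an ear because removing one vertex of the cycle does not
disconnect the graph. In a shortest ear the first and last inner vertices have no neighbours on the
cycle besides the two feet, as otherwise one of them alone would be a shorter ear or have three
neighbours on the cycle.\<close>
theorem finite_hamilton_cycle:
  assumes fin: "finite V" and V2: "card V \<ge> 2" and con: "linked V" "\<And>c. c \<in> V \<Longrightarrow> linked (V - {c})"
  shows "\<exists>Q. cycle_on V Q"
proof -
  define S where "S = {Q. \<exists>X\<subseteq>V. cycle_on X Q}"
  have bound: "length Q \<le> card V" if Q: "Q \<in> S" for Q
  proof -
    obtain X where "X \<subseteq> V" "distinct Q" "set Q = X" using Q unfolding S_def cycle_on_def path_on_def by auto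
    then show ?thesis using card_mono[OF fin, of X] distinct_card[of Q] by simp
  qed
  have "\<exists>Q. Q \<in> S"
  proof -
    obtain c where c: "c \<in> V" using V2 by fastforce
    have "{c} \<noteq> V" using V2 by auto
    then obtain x where x: "x \<in> V" "E c x" using linked_crossing[OF con(1), of "{c}"] c by blast
    then have "cycle_on {c, x} [c, x]" using irrefl[of c] sym[of c x] unfolding cycle_on_def path_on_def by auto
    moreover have "{c, x} \<subseteq> V" using c x by simp
    ultimately have "[c, x] \<in> S" unfolding S_def by (intro CollectI exI[of _ "{c, x}"] conjI)
    then show ?thesis by blast
  qed
  then obtain Q0 where Q0: "Q0 \<in> S" ..
  have "\<forall>Q'. Q' \<in> S \<longrightarrow> length Q' < Suc (card V)" using bound by (simp add: less_Suc_eq_le)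
  from ex_has_greatest_nat[of "\<lambda>Q. Q \<in> S", OF Q0 this]
  obtain Q where Q: "Q \<in> S" "\<And>Q'. Q' \<in> S \<Longrightarrow> length Q' \<le> length Q" by auto
  then obtain X where X: "X \<subseteq> V" "cycle_on X Q" unfolding S_def by blast
  have "X = V"
  proof (rule ccontr)
    assume XV: "X \<noteq> V"
    have lenQ: "length Q = card X" using X distinct_card[of Q] unfolding cycle_on_def path_on_def by auto
    have nh: "\<not> hamilton_path_between X a b" if e: "ear V X P a b" for P a b
    proof
      assume "hamilton_path_between X a b"
      then obtain Q' where Q': "Q' \<noteq> []" "path_on X Q'" "hd Q' = a" "last Q' = b"
        unfolding hamilton_path_between_def by blast
      have len: "length Q' = card X" using Q' distinct_card[of Q'] unfolding path_on_def by auto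
      have "cycle_on (X \<union> set P) (Q' @ rev P)"
        using Q' e len lenQ X sym[of "last P" b] sym[of a "hd P"] unfolding cycle_on_def path_on_def ear_def
        by (auto simp: succ_simps)
      moreover have "X \<union> set P \<subseteq> V" using X e unfolding ear_def by auto
      ultimately have "Q' @ rev P \<in> S" unfolding S_def by blast
      then show False using Q(2) len lenQ e unfolding ear_def by fastforce
    qed
    have X2: "card X \<ge> 2" using X lenQ unfolding cycle_on_def by auto
    obtain c x where cx: "c \<in> X" "x \<in> V - X" "E c x"
    proof (rule linked_crossing[OF con(1) X(1) _ XV])
      show "X \<noteq> {}" using X2 by auto
    qed (rule that)
    have "X \<noteq> {c}" using X2 by auto
    then obtain c1 where c1: "c1 \<in> X" "c1 \<noteq> c" using cx by blast
    have "(\<lambda>a b. E a b \<and> a \<in> V - {c} \<and> b \<in> V - {c})\<^sup>*\<^sup>* x c1"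
      using con(2)[of c] cx c1 X(1) unfolding linked_def by blast
    then obtain P b where "P \<noteq> []" "distinct P" "successively E P" "set P \<subseteq> V - {c} - X"
        "hd P = x" "b \<in> X \<inter> (V - {c})" "E (last P) b"
      using path_to_set[of "V - {c}" x c1 X] c1 cx by blast
    then have "ear V X P c b" using cx unfolding ear_def by auto
    then have "\<exists>a b. ear V X P a b" by blast
    from ex_has_least_nat[of "\<lambda>P. \<exists>a b. ear V X P a b", OF this, of length]
    obtain P where P: "\<exists>a b. ear V X P a b" "\<And>P'. \<exists>a b. ear V X P' a b \<Longrightarrow> length P \<le> length P'" by blast
    then obtain u w where e: "ear V X P u w" by blast
    note ee = e[unfolded ear_def]
    have uw: "u \<in> X" "w \<in> X" "u \<noteq> w" using ee by auto
    obtain A D where C: "cycle_on X (u # A @ w # D)" using cycle_split[OF X(2) uw] .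
    have pX: "hd P \<notin> X" "last P \<notin> X" "hd P \<in> V" "last P \<in> V"
      using ee hd_in_set[of P] last_in_set[of P] by blast+
    have only: "\<forall>c\<in>X. E z c \<longrightarrow> c = u \<or> c = w" if z: "z = hd P \<or> z = last P" for z
    proof (intro ballI impI)
      fix c assume c: "c \<in> X" "E z c"
      show "c = u \<or> c = w"
      proof (rule ccontr)
        assume ne: "\<not> (c = u \<or> c = w)"
        have zV: "z \<in> V - X" using z pX by auto
        have "ear V X [z] u c \<or> ear V X [z] c w"
          using z zV c ne ee sym[of z c] unfolding ear_def by auto
        then have "length P \<le> 1" using P(2)[of "[z]"] by auto
        then have Pz: "P = [z]" using ee z by (cases P) auto
        have nhz: "\<not> hamilton_path_between X p q"
          if "p \<in> X" "q \<in> X" "E z p" "E z q" "p \<noteq> q" for p q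
          using nh[of "[z]" p q] that zV sym[of z p] unfolding ear_def by auto
        have zuw: "E z u" "E z w" using ee Pz sym[of u z] by auto
        have "c \<in> set A \<or> c \<in> set D" using C c ne unfolding cycle_on_def path_on_def by auto
        then show False
        proof
          assume "c \<in> set A"
          then obtain A1 A2 where "A = A1 @ c # A2" by (meson split_list)
          then have "cycle_on X (u # A1 @ c # A2 @ w # D)" using C by simp
          then show False using at_most_two_attachments nhz zV zuw c by blast
        next
          assume "c \<in> set D"
          then obtain D1 D2 where "D = D1 @ c # D2" by (meson split_list)
          then have "cycle_on X (u # A @ w # D1 @ c # D2)" using C by simp
          then show False using at_most_two_attachments nhz zV zuw c by blast
        qed
      qed
    qed
    show False
      by (rule no_cycle_with_clean_ear[OF C nh[OF e], of "hd P" "last P"])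
         (use ee pX only sym[of "last P" w] in auto)
  qed
  then show ?thesis using X by blast
qed

section \<open>Busemann functions\<close>

text \<open>This is Koenig's lemma for the layers given by \<open>l\<close>: a vertex with infinitely many
descendants has a child with infinitely many descendants.\<close>
lemma exists_geodesic_ray:
  assumes EV: "\<And>x y. E x y \<Longrightarrow> x \<in> V \<and> y \<in> V" and lf: "\<And>x. x \<in> V \<Longrightarrow> finite {y. E x y}"
    and inf: "infinite V" and v: "v \<in> V" "l v = (0::nat)"
    and par: "\<And>c. c \<in> V \<Longrightarrow> c \<noteq> v \<Longrightarrow> \<exists>p\<in>V. E p c \<and> l c = Suc (l p)"
  obtains r where "\<And>n. r n \<in> V" "\<And>n. l (r n) = n" "\<And>n. E (r n) (r (Suc n))"
proof -
  define child where "child a b \<longleftrightarrow> E a b \<and> l b = Suc (l a)" for a b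
  define desc where "desc a = {b. child\<^sup>*\<^sup>* a b}" for a
  have "child\<^sup>*\<^sup>* v c" if "c \<in> V" for c
    using that
  proof (induction "l c" arbitrary: c rule: less_induct)
    case less
    show ?case
    proof (cases "c = v")
      case False
      then obtain p where p: "p \<in> V" "E p c" "l c = Suc (l p)" using par less.prems by blast
      then have "child\<^sup>*\<^sup>* v p" "child p c" using less.hyps[of p] unfolding child_def by auto
      then show ?thesis by simp
    qed simp
  qed
  then have infv: "infinite (desc v)" using inf finite_subset[of V "desc v"] unfolding desc_def by blast
  have step: "\<exists>b. child a b \<and> infinite (desc b)" if a: "a \<in> V" "infinite (desc a)" for a
  proof (rule ccontr)
    assume no: "\<not> ?thesis"
    have "desc a \<subseteq> insert a (\<Union>b\<in>{b. child a b}. desc b)"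
      unfolding desc_def by (auto elim: converse_rtranclpE)
    moreover have "finite {b. child a b}"
      using lf[OF a(1)] by (rule finite_subset[rotated]) (auto simp: child_def)
    ultimately have "finite (desc a)" using no by (auto elim: finite_subset)
    then show False using a by simp
  qed
  have "\<exists>r. \<forall>n. (r n \<in> V \<and> l (r n) = n \<and> infinite (desc (r n))) \<and> E (r n) (r (Suc n))"
  proof (rule dependent_nat_choice)
    show "\<exists>x. x \<in> V \<and> l x = 0 \<and> infinite (desc x)" using v infv by blast
    show "\<exists>y. (y \<in> V \<and> l y = Suc n \<and> infinite (desc y)) \<and> E x y"
      if x: "x \<in> V \<and> l x = n \<and> infinite (desc x)" for x n
      using step[of x] x EV unfolding child_def by blast
  qed
  then show thesis using that by blast
qed

text \<open>For a geodesic ray \<open>r\<close>, the integers \<open>d (r n) x - n\<close> do not increase with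
\<open>n\<close> and are bounded below, hence eventually constant; \<open>b x\<close> is their final
value. Following a shortest path from \<open>x\<close> to a vertex \<open>r n\<close> far out on the
ray lowers \<open>b\<close> by one in each step. Vertices of equal level reach a common \<open>r n\<close>
after the same number of steps.\<close>
lemma busemann_function:
  assumes EV: "\<And>x y. E x y \<Longrightarrow> x \<in> V \<and> y \<in> V" and lf: "\<And>x. x \<in> V \<Longrightarrow> finite {y. E x y}"
    and inf: "infinite V" and con: "linked V"
  obtains b :: "'a \<Rightarrow> int" where "\<And>x y. E x y \<Longrightarrow> \<bar>b x - b y\<bar> \<le> 1"
    "\<And>x. x \<in> V \<Longrightarrow> \<exists>p. E x p \<and> b p = b x - 1"
    "\<And>x y. x \<in> V \<Longrightarrow> y \<in> V \<Longrightarrow> b x = b y \<Longrightarrow>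
       \<exists>k z. ((\<lambda>a p. E a p \<and> b p = b a - 1) ^^ k) x z \<and> ((\<lambda>a p. E a p \<and> b p = b a - 1) ^^ k) y z"
proof -
  have "\<forall>u. \<exists>l. u \<in> V \<longrightarrow> layering V u l"
  proof (intro allI)
    fix u
    have "\<exists>l. layering V u l" if "u \<in> V"
      by (rule distance_layers) (use con that in \<open>simp add: linked_def\<close>)
    then show "\<exists>l. u \<in> V \<longrightarrow> layering V u l" by blast
  qed
  from choice[OF this] obtain d where d: "\<And>u. u \<in> V \<Longrightarrow> layering V u (d u)" by blast
  note d' = d[unfolded layering_def]
  have d0: "d u u = 0" "c \<in> V \<Longrightarrow> d u c = 0 \<Longrightarrow> c = u" if "u \<in> V" for u c using d' that by blast+
  have dpar: "\<exists>p\<in>V. E p c \<and> E c p \<and> d u c = Suc (d u p)" if "u \<in> V" "c \<in> V" "c \<noteq> u" for u c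
    using d' that sym by meson
  have dlip: "d u b \<le> Suc (d u a)" if "u \<in> V" "E a b" for u a b using d' that EV[OF that(2)] by blast
  have tri: "d v u \<le> d v c + d u c" if uv: "v \<in> V" "u \<in> V" "c \<in> V" for v u c
    using uv(3)
  proof (induction "d u c" arbitrary: c)
    case 0
    then show ?case using d0(2)[of u c] uv by simp
  next
    case (Suc n)
    then have "c \<noteq> u" using d0(1)[of u] uv by auto
    then obtain p where p: "p \<in> V" "E c p" "d u c = Suc (d u p)" using dpar[of u c] uv Suc.prems by blast
    then have "d v u \<le> d v p + d u p" using Suc.hyps(1)[of p] Suc.hyps(2) by simp
    moreover have "d v p \<le> Suc (d v c)" using dlip uv p by blast
    ultimately show ?case using p by simp
  qed
  have nbr: "d u' c \<le> Suc (d u c)" if uv: "u \<in> V" "E u u'" "c \<in> V" for u u' c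
    using uv(3)
  proof (induction "d u c" arbitrary: c)
    case 0
    then have "c = u" using d0(2)[of u c] uv by simp
    have "d u' u \<le> Suc (d u' u')" using dlip[of u' u' u] EV[OF uv(2)] sym uv by blast
    then show ?case using d0(1)[of u'] EV[OF uv(2)] \<open>c = u\<close> by simp
  next
    case (Suc n)
    then have "c \<noteq> u" using d0(1)[of u] uv by auto
    then obtain p where p: "p \<in> V" "E p c" "d u c = Suc (d u p)" using dpar[of u c] uv Suc.prems by blast
    then have "d u' p \<le> Suc (d u p)" using Suc.hyps(1)[of p] Suc.hyps(2) by simp
    moreover have "d u' c \<le> Suc (d u' p)" using dlip[of u' p c] p EV[OF uv(2)] by blast
    ultimately show ?case using p by simp
  qed
  obtain v where v: "v \<in> V" using inf by fastforce
  obtain r where r: "\<And>n. r n \<in> V" "\<And>n. d v (r n) = n" "\<And>n. E (r n) (r (Suc n))"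
  proof (rule exists_geodesic_ray[OF EV lf inf v, of "d v"])
    show "d v v = 0" using d0 v by blast
    show "\<exists>p\<in>V. E p c \<and> d v c = Suc (d v p)" if "c \<in> V" "c \<noteq> v" for c using dpar[OF v that] by blast
  qed (use that in blast)+
  define f where "f n x = int (d (r n) x) - int n" for n x
  have fmono: "f (n + k) x \<le> f n x" if "x \<in> V" for n k x
  proof (induction k)
    case (Suc k)
    have "d (r (Suc (n + k))) x \<le> Suc (d (r (n + k)) x)" using nbr r that by blast
    then show ?case using Suc unfolding f_def by simp
  qed simp
  have fbound: "f n x \<ge> - int (d v x)" if "x \<in> V" for n x
    using tri[OF v r(1)[of n] that] r(2)[of n] unfolding f_def by simp
  have "\<exists>b. \<exists>N. \<forall>n\<ge>N. f n x = b" if x: "x \<in> V" for x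
  proof -
    have "\<exists>N. \<forall>y. nat (f N x + int (d v x)) \<le> nat (f y x + int (d v x))"
      using ex_has_least_nat[of "\<lambda>_. True" 0 "\<lambda>n. nat (f n x + int (d v x))"] by simp
    then obtain N where N: "nat (f N x + int (d v x)) \<le> nat (f y x + int (d v x))" for y by blast
    have "f n x = f N x" if "n \<ge> N" for n
      using N[of n] fbound[OF x, of n] fbound[OF x, of N] fmono[OF x, of N "n - N"] that by simp
    then show ?thesis by blast
  qed
  then obtain b where b: "\<And>x. x \<in> V \<Longrightarrow> \<exists>N. \<forall>n\<ge>N. f n x = b x" by metis
  have ble: "b x \<le> f n x" if x: "x \<in> V" for x n
  proof -
    obtain N where "\<forall>n\<ge>N. f n x = b x" using b x by blast
    then have "f (n + N) x = b x" by simp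
    then show ?thesis using fmono[OF x, of n N] by simp
  qed
  have blip1: "b y \<le> b x + 1" if e: "E x y" for x y
  proof -
    obtain N where N: "\<forall>n\<ge>N. f n x = b x" using b EV[OF e] by blast
    have "b y \<le> f N y" using ble EV[OF e] by blast
    also have "\<dots> \<le> f N x + 1" using dlip[OF r(1)[of N] e] unfolding f_def by simp
    finally show ?thesis using N by simp
  qed
  have blip: "\<bar>b x - b y\<bar> \<le> 1" if e: "E x y" for x y
    using blip1[OF e] blip1[OF sym[OF e]] by simp
  let ?P = "\<lambda>a p. E a p \<and> b p = b a - 1"
  have step: "\<exists>p\<in>V. ?P x p \<and> f n p = b p \<and> d (r n) x = Suc (d (r n) p)"
    if x: "x \<in> V" "f n x = b x" "x \<noteq> r n" for x n
  proof -
    obtain p where p: "p \<in> V" "E x p" "d (r n) x = Suc (d (r n) p)" using dpar[OF r(1) x(1,3)] by blast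
    then have "f n p = b x - 1" using x(2) unfolding f_def by simp
    moreover have "b p \<le> f n p" using ble p by blast
    moreover have "b x \<le> b p + 1" using blip[OF p(2)] by simp
    ultimately show ?thesis using p by auto
  qed
  have reach: "(?P ^^ d (r n) x) x (r n)" if "x \<in> V" "f n x = b x" for x n
    using that
  proof (induction "d (r n) x" arbitrary: x)
    case 0
    then show ?case using d0(2)[OF r(1)[of n]] by simp
  next
    case (Suc k)
    then have "x \<noteq> r n" using d0(1)[OF r(1)[of n]] by auto
    then obtain p where p: "p \<in> V" "?P x p" "f n p = b p" "d (r n) x = Suc (d (r n) p)"
      using step Suc.prems by blast
    then have "(?P ^^ d (r n) p) p (r n)" using Suc.hyps(1)[of p] Suc.hyps(2) by simp
    then show ?case using relpowp_Suc_I2[of ?P x p "d (r n) p" "r n"] p by auto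
  qed
  show thesis
  proof (rule that)
    show "\<bar>b x - b y\<bar> \<le> 1" if "E x y" for x y using blip that .
    show "\<exists>p. ?P x p" if x: "x \<in> V" for x
    proof -
      obtain N where N: "\<forall>n\<ge>N. f n x = b x" using b x by blast
      obtain n where n: "n \<ge> N" "r n \<noteq> x"
      proof (cases "r N = x")
        case True
        then have "r (Suc N) \<noteq> x" using r(2)[of N] r(2)[of "Suc N"] by auto
        then show ?thesis using that[of "Suc N"] by simp
      qed (use that in blast)
      then show ?thesis using step[of x n] N x by auto
    qed
    show "\<exists>k z. (?P ^^ k) x z \<and> (?P ^^ k) y z" if x: "x \<in> V" "y \<in> V" "b x = b y" for x y
    proof -
      obtain N where N: "\<forall>n\<ge>N. f n x = b x" using b x by blast
      obtain M where M: "\<forall>n\<ge>M. f n y = b y" using b x by blast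
      define n where "n = max N M"
      have n: "f n x = b x" "f n y = b y" using N M unfolding n_def by auto
      then have "d (r n) x = d (r n) y" using x unfolding f_def by simp
      then show ?thesis using reach[OF x(1) n(1)] reach[OF x(2) n(2)] by auto
    qed
  qed
qed

text \<open>Along any two lines of ancestors, distinct non-adjacent vertices of equal level would have distinct
non-adjacent ancestors at all lower levels. But some of these lines meet.\<close>
lemma clique_levels_exist:
  assumes EV: "\<And>x y. E x y \<Longrightarrow> x \<in> V \<and> y \<in> V" and lf: "\<And>x. x \<in> V \<Longrightarrow> finite {y. E x y}"
    and inf: "infinite V" and con: "linked V"
  obtains b :: "'a \<Rightarrow> int" where "\<And>x y. E x y \<Longrightarrow> \<bar>b x - b y\<bar> \<le> 1"
    "\<And>x. x \<in> V \<Longrightarrow> \<exists>p. E x p \<and> b p = b x - 1"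
    "\<And>x y. x \<in> V \<Longrightarrow> y \<in> V \<Longrightarrow> b x = b y \<Longrightarrow> x \<noteq> y \<Longrightarrow> E x y"
proof (rule busemann_function[OF EV lf inf con])
  fix b :: "'a \<Rightarrow> int"
  let ?P = "\<lambda>a p. E a p \<and> b p = b a - 1"
  assume lip: "\<And>x y. E x y \<Longrightarrow> \<bar>b x - b y\<bar> \<le> 1"
    and par: "\<And>x. x \<in> V \<Longrightarrow> \<exists>p. E x p \<and> b p = b x - 1"
    and meet: "\<And>x y. x \<in> V \<Longrightarrow> y \<in> V \<Longrightarrow> b x = b y \<Longrightarrow> \<exists>k z. (?P ^^ k) x z \<and> (?P ^^ k) y z"
  have descend: "x = y \<or> E x y" if "(?P ^^ k) x z" "(?P ^^ k) y z" "x \<in> V" "y \<in> V" "b x = b y" for k x y z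
    using that
  proof (induction k arbitrary: x y)
    case (Suc k)
    obtain p where p: "?P x p" "(?P ^^ k) p z" using relpowp_Suc_D2[OF Suc.prems(1)] by blast
    obtain q where q: "?P y q" "(?P ^^ k) q z" using relpowp_Suc_D2[OF Suc.prems(2)] by blast
    have pqV: "p \<in> V" "q \<in> V" using EV p q by blast+
    have pq: "p = q \<or> E p q" using Suc.IH[OF p(2) q(2) pqV] p q Suc.prems by simp
    obtain g where g: "E p g" "b g = b p - 1" using par pqV by blast
    obtain g' where g': "E q g'" "b g' = b q - 1" using par pqV by blast
    have gV: "g \<in> V" "g' \<in> V" using EV g g' by blast+
    obtain h where h: "E g h" "b h = b g - 1" using par gV by blast
    then have hV: "h \<in> V" using EV by blast
    show ?case
    proof (rule ccontr)
      assume "\<not> (x = y \<or> E x y)"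
      then have "p \<noteq> q \<and> \<not> E p q"
        by (intro parents_apart[of x y p q g g' h V b, OF _ lip])
           (use p q g g' h gV hV pqV Suc.prems in auto)
      then show False using pq by blast
    qed
  qed simp
  show thesis
  proof (rule that)
    show "\<bar>b x - b y\<bar> \<le> 1" if "E x y" for x y using lip that .
    show "\<exists>p. ?P x p" if "x \<in> V" for x using par that .
    show "E x y" if "x \<in> V" "y \<in> V" "b x = b y" "x \<noteq> y" for x y
      using meet[OF that(1,2,3)] descend that by blast
  qed
qed

end

section \<open>Chains of cliques\<close>

locale clique_levels = claw_net_free +
  fixes V :: "'a set" and b :: "'a \<Rightarrow> int"
  assumes EV: "E x y \<Longrightarrow> x \<in> V \<and> y \<in> V"
    and lip: "E x y \<Longrightarrow> \<bar>b x - b y\<bar> \<le> 1"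
    and par: "x \<in> V \<Longrightarrow> \<exists>p. E x p \<and> b p = b x - 1"
    and cl: "\<lbrakk>x \<in> V; y \<in> V; b x = b y; x \<noteq> y\<rbrakk> \<Longrightarrow> E x y"
    and lf: "x \<in> V \<Longrightarrow> finite {y. E x y}"
    and cut: "c \<in> V \<Longrightarrow> linked (V - {c})"
begin

definition level :: "int \<Rightarrow> 'a set" where
  "level k = {x \<in> V. b x = k}"

lemma finite_level: "finite (level k)"
proof (cases "level k = {}")
  case False
  then obtain x where x: "x \<in> level k" by blast
  then have x': "x \<in> V" "b x = k" unfolding level_def by auto
  have "level k \<subseteq> insert x {y. E x y}"
  proof
    fix y assume "y \<in> level k"
    then show "y \<in> insert x {y. E x y}" using cl[of x y] x' unfolding level_def by auto
  qed
  then show ?thesis by (rule finite_subset) (simp add: lf x')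
qed simp

lemma level_down: "level k \<noteq> {} \<Longrightarrow> level (k - 1) \<noteq> {}"
  using par EV unfolding level_def by fastforce

lemma level_downs:
  assumes "level k \<noteq> {}" "j \<le> k"
  shows "level j \<noteq> {}"
  using assms(2)
proof (induction j rule: int_le_induct)
  case base
  then show ?case using assms(1) .
next
  case (step i)
  then show ?case using level_down by blast
qed

lemma crossing_edge:
  assumes "linked Y" "Y \<subseteq> V" "s \<in> Y" "b s \<ge> k" "t \<in> Y" "b t < k"
  shows "\<exists>x\<in>level k \<inter> Y. \<exists>y\<in>level (k - 1) \<inter> Y. E x y"
proof (rule linked_crossing[OF assms(1), of "{x\<in>Y. b x \<ge> k}"])
  show "{x\<in>Y. b x \<ge> k} \<noteq> {}" "{x\<in>Y. b x \<ge> k} \<noteq> Y" using assms by force+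
  fix c x assume "c \<in> {x\<in>Y. b x \<ge> k}" "x \<in> Y - {x\<in>Y. b x \<ge> k}" "E c x"
  moreover from this have "c \<in> level k" "x \<in> level (k - 1)"
    using lip[of c x] assms(2) unfolding level_def by auto
  ultimately show ?thesis by blast
qed auto

text \<open>Two edges from level \<open>k\<close> to the level below it, disjoint except that they may share their
upper vertex if that vertex is a top level by itself.\<close>
definition two_edges :: "int \<Rightarrow> 'a \<Rightarrow> 'a \<Rightarrow> 'a \<Rightarrow> 'a \<Rightarrow> bool" where
  "two_edges k w w' u u' \<longleftrightarrow> w \<in> level k \<and> w' \<in> level k \<and> u \<in> level (k - 1) \<and> u' \<in> level (k - 1) \<and>
     E w u \<and> E w' u' \<and> u \<noteq> u' \<and> (w \<noteq> w' \<or> level k = {w} \<and> level (k + 1) = {})"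

text \<open>If \<open>w u\<close> is one edge between the levels, then deleting \<open>w\<close> or
\<open>u\<close> leaves another edge between the upper and the lower part of the graph. The lower
part always contains a vertex besides \<open>u\<close>, namely a parent of \<open>u\<close>.\<close>
lemma two_edges_exist:
  assumes "level k \<noteq> {}"
  shows "\<exists>w w' u u'. two_edges k w w' u u'"
proof -
  obtain w where w: "w \<in> level k" using assms by blast
  then obtain u where u: "E w u" "b u = k - 1" using par unfolding level_def by force
  then have uV: "u \<in> V" "w \<in> V" using EV by blast+
  obtain g where g: "E u g" "b g = k - 2" using par[OF uV(1)] u by auto
  have gV: "g \<in> V" "g \<noteq> u" using EV g irrefl by blast+
  have wu: "w \<noteq> u" using u irrefl by blast
  have "\<exists>x\<in>level k \<inter> (V - {u}). \<exists>y\<in>level (k - 1) \<inter> (V - {u}). E x y"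
    by (rule crossing_edge[of _ w k g]) (use cut[OF uV(1)] w u uV g gV wu in \<open>auto simp: level_def\<close>)
  then obtain w3 u3 where e3: "E w3 u3" "w3 \<in> level k" "u3 \<in> level (k - 1)" "w3 \<in> V - {u}" "u3 \<in> V - {u}"
    by blast
  have lu: "u \<in> level (k - 1)" using u uV unfolding level_def by simp
  show ?thesis
  proof (cases "w3 = w")
    case False
    then show ?thesis using w u e3 lu unfolding two_edges_def by blast
  next
    case w3: True
    show ?thesis
    proof (cases "\<exists>z\<in>V. b z \<ge> k \<and> z \<noteq> w")
      case True
      then obtain z where z: "z \<in> V" "b z \<ge> k" "z \<noteq> w" by blast
      have "\<exists>x\<in>level k \<inter> (V - {w}). \<exists>y\<in>level (k - 1) \<inter> (V - {w}). E x y"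
        by (rule crossing_edge[of _ z k u]) (use cut[OF uV(2)] z u uV wu in auto)
      then obtain w2 u2 where e2: "E w2 u2" "w2 \<in> level k" "u2 \<in> level (k - 1)" "w2 \<in> V - {w}" "u2 \<in> V - {w}"
        by blast
      show ?thesis
      proof (cases "u2 = u")
        case True
        then have "two_edges k w w2 u3 u" using w u e2 e3 lu w3 unfolding two_edges_def by auto
        then show ?thesis by blast
      next
        case False
        then have "two_edges k w w2 u u2" using w u e2 lu unfolding two_edges_def by auto
        then show ?thesis by blast
      qed
    next
      case False
      then have "level k = {w}" "level (k + 1) = {}" using w unfolding level_def by force+
      then have "two_edges k w w u u3" using w u e3 lu w3 unfolding two_edges_def by auto
      then show ?thesis by blast
    qed
  qed
qed

text \<open>Entering and leaving a level through the same two vertices would leave its other vertices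
uncovered. In that case let \<open>z\<close> be another vertex of the level. By the claw at
\<open>u\<close> with its upper neighbour \<open>n\<close>, its lower neighbour and \<open>z\<close>, one of
the edges at \<open>u\<close> can be moved to \<open>z\<close>. The vertices of the two edges in the
neighbouring levels stay the same, which is why all even levels can be treated at once, and then
all odd ones.\<close>
lemma separate_ends:
  assumes k: "level (k + 1) \<noteq> {}" and up: "two_edges (k + 1) n n' u u'" and dn: "two_edges k w w' p p'"
  obtains v v' x x' where "two_edges (k + 1) n n' v v'" "two_edges k x x' p p'"
    "level k = {v, v'} \<or> {v, v'} \<noteq> {x, x'}"
proof (cases "level k = {u, u'} \<or> {u, u'} \<noteq> {w, w'}")
  case True
  then show ?thesis using that up dn by blast
next
  case False
  have uL: "u \<in> level k" "u' \<in> level k" "E n u" "E n' u'" "u \<noteq> u'" "n \<in> level (k + 1)" using up unfolding two_edges_def by auto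
  have pL: "p \<in> level (k - 1)" "p' \<in> level (k - 1)" "E w p" "E w' p'" using dn unfolding two_edges_def by auto
  obtain z where z: "z \<in> level k" "z \<noteq> u" "z \<noteq> u'" using False uL by blast
  have uw: "{u, u'} = {w, w'}" using False by blast
  have zu: "E u z" using cl z uL unfolding level_def by auto
  show ?thesis
  proof (cases "E n z")
    case True
    have "two_edges (k + 1) n n' z u'" using up z True unfolding two_edges_def by auto
    moreover have "{z, u'} \<noteq> {w, w'}" using uw z by auto
    ultimately show ?thesis using that dn by blast
  next
    case nz: False
    have zq: "E z q" if "q = p \<or> q = p'" "E u q" for q
    proof (rule ccontr)
      assume "\<not> E z q"
      moreover have "\<not> E n q" "n \<noteq> q" using lip[of n q] uL pL that unfolding level_def by auto
      moreover have "n \<noteq> z" "q \<noteq> z" using uL pL z that unfolding level_def by auto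
      ultimately show False
        using claw[of u n q z] sym[OF uL(3)] that(2) zu nz sym[of q z] by blast
    qed
    show ?thesis
    proof (cases "u = w")
      case True
      then have "two_edges k z w' p p'" using dn zq[of p] z pL uw uL unfolding two_edges_def by auto
      moreover have "{u, u'} \<noteq> {z, w'}" using uw z by auto
      ultimately show ?thesis using that up by blast
    next
      case False
      then have "u = w'" using uw by auto
      then have "two_edges k w z p p'" using dn zq[of p'] z pL uw uL unfolding two_edges_def by auto
      moreover have "{u, u'} \<noteq> {w, z}" using uw z by auto
      ultimately show ?thesis using that up by blast
    qed
  qed
qed

text \<open>The vertices \<open>w k\<close>, \<open>w' k\<close> are the feet in level \<open>k\<close> of the
chosen edges to the level below, and \<open>u k\<close>, \<open>u' k\<close> those of the edges to the
level above.\<close>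
definition ladder :: "(int \<Rightarrow> 'a) \<Rightarrow> (int \<Rightarrow> 'a) \<Rightarrow> (int \<Rightarrow> 'a) \<Rightarrow> (int \<Rightarrow> 'a) \<Rightarrow> bool" where
  "ladder w w' u u' \<longleftrightarrow> (\<forall>k. level k \<noteq> {} \<longrightarrow> two_edges k (w k) (w' k) (u (k - 1)) (u' (k - 1)))"

lemma ladder_exists: "\<exists>w w' u u'. ladder w w' u u'"
proof -
  have "\<forall>k. \<exists>f. level k \<noteq> {} \<longrightarrow> two_edges k (fst (fst f)) (snd (fst f)) (fst (snd f)) (snd (snd f))"
    using two_edges_exist by fastforce
  from choice[OF this] obtain f where f: "\<And>k. level k \<noteq> {} \<Longrightarrow>
      two_edges k (fst (fst (f k))) (snd (fst (f k))) (fst (snd (f k))) (snd (snd (f k)))" by blast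
  then have "ladder (\<lambda>k. fst (fst (f k))) (\<lambda>k. snd (fst (f k)))
      (\<lambda>k. fst (snd (f (k + 1)))) (\<lambda>k. snd (snd (f (k + 1))))"
    unfolding ladder_def by simp
  then show ?thesis by blast
qed

definition separated :: "(int \<Rightarrow> 'a) \<Rightarrow> (int \<Rightarrow> 'a) \<Rightarrow> (int \<Rightarrow> 'a) \<Rightarrow> (int \<Rightarrow> 'a) \<Rightarrow> int \<Rightarrow> bool" where
  "separated w w' u u' k \<longleftrightarrow> (level (k + 1) \<noteq> {} \<longrightarrow> level k = {u k, u' k} \<or> {u k, u' k} \<noteq> {w k, w' k})"

text \<open>Since \<open>T\<close> contains no two consecutive levels, every chosen edge is moved at one of its
feet at most, and all these changes are compatible.\<close>
lemma separate_alternate_levels: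
  assumes L: "ladder w w' u u'" and T: "\<And>k. k \<in> T \<Longrightarrow> k - 1 \<notin> T"
  obtains x x' v v' where "ladder x x' v v'" "\<And>k. k \<in> T \<Longrightarrow> separated x x' v v' k"
    "\<And>k. k \<notin> T \<Longrightarrow> x k = w k \<and> x' k = w' k \<and> v k = u k \<and> v' k = u' k"
proof -
  have L': "two_edges k (w k) (w' k) (u (k - 1)) (u' (k - 1))" if "level k \<noteq> {}" for k
    using L that unfolding ladder_def by blast
  define ok where "ok k f \<longleftrightarrow> (case f of ((y, y'), (z, z')) \<Rightarrow>
      two_edges (k + 1) (w (k + 1)) (w' (k + 1)) z z' \<and> two_edges k y y' (u (k - 1)) (u' (k - 1)) \<and>
      (level k = {z, z'} \<or> {z, z'} \<noteq> {y, y'}))" for k f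
  have "\<forall>k. \<exists>f. level (k + 1) \<noteq> {} \<longrightarrow> ok k f"
  proof
    fix k
    show "\<exists>f. level (k + 1) \<noteq> {} \<longrightarrow> ok k f"
    proof (cases "level (k + 1) = {}")
      case False
      then have "level k \<noteq> {}" using level_down[of "k + 1"] by simp
      have "two_edges (k + 1) (w (k + 1)) (w' (k + 1)) (u k) (u' k)" using L'[OF False] by simp
      then obtain z z' y y' where "two_edges (k + 1) (w (k + 1)) (w' (k + 1)) z z'"
          "two_edges k y y' (u (k - 1)) (u' (k - 1))" "level k = {z, z'} \<or> {z, z'} \<noteq> {y, y'}"
        by (rule separate_ends[OF False _ L'[OF \<open>level k \<noteq> {}\<close>]])
      then have "ok k ((y, y'), (z, z'))" unfolding ok_def by simp
      then show ?thesis by blast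
    qed simp
  qed
  from choice[OF this] obtain f where f: "\<And>k. level (k + 1) \<noteq> {} \<Longrightarrow> ok k (f k)" by blast
  define new where "new k \<longleftrightarrow> k \<in> T \<and> level (k + 1) \<noteq> {}" for k
  define x where "x k = (if new k then fst (fst (f k)) else w k)" for k
  define x' where "x' k = (if new k then snd (fst (f k)) else w' k)" for k
  define v where "v k = (if new k then fst (snd (f k)) else u k)" for k
  define v' where "v' k = (if new k then snd (snd (f k)) else u' k)" for k
  have okn: "two_edges (k + 1) (w (k + 1)) (w' (k + 1)) (v k) (v' k)"
      "two_edges k (x k) (x' k) (u (k - 1)) (u' (k - 1))"
      "level k = {v k, v' k} \<or> {v k, v' k} \<noteq> {x k, x' k}" if "new k" for k
  proof -
    have "ok k (f k)" using f that unfolding new_def by blast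
    then show "two_edges (k + 1) (w (k + 1)) (w' (k + 1)) (v k) (v' k)"
      "two_edges k (x k) (x' k) (u (k - 1)) (u' (k - 1))"
      "level k = {v k, v' k} \<or> {v k, v' k} \<noteq> {x k, x' k}"
      using that unfolding ok_def x_def x'_def v_def v'_def by (auto split: prod.splits)
  qed
  have "ladder x x' v v'"
    unfolding ladder_def
  proof (intro allI impI)
    fix k assume k: "level k \<noteq> {}"
    show "two_edges k (x k) (x' k) (v (k - 1)) (v' (k - 1))"
    proof (cases "new k")
      case True
      then have "\<not> new (k - 1)" using T unfolding new_def by blast
      then show ?thesis using okn(2)[OF True] unfolding v_def v'_def by simp
    next
      case nk: False
      show ?thesis
      proof (cases "new (k - 1)")
        case True
        then show ?thesis using okn(1)[OF True] nk unfolding x_def x'_def by simp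
      next
        case False
        then show ?thesis using L'[OF k] nk unfolding x_def x'_def v_def v'_def by simp
      qed
    qed
  qed
  moreover have "separated x x' v v' k" if "k \<in> T" for k
    using okn(3)[of k] that unfolding separated_def new_def by blast
  moreover have "x k = w k \<and> x' k = w' k \<and> v k = u k \<and> v' k = u' k" if "k \<notin> T" for k
    using that unfolding x_def x'_def v_def v'_def new_def by simp
  ultimately show thesis using that by blast
qed

lemma separated_ladder_exists:
  "\<exists>w w' u u'. ladder w w' u u' \<and> (\<forall>k. separated w w' u u' k)"
proof -
  obtain w w' u u' where L: "ladder w w' u u'" using ladder_exists by blast
  obtain x x' v v' where 1: "ladder x x' v v'" "\<And>k. k \<in> {k. even k} \<Longrightarrow> separated x x' v v' k"
    by (rule separate_alternate_levels[OF L, of "{k. even k}"]) auto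
  obtain y y' z z' where 2: "ladder y y' z z'" "\<And>k. k \<in> {k. odd k} \<Longrightarrow> separated y y' z z' k"
    "\<And>k. k \<notin> {k. odd k} \<Longrightarrow> y k = x k \<and> y' k = x' k \<and> z k = v k \<and> z' k = v' k"
    by (rule separate_alternate_levels[OF 1(1), of "{k. odd k}"]) auto
  have "separated y y' z z' k" for k
    using 1(2)[of k] 2(2,3)[of k] unfolding separated_def by (cases "even k") auto
  then show ?thesis using 2(1) by blast
qed

end

text \<open>Discrete integration over all integers, used modulo 2 for a consistent naming of the two strands
and with path lengths for the concatenation of paths.\<close>
lemma int_primitive:
  fixes f :: "int \<Rightarrow> int"
  shows "\<exists>F. \<forall>k. F (k + 1) = F k + f k"
proof -
  define F where "F k = sum f {0..<k} - sum f {k..<0}" for k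
  have "F (k + 1) = F k + f k" for k
  proof (cases "k \<ge> 0")
    case True
    then have "{0..<k + 1} = insert k {0..<k}" by auto
    then show ?thesis using True unfolding F_def by simp
  next
    case False
    then have "{k..<0} = insert k {k + 1..<0}" by auto
    then show ?thesis using False unfolding F_def by simp
  qed
  then show ?thesis by blast
qed

lemma int_parity:
  fixes c :: "int \<Rightarrow> bool"
  shows "\<exists>s. \<forall>k. s k \<longleftrightarrow> (s (k - 1) \<noteq> c k)"
proof -
  obtain F :: "int \<Rightarrow> int" where F: "\<And>k. F (k + 1) = F k + of_bool (c (k + 1))"
    using int_primitive[of "\<lambda>k. of_bool (c (k + 1))"] by blast
  have "odd (F k) \<longleftrightarrow> (odd (F (k - 1)) \<noteq> c k)" for k
    using F[of "k - 1"] by auto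
  then show ?thesis by (intro exI[of _ "\<lambda>k. odd (F k)"]) blast
qed

context clique_levels begin

definition list_path :: "'a list \<Rightarrow> bool" where
  "list_path P \<longleftrightarrow> P \<noteq> [] \<and> distinct P \<and> successively E P"

lemma level_hamilton_path_between:
  assumes "X \<subseteq> level k" "x \<in> X" "y \<in> X" "x \<noteq> y \<or> X = {x}"
  obtains P where "list_path P" "set P = X" "hd P = x" "last P = y"
proof -
  have "hamilton_path_between X x y"
    using assms cl finite_subset[OF assms(1) finite_level]
    by (intro clique_hamilton_path_between) (auto simp: level_def)
  then show thesis using that unfolding hamilton_path_between_def path_on_def list_path_def by blast
qed

lemma split_level:
  assumes k: "level (k + 1) \<noteq> {}" and up: "two_edges (k + 1) n n' u u'" and dn: "two_edges k w w' p p'"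
    and sep: "level k = {u, u'} \<or> {u, u'} \<noteq> {w, w'}"
  obtains P P' where "list_path P" "list_path P'" "set P \<inter> set P' = {}" "set P \<union> set P' = level k"
    "hd P = u" "hd P' = u'" "last P = w \<and> last P' = w' \<or> last P = w' \<and> last P' = w"
proof -
  note found = that
  have main: thesis
    if yy: "y = w \<and> y' = w' \<or> y = w' \<and> y' = w"
      and X: "u \<in> X" "y \<in> X" "u \<noteq> y \<or> X = {u}" "u' \<notin> X" "y' \<notin> X" "X \<subseteq> level k"
      and Y: "u' \<in> level k" "y' \<in> level k" "u' \<noteq> y' \<or> level k - X = {u'}" for X y y'
  proof -
    obtain P where P: "list_path P" "set P = X" "hd P = u" "last P = y"
      by (rule level_hamilton_path_between[of X k u y]) (use X in auto)
    obtain P' where P': "list_path P'" "set P' = level k - X" "hd P' = u'" "last P' = y'"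
      by (rule level_hamilton_path_between[of "level k - X" k u' y']) (use X Y in auto)
    show thesis
      by (rule found[of P P']) (use P P' X yy in auto)
  qed
  have m: "u \<in> level k" "u' \<in> level k" "w \<in> level k" "w' \<in> level k" "u \<noteq> u'" "w \<noteq> w'"
    using up dn k unfolding two_edges_def by simp_all
  have eq: "level k = {u, u'} \<and> (u = w \<and> u' = w' \<or> u = w' \<and> u' = w)" if "{u, u'} = {w, w'}"
    using sep that by (auto simp: doubleton_eq_iff)
  consider "level k = {u, u'}" "u = w" "u' = w'" | "level k = {u, u'}" "u = w'" "u' = w"
    | "{u, u'} \<noteq> {w, w'}" "u = w" | "{u, u'} \<noteq> {w, w'}" "u = w'" | "{u, u'} \<noteq> {w, w'}" "u \<noteq> w" "u \<noteq> w'" "u' = w"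
    | "{u, u'} \<noteq> {w, w'}" "u \<noteq> w" "u \<noteq> w'" "u' = w'"
    | "u \<noteq> w" "u \<noteq> w'" "u' \<noteq> w" "u' \<noteq> w'"
    using eq by blast
  then show thesis
  proof cases
    case 1
    show ?thesis by (rule main[of w "w'" "{u}"]) (use 1 m in auto)
  next
    case 2
    show ?thesis by (rule main[of "w'" w "{u}"]) (use 2 m in auto)
  next
    case 3
    show ?thesis by (rule main[of w "w'" "{u}"]) (use 3 m in auto)
  next
    case 4
    show ?thesis by (rule main[of "w'" w "{u}"]) (use 4 m in auto)
  next
    case 5
    show ?thesis by (rule main[of "w'" w "level k - {u'}"]) (use 5 m in auto)
  next
    case 6
    show ?thesis by (rule main[of w "w'" "level k - {u'}"]) (use 6 m in auto)
  next
    case 7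
    show ?thesis by (rule main[of w "w'" "{u, w}"]) (use 7 m in auto)
  qed
qed

definition strand_pair :: "(int \<Rightarrow> 'a list) \<Rightarrow> (int \<Rightarrow> 'a list) \<Rightarrow> bool" where
  "strand_pair A A' \<longleftrightarrow> (\<forall>k. level (k + 1) \<noteq> {} \<longrightarrow>
     list_path (A k) \<and> list_path (A' k) \<and> set (A k) \<inter> set (A' k) = {} \<and> set (A k) \<union> set (A' k) = level k \<and>
     E (last (A k)) (hd (A (k - 1))) \<and> E (last (A' k)) (hd (A' (k - 1))))"

text \<open>The two paths of a level may lead from \<open>u, u'\<close> to \<open>w, w'\<close> crosswise; the flag
\<open>c k\<close> records this, and \<open>s\<close> is a parity which exchanges the names of the two
paths accordingly. On a top level, which is only left downwards, a single Hamilton path joins the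
two strands.\<close>
theorem strands:
  obtains A A' where "strand_pair A A'"
    "\<And>k. level k \<noteq> {} \<Longrightarrow> level (k + 1) = {} \<Longrightarrow>
       \<exists>T. list_path T \<and> set T = level k \<and> E (hd T) (hd (A' (k - 1))) \<and> E (last T) (hd (A (k - 1)))"
proof -
  obtain w w' u u' where L: "ladder w w' u u'" and sep: "\<And>k. separated w w' u u' k"
    using separated_ladder_exists by blast
  have L': "two_edges k (w k) (w' k) (u (k - 1)) (u' (k - 1))" if "level k \<noteq> {}" for k
    using L that unfolding ladder_def by blast
  define ok where "ok k c P P' \<longleftrightarrow> list_path P \<and> list_path P' \<and> set P \<inter> set P' = {} \<and> set P \<union> set P' = level k \<and>
      hd P = u k \<and> hd P' = u' k \<and> last P = (if c then w' k else w k) \<and> last P' = (if c then w k else w' k)" for k c P P'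
  have "\<forall>k. \<exists>f. level (k + 1) \<noteq> {} \<longrightarrow> ok k (fst f) (fst (snd f)) (snd (snd f))"
  proof
    fix k
    show "\<exists>f. level (k + 1) \<noteq> {} \<longrightarrow> ok k (fst f) (fst (snd f)) (snd (snd f))"
    proof (cases "level (k + 1) = {}")
      case False
      have ne: "level k \<noteq> {}" using level_down[OF False] by simp
      have up: "two_edges (k + 1) (w (k + 1)) (w' (k + 1)) (u k) (u' k)" using L'[OF False] by simp
      obtain P P' where P: "list_path P" "list_path P'" "set P \<inter> set P' = {}" "set P \<union> set P' = level k"
          "hd P = u k" "hd P' = u' k" "last P = w k \<and> last P' = w' k \<or> last P = w' k \<and> last P' = w k"
        by (rule split_level[OF False up L'[OF ne]]) (use sep[of k] False in \<open>auto simp: separated_def\<close>)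
      from P(7) have "ok k False P P' \<or> ok k True P P'" using P(1-6) unfolding ok_def by auto
      then show ?thesis by (metis fst_conv snd_conv)
    qed simp
  qed
  from choice[OF this] obtain f where f: "\<And>k. level (k + 1) \<noteq> {} \<Longrightarrow> ok k (fst (f k)) (fst (snd (f k))) (snd (snd (f k)))"
    by blast
  define c where "c k = fst (f k)" for k
  define P where "P k = fst (snd (f k))" for k
  define P' where "P' k = snd (snd (f k))" for k
  have ok: "ok k (c k) (P k) (P' k)" if "level (k + 1) \<noteq> {}" for k using f that unfolding c_def P_def P'_def by blast
  obtain s where s: "\<And>k. s k \<longleftrightarrow> (s (k - 1) \<noteq> c k)" using int_parity[of c] by blast
  define A where "A k = (if s k then P k else P' k)" for k
  define A' where "A' k = (if s k then P' k else P k)" for k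
  have hds: "hd (P (k - 1)) = u (k - 1)" "hd (P' (k - 1)) = u' (k - 1)"
      "E (w k) (u (k - 1))" "E (w' k) (u' (k - 1))" if k: "level k \<noteq> {}" for k
    using ok[of "k - 1"] L'[OF k] k unfolding ok_def two_edges_def by auto
  show thesis
  proof (rule that)
    show "strand_pair A A'"
      unfolding strand_pair_def
    proof (intro allI impI)
      fix k assume k: "level (k + 1) \<noteq> {}"
      have ne: "level k \<noteq> {}" using level_down[OF k] by simp
      note o = ok[OF k, unfolded ok_def]
      have "E (last (A k)) (hd (A (k - 1)))" "E (last (A' k)) (hd (A' (k - 1)))"
        using o hds[OF ne] s[of k] unfolding A_def A'_def by (cases "s k"; cases "c k"; simp)+
      then show "list_path (A k) \<and> list_path (A' k) \<and> set (A k) \<inter> set (A' k) = {} \<and>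
         set (A k) \<union> set (A' k) = level k \<and> E (last (A k)) (hd (A (k - 1))) \<and> E (last (A' k)) (hd (A' (k - 1)))"
        using o unfolding A_def A'_def by auto
    qed
  next
    fix k assume k: "level k \<noteq> {}" "level (k + 1) = {}"
    note o = L'[OF k(1), unfolded two_edges_def]
    have wne: "w k \<noteq> w' k \<or> level k = {w k}" using o by blast
    show "\<exists>T. list_path T \<and> set T = level k \<and> E (hd T) (hd (A' (k - 1))) \<and> E (last T) (hd (A (k - 1)))"
    proof (cases "s (k - 1)")
      case True
      obtain T where "list_path T" "set T = level k" "hd T = w' k" "last T = w k"
        by (rule level_hamilton_path_between[of "level k" k "w' k" "w k"]) (use o wne in auto)
      then show ?thesis using hds[OF k(1)] True unfolding A_def A'_def by (intro exI[of _ T]) simp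
    next
      case False
      obtain T where "list_path T" "set T = level k" "hd T = w k" "last T = w' k"
        by (rule level_hamilton_path_between[of "level k" k "w k" "w' k"]) (use o wne in auto)
      then show ?thesis using hds[OF k(1)] False unfolding A_def A'_def by (intro exI[of _ T]) simp
    qed
  qed
qed

end

section \<open>Double rays\<close>

lemma int_block:
  fixes F :: "int \<Rightarrow> int"
  assumes "\<And>k. F k < F (k + 1)"
  shows "\<exists>j. F j \<le> i \<and> i < F (j + 1)"
proof (induction i rule: int_induct[where k = "F 0"])
  case base
  then show ?case using assms[of 0] by (intro exI[of _ 0]) simp
next
  case (step1 i)
  then obtain j where j: "F j \<le> i" "i < F (j + 1)" by blast
  show ?case
  proof (cases "i + 1 < F (j + 1)")
    case False
    then show ?thesis using j assms[of "j + 1"] by (intro exI[of _ "j + 1"]) simp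
  qed (use j in force)
next
  case (step2 i)
  then obtain j where j: "F j \<le> i" "i < F (j + 1)" by blast
  show ?case
  proof (cases "F j \<le> i - 1")
    case False
    then show ?thesis using j assms[of "j - 1"] by (intro exI[of _ "j - 1"]) simp
  qed (use j in force)
qed

context claw_net_free begin

text \<open>The function \<open>f\<close> names the path that contains the \<open>i\<close>-th vertex of the double
ray. Its monotonicity and surjectivity say that both tails run through all paths in order, which
later determines their ends.\<close>
lemma concatenate_paths:
  fixes g :: "int \<Rightarrow> 'a list"
  assumes ne: "\<And>j. g j \<noteq> []" and di: "\<And>j. distinct (g j)" and su: "\<And>j. successively E (g j)"
    and disj: "\<And>i j. i \<noteq> j \<Longrightarrow> set (g i) \<inter> set (g j) = {}"
    and link: "\<And>j. E (last (g j)) (hd (g (j + 1)))"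
  obtains h :: "int \<Rightarrow> 'a" and f :: "int \<Rightarrow> int" where "inj h" "\<And>i. E (h i) (h (i + 1))" "range h = (\<Union>j. set (g j))"
    "mono f" "surj f" "\<And>i. h i \<in> set (g (f i))"
proof -
  obtain F where F: "\<And>k. F (k + 1) = F k + int (length (g k))"
    using int_primitive[of "\<lambda>k. int (length (g k))"] by blast
  have len: "length (g k) > 0" for k using ne by simp
  have Fs: "F k < F (k + 1)" for k using F[of k] len[of k] by simp
  have Fmono: "F k \<le> F j" if "k \<le> j" for k j
    using that
  proof (induction j rule: int_ge_induct)
    case (step i)
    then show ?case using Fs[of i] by simp
  qed simp
  have "\<forall>i. \<exists>j. F j \<le> i \<and> i < F (j + 1)" using int_block[of F] Fs by blast
  from choice[OF this] obtain f where f: "\<And>i. F (f i) \<le> i" "\<And>i. i < F (f i + 1)" by blast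
  have fu: "f i = j" if "F j \<le> i" "i < F (j + 1)" for i j
  proof (rule antisym)
    show "f i \<le> j" using Fmono[of "j + 1" "f i"] f(1)[of i] that(2) by fastforce
    show "j \<le> f i" using Fmono[of "f i + 1" j] f(2)[of i] that(1) by fastforce
  qed
  define h where "h i = g (f i) ! nat (i - F (f i))" for i
  have idx: "nat (i - F (f i)) < length (g (f i))" for i
    using f(1)[of i] f(2)[of i] F[of "f i"] by simp
  have hin: "h i \<in> set (g (f i))" for i unfolding h_def using idx by simp
  have at: "h (F j + int m) = g j ! m \<and> f (F j + int m) = j" if "m < length (g j)" for j m
  proof -
    have "f (F j + int m) = j" using that F[of j] by (intro fu) simp_all
    then show ?thesis unfolding h_def by simp
  qed
  show thesis
  proof (rule that)
    show "inj h"
    proof (rule injI)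
      fix x y assume xy: "h x = h y"
      then have e: "f x = f y" using hin[of x] hin[of y] disj[of "f x" "f y"] by auto
      then have "nat (x - F (f x)) = nat (y - F (f x))"
        using xy idx[of x] idx[of y] di[of "f x"] unfolding h_def by (simp add: nth_eq_iff_index_eq)
      then show "x = y" using f(1)[of x] f(1)[of y] e by simp
    qed
    show "E (h i) (h (i + 1))" for i
    proof (cases "i + 1 < F (f i + 1)")
      case True
      define m where "m = nat (i - F (f i))"
      have m: "i = F (f i) + int m" "i + 1 = F (f i) + int (Suc m)" "Suc m < length (g (f i))"
        using True f(1)[of i] F[of "f i"] unfolding m_def by simp_all
      have "h i = g (f i) ! m" using at[of m "f i"] m by simp
      moreover have "h (i + 1) = g (f i) ! Suc m" using at[OF m(3)] m(2) by metis
      ultimately show ?thesis using su[of "f i"] m(3) successively_conv_nth by metis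
    next
      case False
      then have i1: "i + 1 = F (f i + 1)" using f(2)[of i] by simp
      define m where "m = length (g (f i)) - 1"
      have m: "i = F (f i) + int m" "m < length (g (f i))" using i1 F[of "f i"] len[of "f i"] unfolding m_def by (simp_all add: int_ops)
      have "h i = last (g (f i))" using at[OF m(2)] m(1) ne[of "f i"] by (metis last_conv_nth m_def)
      moreover have "h (i + 1) = hd (g (f i + 1))"
        using at[of 0 "f i + 1"] len[of "f i + 1"] i1 ne[of "f i + 1"] by (simp add: hd_conv_nth)
      ultimately show ?thesis using link by simp
    qed
    show "range h = (\<Union>j. set (g j))"
    proof
      show "range h \<subseteq> (\<Union>j. set (g j))" using hin by blast
      show "(\<Union>j. set (g j)) \<subseteq> range h"
      proof
        fix v assume "v \<in> (\<Union>j. set (g j))"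
        then obtain j where "v \<in> set (g j)" by blast
        then obtain m where "m < length (g j)" "v = g j ! m" by (metis in_set_conv_nth)
        then show "v \<in> range h" using at[of m j] by (metis rangeI)
      qed
    qed
    show "mono f"
    proof (rule monoI)
      fix x y :: int assume xy: "x \<le> y"
      show "f x \<le> f y"
      proof (rule ccontr)
        assume "\<not> f x \<le> f y"
        then have "F (f y + 1) \<le> F (f x)" by (intro Fmono) simp
        then show False using xy f(1)[of x] f(2)[of y] by simp
      qed
    qed
    show "surj f"
      using at[of 0] len by (metis surjI add_0_right of_nat_0)
    show "h i \<in> set (g (f i))" for i using hin .
  qed
qed

end

lemma mono_surj_reaches_forward:
  fixes f :: "int \<Rightarrow> int"
  assumes "mono f" "surj f"
  shows "\<exists>J. \<forall>j\<ge>J. \<exists>m\<ge>N. f (int m) = j"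
proof (intro exI[of _ "f (int N) + 1"] allI impI)
  fix j assume j: "f (int N) + 1 \<le> j"
  obtain i where i: "f i = j" using assms(2) by (metis surjD)
  have "int N \<le> i"
  proof (rule ccontr)
    assume "\<not> int N \<le> i"
    then have "f i \<le> f (int N)" using assms(1) by (intro monoD[of f]) simp_all
    then show False using i j by simp
  qed
  then show "\<exists>m\<ge>N. f (int m) = j" using i by (intro exI[of _ "nat i"]) auto
qed

lemma mono_surj_reaches_backward:
  fixes f :: "int \<Rightarrow> int"
  assumes "mono f" "surj f"
  shows "\<exists>J. \<forall>j\<le>J. \<exists>m\<ge>N. f (- int m) = j"
proof -
  have f': "mono (\<lambda>i. - f (- i))" using assms(1) unfolding mono_def by simp
  have "surj (\<lambda>i. - f (- i))"
    using assms(2) by (metis surj_def add.inverse_inverse)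
  from mono_surj_reaches_forward[OF f' this, of N]
  obtain J where J: "\<And>j. j \<ge> J \<Longrightarrow> \<exists>m\<ge>N. - f (- int m) = j" by blast
  have "\<exists>m\<ge>N. f (- int m) = j" if "j \<le> - J" for j
    using J[of "- j"] that by fastforce
  then show ?thesis by blast
qed

context clique_levels begin

text \<open>The strands run downwards, so the paths of a strand are numbered by their negated levels.\<close>
lemma two_double_rays:
  assumes all: "\<And>k. level k \<noteq> {}"
  obtains h h' :: "int \<Rightarrow> 'a" and f f' :: "int \<Rightarrow> int" where "inj h" "inj h'" "range h \<inter> range h' = {}" "range h \<union> range h' = V"
    "\<And>i. E (h i) (h (i + 1))" "\<And>i. E (h' i) (h' (i + 1))"
    "mono f" "surj f" "mono f'" "surj f'" "\<And>i. b (h i) = - f i" "\<And>i. b (h' i) = - f' i"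
proof -
  obtain A A' where "strand_pair A A'" by (rule strands)
  note A = this[unfolded strand_pair_def, rule_format, OF all]
  have lv: "b x = k \<and> x \<in> V" if "x \<in> set (A k) \<or> x \<in> set (A' k)" for x k using A[of k] that unfolding level_def by auto
  have strand: thesis' if B: "\<And>k. list_path (B k)" "\<And>k x. x \<in> set (B k) \<Longrightarrow> b x = k" "\<And>k. E (last (B k)) (hd (B (k - 1)))"
    and t: "\<And>(h :: int \<Rightarrow> 'a) (f :: int \<Rightarrow> int). inj h \<Longrightarrow> (\<And>i. E (h i) (h (i + 1))) \<Longrightarrow> range h = (\<Union>k. set (B k)) \<Longrightarrow>
        mono f \<Longrightarrow> surj f \<Longrightarrow> (\<And>i. b (h i) = - f i) \<Longrightarrow> thesis'" for B thesis'
  proof (rule concatenate_paths[of "\<lambda>j. B (- j)"])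
    show "B (- j) \<noteq> []" "distinct (B (- j))" "successively E (B (- j))" for j
      using B(1)[of "- j"] unfolding list_path_def by auto
    show "set (B (- i)) \<inter> set (B (- j)) = {}" if "i \<noteq> j" for i j
    proof (rule ccontr)
      assume "set (B (- i)) \<inter> set (B (- j)) \<noteq> {}"
      then obtain x where "x \<in> set (B (- i))" "x \<in> set (B (- j))" by blast
      then have "- i = - j" using B(2) by metis
      then show False using that by simp
    qed
    show "E (last (B (- j))) (hd (B (- (j + 1))))" for j using B(3)[of "- j"] by simp
    fix h :: "int \<Rightarrow> 'a" and f :: "int \<Rightarrow> int" assume h: "inj h" "\<And>i. E (h i) (h (i + 1))" "range h = (\<Union>j. set (B (- j)))" "mono f" "surj f"
      "\<And>i. h i \<in> set (B (- f i))"
    have r: "range h = (\<Union>k. set (B k))"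
    proof -
      have "x \<in> (\<Union>j. set (B (- j)))" if "x \<in> set (B k)" for x k
        by (rule UN_I[of "- k"]) (simp_all add: that)
      then have "(\<Union>j. set (B (- j))) = (\<Union>k. set (B k))" by blast
      then show ?thesis using h(3) by simp
    qed
    show thesis' by (rule t[OF h(1,2) r h(4,5)]) (use B(2) h(6) in auto)
  qed
  obtain h :: "int \<Rightarrow> 'a" and f :: "int \<Rightarrow> int" where h: "inj h" "\<And>i. E (h i) (h (i + 1))" "range h = (\<Union>k. set (A k))" "mono f" "surj f" "\<And>i. b (h i) = - f i"
    by (rule strand[of A]) (use A lv in auto)
  obtain h' :: "int \<Rightarrow> 'a" and f' :: "int \<Rightarrow> int" where h': "inj h'" "\<And>i. E (h' i) (h' (i + 1))" "range h' = (\<Union>k. set (A' k))" "mono f'" "surj f'" "\<And>i. b (h' i) = - f' i"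
    by (rule strand[of A']) (use A lv in auto)
  show thesis
  proof (rule that[of h h' f f'])
    show "range h \<inter> range h' = {}"
    proof (rule ccontr)
      assume "range h \<inter> range h' \<noteq> {}"
      then obtain x k k' where x: "x \<in> set (A k)" "x \<in> set (A' k')" using h(3) h'(3) by auto
      then have "k = k'" using lv by metis
      then show False using A[of k] x by auto
    qed
    show "range h \<union> range h' = V"
    proof
      show "range h \<union> range h' \<subseteq> V" using h(3) h'(3) lv by auto
      show "V \<subseteq> range h \<union> range h'"
      proof
        fix x assume "x \<in> V"
        then have "x \<in> level (b x)" unfolding level_def by simp
        then show "x \<in> range h \<union> range h'" using A[of "b x"] h(3) h'(3) by auto
      qed
    qed
  qed (use h h' in auto)
qed

text \<open>The path through the top level has index 0. One strand follows it, and the other one precedes it in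
reverse order.\<close>
lemma one_double_ray:
  assumes top: "level M \<noteq> {}" "level (M + 1) = {}"
  obtains h :: "int \<Rightarrow> 'a" and f :: "int \<Rightarrow> int" where "inj h" "range h = V" "\<And>i. E (h i) (h (i + 1))"
    "mono f" "surj f" "\<And>i. b (h i) = M - \<bar>f i\<bar>"
proof -
  obtain A A' where sp: "strand_pair A A'"
    and T: "\<And>k. level k \<noteq> {} \<Longrightarrow> level (k + 1) = {} \<Longrightarrow>
       \<exists>T. list_path T \<and> set T = level k \<and> E (hd T) (hd (A' (k - 1))) \<and> E (last T) (hd (A (k - 1)))"
    by (rule strands) (rule that, assumption, blast)
  obtain T where T: "list_path T" "set T = level M" "E (hd T) (hd (A' (M - 1)))" "E (last T) (hd (A (M - 1)))"
    using T[OF top] by blast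
  have ne: "level (k + 1) \<noteq> {}" if "k < M" for k using level_downs[OF top(1)] that by simp
  note A = sp[unfolded strand_pair_def, rule_format, OF ne]
  define g where "g j = (if j = 0 then T else if j > 0 then A (M - j) else rev (A' (M + j)))" for j
  have gA: "list_path (g j) \<and> set (g j) \<subseteq> level (M - \<bar>j\<bar>)" for j
    using A[of "M - j"] A[of "M + j"] T unfolding g_def list_path_def by (auto simp: succ_flip)
  show thesis
  proof (rule concatenate_paths[of g])
    show "g j \<noteq> []" "distinct (g j)" "successively E (g j)" for j using gA[of j] unfolding list_path_def by auto
    show "set (g i) \<inter> set (g j) = {}" if "i \<noteq> j" for i j
    proof (rule ccontr)
      assume "set (g i) \<inter> set (g j) \<noteq> {}"
      then obtain x where x: "x \<in> set (g i)" "x \<in> set (g j)" by blast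
      then have "x \<in> level (M - \<bar>i\<bar>)" "x \<in> level (M - \<bar>j\<bar>)" using gA by blast+
      then have "M - \<bar>i\<bar> = M - \<bar>j\<bar>" unfolding level_def by simp
      then have "i = - j" "i \<noteq> 0" using that by auto
      then show False using x A[of "M - i"] A[of "M + i"] unfolding g_def by (auto split: if_splits)
    qed
    show "E (last (g j)) (hd (g (j + 1)))" for j
    proof -
      consider "j > 0" | "j = 0" | "j = -1" | "j < -1" by linarith
      then show ?thesis
      proof cases
        case 1
        then show ?thesis using A[of "M - j"] unfolding g_def by (simp add: algebra_simps)
      next
        case 2
        then show ?thesis using T unfolding g_def by simp
      next
        case 3
        then show ?thesis using T(3) sym unfolding g_def by (simp add: last_rev)
      next
        case 4
        have "E (last (A' (M + (j + 1)))) (hd (A' (M + j)))" using A[of "M + (j + 1)"] 4 by (simp add: algebra_simps)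
        then show ?thesis using 4 sym unfolding g_def by (simp add: last_rev hd_rev)
      qed
    qed
    fix h :: "int \<Rightarrow> 'a" and f :: "int \<Rightarrow> int" assume h: "inj h" "\<And>i. E (h i) (h (i + 1))" "range h = (\<Union>j. set (g j))" "mono f" "surj f"
      "\<And>i. h i \<in> set (g (f i))"
    have "(\<Union>j. set (g j)) = V"
    proof
      show "(\<Union>j. set (g j)) \<subseteq> V" using gA unfolding level_def by blast
      show "V \<subseteq> (\<Union>j. set (g j))"
      proof
        fix x assume x: "x \<in> V"
        have xl: "x \<in> level (b x)" using x unfolding level_def by simp
        have "b x \<le> M"
        proof (rule ccontr)
          assume "\<not> b x \<le> M"
          then show False using level_downs[of "b x" "M + 1"] xl top by auto
        qed
        then consider "b x = M" | "b x < M" by linarith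
        then show "x \<in> (\<Union>j. set (g j))"
        proof cases
          case 1
          then have "x \<in> set (g 0)" using T xl unfolding g_def by simp
          then show ?thesis by blast
        next
          case 2
          then have "x \<in> set (A (b x)) \<or> x \<in> set (A' (b x))" using A[of "b x"] xl by auto
          then have "x \<in> set (g (M - b x)) \<or> x \<in> set (g (b x - M))" using 2 unfolding g_def by simp
          then show ?thesis by blast
        qed
      qed
    qed
    then show thesis using that[of h f] h gA unfolding level_def by blast
  qed
qed

end

section \<open>Closed curves and circles\<close>

text \<open>The map from \<open>[0, 1]\<close> onto the circle is a quotient map, so the curve factors through
the circle; an injective continuous map from a compact to a Hausdorff space is an embedding.\<close>
lemma circle_of_closed_curve:
  fixes f :: "real \<Rightarrow> 'p"
  assumes f: "continuous_map (top_of_set {0..1}) X f" and f01: "f 0 = f 1" and inj: "inj_on f {0..<1}"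
    and X: "Hausdorff_space X"
  shows "top_of_set (sphere (0::complex) 1) homeomorphic_space subtopology X (f ` {0..1})"
proof -
  define e where "e t = cis (2 * pi * t)" for t :: real
  let ?I = "top_of_set {0..1::real}"
  let ?C = "top_of_set (sphere (0::complex) 1)"
  have surj: "e ` {0..1} = sphere 0 1"
  proof
    show "e ` {0..1} \<subseteq> sphere 0 1" unfolding e_def by auto
    show "sphere 0 1 \<subseteq> e ` {0..1}"
    proof
      fix z :: complex assume "z \<in> sphere 0 1"
      then have "cmod z = 1" by simp
      then have "z = cis (Arg2pi z)" using Arg2pi_eq[of z] by (simp add: cis_conv_exp mult.commute)
      then have "z = e (Arg2pi z / (2 * pi))" unfolding e_def by simp
      moreover have "Arg2pi z / (2 * pi) \<in> {0..1}" using Arg2pi_ge_0[of z] Arg2pi_lt_2pi[of z] by simp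
      ultimately show "z \<in> e ` {0..1}" by blast
    qed
  qed
  have cont: "continuous_map ?I ?C e"
    using surj unfolding e_def by (auto intro!: continuous_intros)
  have "quotient_map ?I ?C e"
  proof (rule continuous_closed_imp_quotient_map[OF cont])
    show "closed_map ?I ?C e"
      by (rule continuous_imp_closed_map) (use cont in \<open>auto simp: compact_space_subtopology Hausdorff_space_subtopology\<close>)
    show "e ` topspace ?I = topspace ?C" using surj by simp
  qed
  have same: "f t = f t'" if t: "t \<in> {0..1}" "t' \<in> {0..1}" "e t = e t'" for t t'
  proof -
    have "sin (2 * pi * t) = sin (2 * pi * t') \<and> cos (2 * pi * t) = cos (2 * pi * t')"
      using t(3) unfolding e_def by (simp add: complex_eq_iff)
    then obtain n :: int where "2 * pi * t = 2 * pi * t' + 2 * pi * n"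
      using sin_cos_eq_iff[of "2 * pi * t" "2 * pi * t'"] by blast
    then have "2 * pi * t = 2 * pi * (t' + n)" by (simp add: distrib_left)
    then have n: "t = t' + of_int n" by simp
    then have "-1 \<le> real_of_int n" "real_of_int n \<le> 1" using t by auto
    then have "n = -1 \<or> n = 0 \<or> n = 1" by linarith
    then show ?thesis using n t f01 by auto
  qed
  define g where "g z = f (SOME t. t \<in> {0..1} \<and> e t = z)" for z
  have ge: "g (e t) = f t" if "t \<in> {0..1}" for t
  proof -
    have "\<exists>t'. t' \<in> {0..1} \<and> e t' = e t" using that by blast
    from someI_ex[OF this] show ?thesis unfolding g_def using same that by blast
  qed
  have "continuous_map ?I X (g \<circ> e)"
    by (rule continuous_map_eq[OF f]) (simp add: ge)
  then have gc: "continuous_map ?C X g"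
    using continuous_compose_quotient_map[OF \<open>quotient_map ?I ?C e\<close>] by blast
  have im: "g ` sphere 0 1 = f ` {0..1}" unfolding surj[symmetric] image_image using ge by simp
  have "f ` {0..1} \<subseteq> topspace X" using f by (auto simp: continuous_map_def)
  then have ts: "topspace (subtopology X (f ` {0..1})) = f ` {0..1}" by auto
  have gc': "continuous_map ?C (subtopology X (f ` {0..1})) g"
    using gc im by (simp add: continuous_map_in_subtopology image_subset_iff_funcset[symmetric])
  have gi: "inj_on g (sphere 0 1)"
  proof (rule inj_onI)
    fix y z :: complex assume y: "y \<in> sphere 0 1" "z \<in> sphere 0 1" "g y = g z"
    have "\<exists>t\<in>{0..<1}. e t = w" if w: "w \<in> sphere 0 1" for w
    proof -
      obtain t where t: "t \<in> {0..1}" "w = e t" using w surj by blast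
      show ?thesis
      proof (cases "t = 1")
        case True
        then have "e 0 = w" using t unfolding e_def by simp
        then show ?thesis by force
      qed (use t in force)
    qed
    then obtain s t where st: "s \<in> {0..<1}" "t \<in> {0..<1}" "y = e s" "z = e t" using y by metis
    then have "f s = f t" using y ge by auto
    then have "s = t" using inj st by (simp add: inj_on_eq_iff)
    then show "y = z" using st by simp
  qed
  have "homeomorphic_map ?C (subtopology X (f ` {0..1})) g"
    by (rule continuous_imp_homeomorphic_map[OF gc'])
       (use gi im ts in \<open>auto simp: compact_space_subtopology Hausdorff_space_subtopology X\<close>)
  then show ?thesis by (rule homeomorphic_map_imp_homeomorphic_space)
qed

text \<open>These two functions are inverse bijections between the open unit interval and the real line. They
compactify a curve on the line by its limits at both ends.\<close>
definition line_param :: "real \<Rightarrow> real" where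
  "line_param t = tan (pi * (t - 1/2))"

definition unit_param :: "real \<Rightarrow> real" where
  "unit_param x = arctan x / pi + 1/2"

lemma unit_param_bounds: "0 < unit_param x" "unit_param x < 1"
  using arctan_bounded[of x] unfolding unit_param_def by (auto simp: field_simps)

lemma line_unit_param: "line_param (unit_param x) = x"
  unfolding unit_param_def line_param_def by (simp add: tan_arctan)

lemma unit_line_param: "0 < t \<Longrightarrow> t < 1 \<Longrightarrow> unit_param (line_param t) = t"
  unfolding unit_param_def line_param_def
  by (subst arctan_tan) (auto simp: field_simps)

lemma unit_param_less: "unit_param x < unit_param y \<longleftrightarrow> x < y"
  unfolding unit_param_def by (simp add: divide_less_cancel arctan_less_iff)

lemma continuous_on_line_param: "continuous_on {0<..<1} line_param"
proof -
  have "cos (pi * (t - 1/2)) \<noteq> 0" if "t \<in> {0<..<1}" for t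
  proof -
    have "- (pi/2) < pi * (t - 1/2)" "pi * (t - 1/2) < pi/2" using that by (auto simp: field_simps)
    then show ?thesis using cos_gt_zero_pi by force
  qed
  then show ?thesis unfolding line_param_def by (intro continuous_intros) auto
qed

definition compactified :: "(real \<Rightarrow> 'p) \<Rightarrow> 'p \<Rightarrow> 'p \<Rightarrow> real \<Rightarrow> 'p" where
  "compactified g p q t = (if t \<le> 0 then p else if t \<ge> 1 then q else g (line_param t))"

lemma continuous_map_compactified:
  assumes g: "continuous_map euclideanreal X g" and pq: "p \<in> topspace X" "q \<in> topspace X"
    and p: "\<And>U. openin X U \<Longrightarrow> p \<in> U \<Longrightarrow> \<exists>N. \<forall>t<N. g t \<in> U"
    and q: "\<And>U. openin X U \<Longrightarrow> q \<in> U \<Longrightarrow> \<exists>N. \<forall>t>N. g t \<in> U"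
  shows "continuous_map (top_of_set {0..1}) X (compactified g p q)"
  unfolding continuous_map_def
proof (intro conjI allI impI)
  show "compactified g p q \<in> topspace (top_of_set {0..1}) \<rightarrow> topspace X"
    using g pq unfolding compactified_def continuous_map_def by auto
  fix U assume U: "openin X U"
  let ?P = "{x \<in> topspace (top_of_set {0..1}). compactified g p q x \<in> U}"
  show "openin (top_of_set {0..1}) ?P"
  proof (subst openin_subopen, intro ballI)
    fix t assume "t \<in> ?P"
    then have t: "0 \<le> t" "t \<le> 1" "compactified g p q t \<in> U" by auto
    have "\<exists>T. open T \<and> t \<in> T \<and> T \<inter> {0..1} \<subseteq> ?P"
    proof -
      consider "t = 0" | "t = 1" | "0 < t" "t < 1" using t by linarith
      then show ?thesis
      proof cases
        case 1
        then have "p \<in> U" using t unfolding compactified_def by simp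
        then obtain N where N: "\<forall>t<N. g t \<in> U" using p U by blast
        have "compactified g p q s \<in> U" if "0 \<le> s" "s < unit_param N" for s
        proof (cases "s = 0")
          case False
          then have "line_param s < N"
            using that unit_param_bounds(2)[of N] unit_line_param[of s] unit_param_less[of "line_param s" N] by simp
          then show ?thesis using False that N unit_param_bounds(2)[of N] unfolding compactified_def by simp
        qed (use \<open>p \<in> U\<close> in \<open>simp add: compactified_def\<close>)
        then show ?thesis using 1 unit_param_bounds(1)[of N]
          by (intro exI[of _ "{..<unit_param N}"]) auto
      next
        case 2
        then have "q \<in> U" using t unfolding compactified_def by simp
        then obtain N where N: "\<forall>t>N. g t \<in> U" using q U by blast
        have "compactified g p q s \<in> U" if "s \<le> 1" "s > unit_param N" for s
        proof (cases "s = 1")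
          case False
          then have "line_param s > N"
            using that unit_param_bounds(1)[of N] unit_line_param[of s] unit_param_less[of N "line_param s"] by simp
          then show ?thesis using False that N unit_param_bounds(1)[of N] unfolding compactified_def by simp
        qed (use \<open>q \<in> U\<close> in \<open>simp add: compactified_def\<close>)
        then show ?thesis using 2 unit_param_bounds(2)[of N]
          by (intro exI[of _ "{unit_param N<..}"]) auto
      next
        case 3
        have "open {x. g x \<in> U}" using g U unfolding continuous_map_def by auto
        then have "open ({0<..<1} \<inter> line_param -` {x. g x \<in> U})"
          using continuous_on_line_param by (intro continuous_open_preimage) auto
        moreover have "t \<in> {0<..<1} \<inter> line_param -` {x. g x \<in> U}"
          using 3 t unfolding compactified_def by simp
        moreover have "({0<..<1} \<inter> line_param -` {x. g x \<in> U}) \<inter> {0..1} \<subseteq> ?P"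
          unfolding compactified_def by auto
        ultimately show ?thesis by blast
      qed
    qed
    then obtain T where "open T" "t \<in> T" "T \<inter> {0..1} \<subseteq> ?P" by blast
    then show "\<exists>T'. openin (top_of_set {0..1}) T' \<and> t \<in> T' \<and> T' \<subseteq> ?P"
      using t by (intro exI[of _ "{0..1} \<inter> T"]) (auto simp: openin_open)
  qed
qed

lemma compactified_unit_param: "compactified g p q (unit_param x) = g x"
  using unit_param_bounds[of x] unfolding compactified_def by (simp add: line_unit_param)

lemma line_param_inj: "inj_on line_param {0<..<1}"
  by (rule inj_on_inverseI[of _ unit_param]) (simp add: unit_line_param)

definition two_arcs :: "(real \<Rightarrow> 'p) \<Rightarrow> (real \<Rightarrow> 'p) \<Rightarrow> real \<Rightarrow> 'p" where
  "two_arcs f f' t = (if t \<le> 1/2 then f (2 * t) else f' (2 - 2 * t))"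

lemma continuous_map_two_arcs:
  assumes f: "continuous_map (top_of_set {0..1}) X f" and f': "continuous_map (top_of_set {0..1}) X f'"
    and 1: "f 1 = f' 1"
  shows "continuous_map (top_of_set {0..1}) X (two_arcs f f')"
proof -
  have a: "continuous_map (top_of_set {0..1/2}) X (\<lambda>t. f (2 * t))"
    by (rule continuous_map_compose[OF _ f, unfolded o_def]) (auto intro!: continuous_intros)
  have b: "continuous_map (top_of_set {1/2..1}) X (\<lambda>t. f' (2 - 2 * t))"
    by (rule continuous_map_compose[OF _ f', unfolded o_def]) (auto intro!: continuous_intros)
  have i: "{0..1} \<inter> {0..1/2::real} = {0..1/2}" "{0..1} \<inter> {1/2..1::real} = {1/2..1}"
     "{x \<in> {0..1}. x \<le> 1/2} = {0..1/2::real}" "{x \<in> {0..1}. 1/2 \<le> x} = {1/2..1::real}" by auto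
  have h: "f (2 * t) = f' (2 - 2 * t)" if "t * 2 = 1" for t
  proof -
    have "2 * t = 1" "2 - 2 * t = 1" using that by simp_all
    then show ?thesis using 1 by simp
  qed
  show ?thesis
    unfolding two_arcs_def
    by (rule continuous_map_cases_le[where p = "\<lambda>t. t" and q = "\<lambda>t. 1/2"])
       (use a b h i in \<open>simp_all add: subtopology_subtopology\<close>)
qed

section \<open>The 1-complex\<close>

lemma edge_pt_0: "edge_pt u v 0 = vert_pt u"
  and edge_pt_1: "edge_pt u v 1 = vert_pt v"
  unfolding edge_pt_def by auto

lemma edge_pt_flip: "edge_pt u v t = edge_pt v u (1 - t)"
  unfolding edge_pt_def by auto

lemma edge_pt_apply:
  "u \<noteq> v \<Longrightarrow> edge_pt u v t w = (if w = u then 1 - t else if w = v then t else 0)"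
  unfolding edge_pt_def vert_pt_def by auto

lemma edge_pt_continuous: "continuous_on X (\<lambda>t. edge_pt u v t w)"
  unfolding edge_pt_def by (intro continuous_intros)

lemma simple_graphD:
  assumes "simple_graph G" "{u, v} \<in> edges G"
  shows "u \<in> verts G" "v \<in> verts G" "u \<noteq> v"
  using assms unfolding simple_graph_def by force+

lemma vert_pt_in_complex: "v \<in> verts G \<Longrightarrow> vert_pt v \<in> complex_pts G"
  unfolding complex_pts_def by blast

lemma edge_pt_in_complex: "{u, v} \<in> edges G \<Longrightarrow> 0 \<le> t \<Longrightarrow> t \<le> 1 \<Longrightarrow> edge_pt u v t \<in> complex_pts G"
  unfolding complex_pts_def by blast

lemma complex_pts_support:
  assumes G: "simple_graph G" and p: "p \<in> complex_pts G"
  shows "\<exists>A. finite A \<and> A \<subseteq> verts G \<and> A \<noteq> {} \<and> (\<forall>w. p w > 0 \<longleftrightarrow> w \<in> A) \<and> (\<forall>w. p w \<ge> 0) \<and> (\<Sum>w\<in>A. p w) = 1"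
proof -
  from p consider v where "v \<in> verts G" "p = vert_pt v"
    | u v t where "{u, v} \<in> edges G" "0 \<le> t" "t \<le> 1" "p = edge_pt u v t" unfolding complex_pts_def by blast
  then show ?thesis
  proof cases
    case 1
    then show ?thesis by (intro exI[of _ "{v}"]) (auto simp: vert_pt_def)
  next
    case 2
    note e = simple_graphD[OF G 2(1)]
    have "t = 0 \<or> t = 1 \<or> 0 < t \<and> t < 1" using 2 by auto
    then show ?thesis
    proof (elim disjE)
      assume "t = 0"
      then show ?thesis using 2 e by (intro exI[of _ "{u}"]) (auto simp: edge_pt_0 vert_pt_def)
    next
      assume "t = 1"
      then show ?thesis using 2 e by (intro exI[of _ "{v}"]) (auto simp: edge_pt_1 vert_pt_def)
    next
      assume "0 < t \<and> t < 1"
      then show ?thesis using 2 e by (intro exI[of _ "{u, v}"]) (auto simp: edge_pt_apply)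
    qed
  qed
qed

text \<open>Preimages of open sets under functions that are continuous on every edge are open. Coordinates and
finite sums of coordinates are such functions, and they suffice to separate points.\<close>
lemma complex_open_vimage:
  assumes "\<And>u v. {u, v} \<in> edges G \<Longrightarrow> continuous_on {0..1} (\<lambda>t. \<phi> (edge_pt u v t))" "open U"
  shows "complex_open G {p \<in> complex_pts G. \<phi> p \<in> U}"
  unfolding complex_open_def
proof (intro conjI allI impI)
  fix u v assume e: "{u, v} \<in> edges G"
  have "{t \<in> {0..1}. edge_pt u v t \<in> {p \<in> complex_pts G. \<phi> p \<in> U}} = {0..1} \<inter> (\<lambda>t. \<phi> (edge_pt u v t)) -` U"
    using edge_pt_in_complex[OF e] by auto
  then show "openin (top_of_set {0..1}) {t \<in> {0..1}. edge_pt u v t \<in> {p \<in> complex_pts G. \<phi> p \<in> U}}"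
    using continuous_openin_preimage_gen[OF assms(1)[OF e] assms(2)] by simp
qed auto

section \<open>Components and ends\<close>

lemma conn_rel_equiv: "equiv (verts H) (conn_rel H)"
proof (rule equivI)
  show "conn_rel H \<subseteq> verts H \<times> verts H" "refl_on (verts H) (conn_rel H)"
    unfolding conn_rel_def refl_on_def by auto
  have "sym {(x, y). {x, y} \<in> edges H}"
  proof (rule symI)
    fix x y assume "(x, y) \<in> {(x, y). {x, y} \<in> edges H}"
    then show "(y, x) \<in> {(x, y). {x, y} \<in> edges H}" by (simp add: insert_commute)
  qed
  then have s: "sym ({(x, y). {x, y} \<in> edges H}\<^sup>*)" by (rule sym_rtrancl)
  show "sym (conn_rel H)"
    by (rule symI) (use symD[OF s] in \<open>auto simp: conn_rel_def\<close>)
  show "trans (conn_rel H)"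
    by (rule transI) (auto simp: conn_rel_def)
qed

lemma components_subset: "C \<in> graph_components H \<Longrightarrow> C \<subseteq> verts H"
  unfolding graph_components_def by (rule in_quotient_imp_subset[OF conn_rel_equiv])

lemma components_unique:
  assumes "C \<in> graph_components H" "C' \<in> graph_components H" "x \<in> C" "x \<in> C'"
  shows "C = C'"
  using quotient_disj[OF conn_rel_equiv, of C H C'] assms unfolding graph_components_def by auto

lemma component_exists: "x \<in> verts H \<Longrightarrow> \<exists>C\<in>graph_components H. x \<in> C"
  using Union_quotient[OF conn_rel_equiv[of H]] unfolding graph_components_def by auto

lemma component_closed:
  "\<lbrakk>C \<in> graph_components H; x \<in> C; (x, y) \<in> conn_rel H\<rbrakk> \<Longrightarrow> y \<in> C"
  unfolding graph_components_def by (rule in_quotient_imp_closed[OF conn_rel_equiv])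

lemma verts_delete: "verts (delete_verts G S) = verts G - S"
  and edges_delete: "edges (delete_verts G S) = {e \<in> edges G. e \<subseteq> verts G - S}"
  unfolding delete_verts_def induced_subgraph_def by auto

lemma component_step:
  assumes "simple_graph G" "C \<in> graph_components (delete_verts G S)" "x \<in> C" "{x, y} \<in> edges G" "y \<notin> S"
  shows "y \<in> C"
proof (rule component_closed[OF assms(2,3)])
  have "x \<in> verts G - S" using components_subset[OF assms(2)] assms(3) by (auto simp: verts_delete)
  moreover have "y \<in> verts G - S" using simple_graphD[OF assms(1,4)] assms(5) by simp
  ultimately show "(x, y) \<in> conn_rel (delete_verts G S)"
    using assms(4) unfolding conn_rel_def by (auto simp: verts_delete edges_delete)
qed

lemma ray_leaves_finite_set:
  assumes "r \<in> rays G" "finite S"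
  shows "\<exists>N. \<forall>m\<ge>N. r m \<notin> S"
proof -
  have "finite (r -` S)" using assms unfolding rays_def by (intro finite_vimageI) auto
  then obtain N where "\<And>m. m \<in> r -` S \<Longrightarrow> m < N" by (meson finite_nat_set_iff_bounded)
  then show ?thesis by (intro exI[of _ N]) (metis leD vimageI)
qed

lemma ray_tail_component:
  assumes G: "simple_graph G" and r: "r \<in> rays G" and N: "\<And>m. m \<ge> N \<Longrightarrow> r m \<notin> S"
    and C: "C \<in> graph_components (delete_verts G S)" "r k \<in> C" "k \<ge> N" and m: "m \<ge> N"
  shows "r m \<in> C"
proof -
  have e: "{r i, r (Suc i)} \<in> edges G" for i using r unfolding rays_def by blast
  have up: "r (i + j) \<in> C" if "r i \<in> C" "i \<ge> N" for i j
  proof (induction j)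
    case (Suc j)
    then show ?case using component_step[OF G C(1) Suc e[of "i + j"]] N[of "Suc (i + j)"] that by simp
  qed (use that in simp)
  have down: "r i \<in> C" if "r (i + j) \<in> C" "i \<ge> N" for i j
    using that(1)
  proof (induction j)
    case (Suc j)
    have "{r (Suc (i + j)), r (i + j)} \<in> edges G" using e[of "i + j"] by (simp add: insert_commute)
    then have "r (i + j) \<in> C" using component_step[OF G C(1), of "r (Suc (i + j))" "r (i + j)"] Suc N[of "i + j"] that by simp
    then show ?case using Suc by simp
  qed simp
  show ?thesis
  proof (cases "k \<le> m")
    case True
    then show ?thesis using up[of k "m - k"] C by simp
  next
    case False
    then show ?thesis using down[of m "k - m"] C m by simp
  qed
qed

lemma ray_in_component:
  assumes "simple_graph G" "r \<in> rays G" "finite S"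
  shows "\<exists>C\<in>graph_components (delete_verts G S). has_tail_in r C"
proof -
  obtain N where N: "\<And>m. m \<ge> N \<Longrightarrow> r m \<notin> S" using ray_leaves_finite_set[OF assms(2,3)] by blast
  have "r N \<in> verts (delete_verts G S)" using assms N[of N] unfolding rays_def by (auto simp: verts_delete)
  from component_exists[OF this]
  obtain C where C: "C \<in> graph_components (delete_verts G S)" "r N \<in> C" by blast
  have "r m \<in> C" if "m \<ge> N" for m by (rule ray_tail_component[OF assms(1,2) N C order_refl that])
  then show ?thesis using C unfolding has_tail_in_def by blast
qed

lemma tail_component_unique:
  assumes "C \<in> graph_components H" "C' \<in> graph_components H" "has_tail_in r C" "has_tail_in r C'"
  shows "C = C'"
proof -
  obtain N M where "\<And>m. m \<ge> N \<Longrightarrow> r m \<in> C" "\<And>m. m \<ge> M \<Longrightarrow> r m \<in> C'"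
    using assms unfolding has_tail_in_def by blast
  then have "r (max N M) \<in> C" "r (max N M) \<in> C'" by auto
  then show ?thesis by (rule components_unique[OF assms(1,2)])
qed

lemma ray_equiv_equiv:
  assumes G: "simple_graph G"
  shows "equiv (rays G) (ray_equiv G)"
proof (rule equivI)
  show "ray_equiv G \<subseteq> rays G \<times> rays G" unfolding ray_equiv_def by auto
  show "refl_on (rays G) (ray_equiv G)"
  proof (rule refl_onI)
    fix r assume "r \<in> rays G"
    then have "\<exists>C\<in>graph_components (delete_verts G S). has_tail_in r C" if "finite S" for S
      by (rule ray_in_component[OF G _ that])
    then show "(r, r) \<in> ray_equiv G" using \<open>r \<in> rays G\<close> unfolding ray_equiv_def by blast
  qed
  show "sym (ray_equiv G)" unfolding ray_equiv_def sym_def by blast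
  show "trans (ray_equiv G)"
  proof (rule transI)
    fix r s t assume rs: "(r, s) \<in> ray_equiv G" and st: "(s, t) \<in> ray_equiv G"
    have "\<exists>C\<in>graph_components (delete_verts G S). has_tail_in r C \<and> has_tail_in t C"
      if "finite S" "S \<subseteq> verts G" for S
    proof -
      obtain C where "C \<in> graph_components (delete_verts G S)" "has_tail_in r C" "has_tail_in s C"
        using rs \<open>finite S\<close> \<open>S \<subseteq> verts G\<close> unfolding ray_equiv_def by blast
      moreover obtain C' where "C' \<in> graph_components (delete_verts G S)" "has_tail_in s C'" "has_tail_in t C'"
        using st \<open>finite S\<close> \<open>S \<subseteq> verts G\<close> unfolding ray_equiv_def by blast
      ultimately show ?thesis using tail_component_unique[of C "delete_verts G S" C' s] by auto
    qed
    then show "(r, t) \<in> ray_equiv G" using rs st unfolding ray_equiv_def by blast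
  qed
qed

lemma end_component_eq:
  assumes G: "simple_graph G" and \<omega>: "\<omega> \<in> graph_ends G" "r \<in> \<omega>" and S: "finite S" "S \<subseteq> verts G"
    and C: "C \<in> graph_components (delete_verts G S)" "has_tail_in r C"
  shows "end_component G S \<omega> = C"
  unfolding end_component_def
proof (rule the_equality)
  have "has_tail_in r' C" if r': "r' \<in> \<omega>" for r'
  proof -
    have "(r, r') \<in> ray_equiv G"
      using quotient_eq_iff[OF ray_equiv_equiv[OF G], of \<omega> \<omega> r r'] \<omega> r' unfolding graph_ends_def by blast
    then obtain D where "D \<in> graph_components (delete_verts G S)" "has_tail_in r D" "has_tail_in r' D"
      using S unfolding ray_equiv_def by blast
    then show ?thesis using tail_component_unique[OF C(1) _ C(2), of D] by auto
  qed
  then show "C \<in> graph_components (delete_verts G S) \<and> (\<forall>r\<in>\<omega>. has_tail_in r C)" using C by blast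
  show "D = C" if "D \<in> graph_components (delete_verts G S) \<and> (\<forall>r\<in>\<omega>. has_tail_in r D)" for D
    using tail_component_unique[OF C(1) _ C(2), of D] that \<omega>(2) by auto
qed

lemma end_has_ray:
  assumes "simple_graph G" "\<omega> \<in> graph_ends G"
  obtains r where "r \<in> \<omega>" "r \<in> rays G"
  using that in_quotient_imp_non_empty[OF ray_equiv_equiv[OF assms(1)], of \<omega>]
    in_quotient_imp_subset[OF ray_equiv_equiv[OF assms(1)], of \<omega>] assms(2)
  unfolding graph_ends_def by blast

lemma end_component_component:
  assumes G: "simple_graph G" and \<omega>: "\<omega> \<in> graph_ends G" and S: "finite S" "S \<subseteq> verts G"
  shows "end_component G S \<omega> \<in> graph_components (delete_verts G S)"
    and "r \<in> \<omega> \<Longrightarrow> has_tail_in r (end_component G S \<omega>)"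
proof -
  have *: "end_component G S \<omega> \<in> graph_components (delete_verts G S) \<and> has_tail_in r (end_component G S \<omega>)"
    if r: "r \<in> \<omega>" for r
  proof -
    have "r \<in> rays G" using r \<omega> in_quotient_imp_subset[OF ray_equiv_equiv[OF G], of \<omega>] unfolding graph_ends_def by blast
    then obtain C where C: "C \<in> graph_components (delete_verts G S)" "has_tail_in r C"
      using ray_in_component[OF G _ S(1)] by blast
    then show ?thesis using end_component_eq[OF G \<omega> r S C] by simp
  qed
  obtain r0 where "r0 \<in> \<omega>" by (rule end_has_ray[OF G \<omega>])
  then show "end_component G S \<omega> \<in> graph_components (delete_verts G S)" using * by blast
  show "r \<in> \<omega> \<Longrightarrow> has_tail_in r (end_component G S \<omega>)" using * by blast
qed

definition end_of :: "'a sgraph \<Rightarrow> (nat \<Rightarrow> 'a) \<Rightarrow> (nat \<Rightarrow> 'a) set" where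
  "end_of G r = ray_equiv G `` {r}"

lemma end_of_end:
  assumes "simple_graph G" "r \<in> rays G"
  shows "end_of G r \<in> graph_ends G" "r \<in> end_of G r"
  unfolding graph_ends_def end_of_def
  by (rule quotientI[OF assms(2)], rule equiv_class_self[OF ray_equiv_equiv[OF assms(1)] assms(2)])

lemma end_of_eq_iff:
  assumes "simple_graph G" "r \<in> rays G" "r' \<in> rays G"
  shows "end_of G r = end_of G r' \<longleftrightarrow> (r, r') \<in> ray_equiv G"
  unfolding end_of_def using eq_equiv_class_iff[OF ray_equiv_equiv[OF assms(1)] assms(2,3)] .

text \<open>Beyond a finite set, each ray stays in one component, and infinitely many contacts force these
components to agree.\<close>
lemma ray_equivI:
  assumes G: "simple_graph G" and r: "r \<in> rays G" "r' \<in> rays G"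
    and meet: "\<And>N. \<exists>m\<ge>N. \<exists>n\<ge>N. r m = r' n \<or> {r m, r' n} \<in> edges G"
  shows "(r, r') \<in> ray_equiv G"
proof -
  have "\<exists>C\<in>graph_components (delete_verts G S). has_tail_in r C \<and> has_tail_in r' C" if S: "finite S" "S \<subseteq> verts G" for S
  proof -
    obtain N where N: "\<And>m. m \<ge> N \<Longrightarrow> r m \<notin> S" using ray_leaves_finite_set[OF r(1) S(1)] by blast
    obtain N' where N': "\<And>m. m \<ge> N' \<Longrightarrow> r' m \<notin> S" using ray_leaves_finite_set[OF r(2) S(1)] by blast
    obtain C where C: "C \<in> graph_components (delete_verts G S)" "has_tail_in r C"
      using ray_in_component[OF G r(1) S(1)] by blast
    then obtain M where M: "\<And>m. m \<ge> M \<Longrightarrow> r m \<in> C" unfolding has_tail_in_def by blast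
    obtain m n where mn: "m \<ge> max M (max N N')" "n \<ge> max M (max N N')" "r m = r' n \<or> {r m, r' n} \<in> edges G"
      using meet by blast
    have "r m \<in> C" using M mn by simp
    then have nC: "r' n \<in> C" using component_step[OF G C(1), of "r m" "r' n"] N'[of n] mn by auto
    have "r' k \<in> C" if "k \<ge> N'" for k
      by (rule ray_tail_component[OF G r(2) N' C(1) nC _ that]) (use mn in simp_all)
    then show ?thesis using C unfolding has_tail_in_def by blast
  qed
  then show ?thesis using r unfolding ray_equiv_def by blast
qed

section \<open>The Freudenthal compactification\<close>

lemma Point_in_end_nbhd:
  "Point p \<in> end_nbhd G S \<omega> l \<longleftrightarrow> p \<in> complex_pts (induced_subgraph G (end_component G S \<omega>)) \<union>
    {edge_pt c s t | c s t. c \<in> end_component G S \<omega> \<and> s \<in> S \<and> {c, s} \<in> edges G \<and> 0 \<le> t \<and> t < l {c, s}}"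
proof -
  have "Point p \<in> Point ` A \<longleftrightarrow> p \<in> A" "Point p \<notin> End ` B" for A :: "('a \<Rightarrow> real) set" and B by auto
  then show ?thesis unfolding end_nbhd_def Let_def by simp
qed

text \<open>Checked edge by edge: the neighbourhood contains the whole edge, a half-open part of it, or none of
its points, according to whether two, one or none of its vertices lie in the component. An edge
leaving the component ends in \<open>S\<close>.\<close>
lemma end_nbhd_Point_complex_open:
  assumes G: "simple_graph G" and S: "finite S" "S \<subseteq> verts G" and \<omega>: "\<omega> \<in> graph_ends G"
    and l: "\<And>e. 0 < l e \<and> l e < (1::real)"
  shows "complex_open G {p. Point p \<in> end_nbhd G S \<omega> l}"
proof -
  define C where "C = end_component G S \<omega>"
  have C: "C \<in> graph_components (delete_verts G S)"
    unfolding C_def by (rule end_component_component[OF G \<omega> S])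
  have CV: "C \<subseteq> verts G - S" using components_subset[OF C] by (simp add: verts_delete)
  define P where "P = {p. Point p \<in> end_nbhd G S \<omega> l}"
  have P: "P = complex_pts (induced_subgraph G C) \<union>
      {edge_pt c s t | c s t. c \<in> C \<and> s \<in> S \<and> {c, s} \<in> edges G \<and> 0 \<le> t \<and> t < l {c, s}}"
    unfolding P_def Point_in_end_nbhd C_def[symmetric] by (rule Collect_mem_eq)
  have ind: "complex_pts (induced_subgraph G C) \<subseteq> complex_pts G"
    using CV unfolding complex_pts_def induced_subgraph_def by auto
  have sup: "\<exists>c\<in>C. p c > 0 \<and> (\<forall>w. p w > 0 \<longrightarrow> w \<in> C)" if p: "p \<in> complex_pts (induced_subgraph G C)" for p
  proof -
    have "simple_graph (induced_subgraph G C)" using G unfolding simple_graph_def induced_subgraph_def by auto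
    from complex_pts_support[OF this p] obtain A where "A \<subseteq> verts (induced_subgraph G C)" "A \<noteq> {}"
      "\<And>w. p w > 0 \<longleftrightarrow> w \<in> A" by blast
    moreover have "verts (induced_subgraph G C) = C" by (simp add: induced_subgraph_def)
    ultimately show ?thesis by blast
  qed
  have in_ind: "edge_pt u v t \<in> complex_pts (induced_subgraph G C)"
    if "u \<in> C" "v \<in> C" "{u, v} \<in> edges G" "0 \<le> t" "t \<le> 1" for u v t
    by (rule edge_pt_in_complex) (use that in \<open>auto simp: induced_subgraph_def\<close>)
  have vert_ind: "vert_pt u \<in> P" if "u \<in> C" for u
    unfolding P using vert_pt_in_complex[of u "induced_subgraph G C"] that by (auto simp: induced_subgraph_def)
  have half: "edge_pt c s t \<in> P \<longleftrightarrow> t < l {c, s}" if cs: "c \<in> C" "s \<in> S" "{c, s} \<in> edges G" "0 \<le> t" "t \<le> 1" for c s t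
  proof
    assume "t < l {c, s}"
    then show "edge_pt c s t \<in> P" unfolding P using cs by blast
  next
    have ne: "c \<noteq> s" "s \<notin> C" using CV cs by auto
    assume "edge_pt c s t \<in> P"
    then consider "edge_pt c s t \<in> complex_pts (induced_subgraph G C)"
      | c' s' t' where "edge_pt c s t = edge_pt c' s' t'" "c' \<in> C" "s' \<in> S" "{c', s'} \<in> edges G" "0 \<le> t'" "t' < l {c', s'}"
      unfolding P by blast
    then show "t < l {c, s}"
    proof cases
      case 1
      then have "\<not> edge_pt c s t s > 0" using sup ne by blast
      then have "t = 0" using cs ne by (simp add: edge_pt_apply)
      then show ?thesis using l by simp
    next
      case 2
      have ne': "c' \<noteq> s'" "s' \<notin> C" using CV 2 by auto
      have t': "t' < 1" using 2 l[of "{c', s'}"] by simp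
      have "edge_pt c s t c' = 1 - t'" using 2(1) ne' by (simp add: edge_pt_apply)
      moreover have "c' \<noteq> s" using 2(2) ne by auto
      ultimately have cc: "c' = c" using t' edge_pt_apply[OF ne(1), of t c'] by (auto split: if_splits)
      then have tt: "t = t'" using \<open>edge_pt c s t c' = 1 - t'\<close> ne by (simp add: edge_pt_apply)
      show ?thesis
      proof (cases "s = s'")
        case False
        have "edge_pt c s t s = edge_pt c' s' t' s" using 2(1) by simp
        then have "t = 0" using False ne cc edge_pt_apply[OF ne(1), of t s] edge_pt_apply[OF ne'(1), of t' s] by auto
        then show ?thesis using l by simp
      qed (use 2 cc tt in simp)
    qed
  qed
  have out: "edge_pt u v t \<notin> P" if uv: "u \<notin> C" "v \<notin> C" "{u, v} \<in> edges G" "0 \<le> t" "t \<le> 1" for u v t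
  proof
    note ne = simple_graphD[OF G uv(3)]
    have zero: "edge_pt u v t w = 0" if "w \<in> C" for w using uv ne that by (auto simp: edge_pt_apply)
    assume "edge_pt u v t \<in> P"
    then consider "edge_pt u v t \<in> complex_pts (induced_subgraph G C)"
      | c' s' t' where "edge_pt u v t = edge_pt c' s' t'" "c' \<in> C" "s' \<in> S" "t' < l {c', s'}"
      unfolding P by blast
    then show False
    proof cases
      case 1
      then show False using sup zero by force
    next
      case 2
      then have "edge_pt c' s' t' c' = 0" using zero by metis
      moreover have "c' \<noteq> s'" using CV 2 by auto
      ultimately show False using 2 l[of "{c', s'}"] by (simp add: edge_pt_apply)
    qed
  qed
  have "complex_open G P"
    unfolding complex_open_def
  proof (intro conjI allI impI)
    show "P \<subseteq> complex_pts G"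
    proof -
      have "edge_pt c s t \<in> complex_pts G" if "{c, s} \<in> edges G" "0 \<le> t" "t < l {c, s}" for c s t
        using edge_pt_in_complex[OF that(1,2)] that(3) l[of "{c, s}"] by simp
      then show ?thesis unfolding P using ind by blast
    qed
    fix u v assume e: "{u, v} \<in> edges G"
    then have e': "{v, u} \<in> edges G" by (simp add: insert_commute)
    consider "u \<in> C" "v \<in> C" | "u \<in> C" "v \<in> S" | "u \<in> S" "v \<in> C" | "u \<notin> C" "v \<notin> C"
      using component_step[OF G C _ e] component_step[OF G C _ e'] by blast
    then show "openin (top_of_set {0..1}) {t \<in> {0..1}. edge_pt u v t \<in> P}"
    proof cases
      case 1
      then have "{t \<in> {0..1}. edge_pt u v t \<in> P} = {0..1}" using in_ind[OF 1 e] unfolding P by auto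
      then show ?thesis by (simp only: openin_subtopology_self)
    next
      case 2
      then have "{t \<in> {0..1}. edge_pt u v t \<in> P} = {0..1} \<inter> {..<l {u, v}}" using half[OF 2 e] by auto
      then show ?thesis by (simp only: openin_open_Int[OF open_lessThan])
    next
      case 3
      have "edge_pt u v t \<in> P \<longleftrightarrow> 1 - t < l {u, v}" if "0 \<le> t" "t \<le> 1" for t
        using half[OF 3(2,1) e', of "1 - t"] that edge_pt_flip[of u v t] by (simp add: insert_commute)
      then have "{t \<in> {0..1}. edge_pt u v t \<in> P} = {0..1} \<inter> {1 - l {u, v}<..}" by auto
      then show ?thesis by (simp only: openin_open_Int[OF open_greaterThan])
    next
      case 4
      then have "{t \<in> {0..1}. edge_pt u v t \<in> P} = {}" using out[OF 4 e] by auto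
      then show ?thesis by (simp only: openin_empty)
    qed
  qed
  then show ?thesis unfolding P_def .
qed

definition basic_open :: "'a sgraph \<Rightarrow> 'a fpoint set set" where
  "basic_open G = {Point ` U | U. complex_open G U} \<union>
      {end_nbhd G S \<omega> l | S \<omega> l. finite S \<and> S \<subseteq> verts G \<and> \<omega> \<in> graph_ends G \<and> (\<forall>e. 0 < l e \<and> l e < 1)}"

lemma basic_open_cases:
  assumes "U \<in> basic_open G"
  obtains V where "U = Point ` V" "complex_open G V"
  | S \<omega> l where "U = end_nbhd G S \<omega> l" "finite S" "S \<subseteq> verts G" "\<omega> \<in> graph_ends G" "\<forall>e. 0 < l e \<and> l e < 1"
  using assms unfolding basic_open_def Un_iff mem_Collect_eq by (elim disjE exE conjE)

lemma freudenthal_basic: "freudenthal G = topology_generated_by (basic_open G)"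
  unfolding freudenthal_def basic_open_def by simp

lemma openin_Point: "complex_open G U \<Longrightarrow> openin (freudenthal G) (Point ` U)"
  unfolding freudenthal_basic by (rule topology_generated_by_Basis) (auto simp: basic_open_def)

lemma openin_end_nbhd:
  "\<lbrakk>finite S; S \<subseteq> verts G; \<omega> \<in> graph_ends G; \<And>e. 0 < l e \<and> l e < 1\<rbrakk> \<Longrightarrow> openin (freudenthal G) (end_nbhd G S \<omega> l)"
  unfolding freudenthal_basic basic_open_def by (rule topology_generated_by_Basis, rule UnI2) blast

lemma End_in_end_nbhd:
  "End \<omega>' \<in> end_nbhd G S \<omega> l \<longleftrightarrow> \<omega>' \<in> graph_ends G \<and> end_component G S \<omega>' = end_component G S \<omega>"
  unfolding end_nbhd_def Let_def by auto

lemma topspace_freudenthal: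
  assumes G: "simple_graph G"
  shows "topspace (freudenthal G) = Point ` complex_pts G \<union> End ` graph_ends G"
proof
  have "complex_open G (complex_pts G)"
    using complex_open_vimage[of G "\<lambda>_. 0::real" UNIV] by simp
  then have "openin (freudenthal G) (Point ` complex_pts G)" by (rule openin_Point)
  then have "Point ` complex_pts G \<subseteq> topspace (freudenthal G)" by (rule openin_subset)
  moreover have "End \<omega> \<in> topspace (freudenthal G)" if "\<omega> \<in> graph_ends G" for \<omega>
    using openin_subset[OF openin_end_nbhd[of "{}" G \<omega> "\<lambda>_. 1/2"]] that End_in_end_nbhd[of \<omega> G "{}" \<omega>] by auto
  ultimately show "Point ` complex_pts G \<union> End ` graph_ends G \<subseteq> topspace (freudenthal G)" by blast
  have "U \<subseteq> Point ` complex_pts G \<union> End ` graph_ends G" if U: "U \<in> basic_open G" for U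
  proof
    fix x assume x: "x \<in> U"
    from U show "x \<in> Point ` complex_pts G \<union> End ` graph_ends G"
    proof (cases rule: basic_open_cases)
      case (1 V)
      then show ?thesis using x unfolding complex_open_def by blast
    next
      case (2 S \<omega> l)
      show ?thesis
      proof (cases x)
        case (Point p)
        then have "p \<in> {p. Point p \<in> end_nbhd G S \<omega> l}" using x 2 by simp
        then have "p \<in> complex_pts G"
          using end_nbhd_Point_complex_open[OF G 2(2,3,4), of l] 2(5) unfolding complex_open_def by blast
        then show ?thesis using Point by blast
      next
        case (End \<omega>')
        then show ?thesis using x 2 End_in_end_nbhd[of \<omega>' G S \<omega> l] by auto
      qed
    qed
  qed
  then show "topspace (freudenthal G) \<subseteq> Point ` complex_pts G \<union> End ` graph_ends G"
    unfolding freudenthal_basic by auto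
qed

text \<open>The constant 1/2 makes the neighbourhood disjoint from the points whose coordinates in
\<open>S\<close> have sum greater than 1/2, a neighbourhood of every point supported by \<open>S\<close>.\<close>
lemma end_nbhd_support:
  assumes G: "simple_graph G" and S: "finite S" "S \<subseteq> verts G" and \<omega>: "\<omega> \<in> graph_ends G"
    and p: "Point p \<in> end_nbhd G S \<omega> (\<lambda>_. 1/2)"
  shows "(\<exists>c\<in>end_component G S \<omega>. p c > 0) \<and> (\<forall>w. p w > 0 \<longrightarrow> w \<in> end_component G S \<omega> \<union> S) \<and>
    (\<Sum>s\<in>S. p s) < 1/2"
proof -
  define C where "C = end_component G S \<omega>"
  have "C \<in> graph_components (delete_verts G S)"
    unfolding C_def by (rule end_component_component[OF G \<omega> S])
  then have CV: "C \<subseteq> verts G - S" using components_subset by (metis verts_delete)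
  from p consider "p \<in> complex_pts (induced_subgraph G C)"
    | c s t where "p = edge_pt c s t" "c \<in> C" "s \<in> S" "{c, s} \<in> edges G" "0 \<le> t" "t < 1/2"
    unfolding Point_in_end_nbhd C_def[symmetric] by blast
  then show ?thesis unfolding C_def[symmetric]
  proof cases
    case 1
    have "simple_graph (induced_subgraph G C)" using G unfolding simple_graph_def induced_subgraph_def by auto
    from complex_pts_support[OF this 1] obtain A where "A \<subseteq> verts (induced_subgraph G C)"
      and A': "\<And>w. p w > 0 \<longleftrightarrow> w \<in> A" "\<And>w. p w \<ge> 0" "A \<noteq> {}" by blast
    then have A: "A \<subseteq> C" by (simp add: induced_subgraph_def)
    have "p s = 0" if "s \<in> S" for s
    proof -
      have "s \<notin> A" using A CV that by auto
      then show ?thesis using A'(1)[of s] A'(2)[of s] by simp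
    qed
    then have "(\<Sum>s\<in>S. p s) = 0" by simp
    then show "(\<exists>c\<in>C. p c > 0) \<and> (\<forall>w. p w > 0 \<longrightarrow> w \<in> C \<union> S) \<and> (\<Sum>s\<in>S. p s) < 1/2" using A A' by auto
  next
    case 2
    have ne: "c \<noteq> s" "c \<notin> S" using 2 CV by auto
    have "(\<Sum>x\<in>S. p x) = (\<Sum>x\<in>S. if x = s then t else 0)"
      using ne 2 by (intro sum.cong) (auto simp: edge_pt_apply)
    also have "\<dots> = t" using S 2 by simp
    finally have "(\<Sum>x\<in>S. p x) < 1/2" using 2 by simp
    moreover have "p c > 0" using 2 ne by (simp add: edge_pt_apply)
    moreover have "\<forall>w. p w > 0 \<longrightarrow> w \<in> C \<union> S" using 2 ne by (auto simp: edge_pt_apply)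
    ultimately show "(\<exists>c\<in>C. p c > 0) \<and> (\<forall>w. p w > 0 \<longrightarrow> w \<in> C \<union> S) \<and> (\<Sum>s\<in>S. p s) < 1/2" using 2 by blast
  qed
qed

text \<open>Two points of the 1-complex are separated by a coordinate. A point is separated from an end by
taking its support as the finite set \<open>S\<close>, and two ends by a finite set that puts their
rays into different components.\<close>
lemma Hausdorff_freudenthal:
  assumes G: "simple_graph G"
  shows "Hausdorff_space (freudenthal G)"
proof -
  let ?sep = "\<lambda>x y. \<exists>U V. openin (freudenthal G) U \<and> openin (freudenthal G) V \<and> x \<in> U \<and> y \<in> V \<and> disjnt U V"
  have pp: "?sep (Point p) (Point q)" if pq: "p \<in> complex_pts G" "q \<in> complex_pts G" "p w < q w" for p q w
  proof -
    define c where "c = (p w + q w) / 2"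
    have "complex_open G {x \<in> complex_pts G. x w \<in> {..<c}}" "complex_open G {x \<in> complex_pts G. x w \<in> {c<..}}"
      by (rule complex_open_vimage[of G "\<lambda>x. x w"]; simp add: edge_pt_continuous)+
    then have "openin (freudenthal G) (Point ` {x \<in> complex_pts G. x w \<in> {..<c}})"
       "openin (freudenthal G) (Point ` {x \<in> complex_pts G. x w \<in> {c<..}})" using openin_Point by blast+
    moreover have "Point p \<in> Point ` {x \<in> complex_pts G. x w \<in> {..<c}}" "Point q \<in> Point ` {x \<in> complex_pts G. x w \<in> {c<..}}"
      using pq unfolding c_def by auto
    moreover have "disjnt (Point ` {x \<in> complex_pts G. x w \<in> {..<c}}) (Point ` {x \<in> complex_pts G. x w \<in> {c<..}})"
      by (auto simp: disjnt_def)
    ultimately show ?thesis by blast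
  qed
  have pe: "?sep (Point p) (End \<omega>)" if p: "p \<in> complex_pts G" and \<omega>: "\<omega> \<in> graph_ends G" for p \<omega>
  proof -
    obtain A where A: "finite A" "A \<subseteq> verts G" "(\<Sum>w\<in>A. p w) = 1"
      using complex_pts_support[OF G p] by blast
    have "complex_open G {x \<in> complex_pts G. (\<Sum>w\<in>A. x w) \<in> {1/2<..}}"
      by (rule complex_open_vimage[of G "\<lambda>x. \<Sum>w\<in>A. x w"]) (auto intro!: continuous_intros edge_pt_continuous)
    then have "openin (freudenthal G) (Point ` {x \<in> complex_pts G. (\<Sum>w\<in>A. x w) \<in> {1/2<..}})" using openin_Point by blast
    moreover have "openin (freudenthal G) (end_nbhd G A \<omega> (\<lambda>_. 1/2))"
      by (rule openin_end_nbhd[OF A(1,2) \<omega>]) simp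
    moreover have "Point p \<in> Point ` {x \<in> complex_pts G. (\<Sum>w\<in>A. x w) \<in> {1/2<..}}" using A p by auto
    moreover have "End \<omega> \<in> end_nbhd G A \<omega> (\<lambda>_. 1/2)" using \<omega> by (simp add: End_in_end_nbhd)
    moreover have "disjnt (Point ` {x \<in> complex_pts G. (\<Sum>w\<in>A. x w) \<in> {1/2<..}}) (end_nbhd G A \<omega> (\<lambda>_. 1/2))"
      unfolding disjnt_def using end_nbhd_support[OF G A(1,2) \<omega>] by fastforce
    ultimately show ?thesis by blast
  qed
  have ee: "?sep (End \<omega>) (End \<omega>')" if \<omega>: "\<omega> \<in> graph_ends G" "\<omega>' \<in> graph_ends G" "\<omega> \<noteq> \<omega>'" for \<omega> \<omega>'
  proof -
    obtain r where r: "r \<in> \<omega>" "r \<in> rays G" by (rule end_has_ray[OF G \<omega>(1)])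
    obtain r' where r': "r' \<in> \<omega>'" "r' \<in> rays G" by (rule end_has_ray[OF G \<omega>(2)])
    have "(r, r') \<notin> ray_equiv G"
      using quotient_eq_iff[OF ray_equiv_equiv[OF G], of \<omega> \<omega>' r r'] \<omega> r r' unfolding graph_ends_def by blast
    then obtain S where S: "finite S" "S \<subseteq> verts G"
      and no: "\<not> (\<exists>C\<in>graph_components (delete_verts G S). has_tail_in r C \<and> has_tail_in r' C)"
      using r r' unfolding ray_equiv_def by blast
    define C where "C = end_component G S \<omega>"
    define C' where "C' = end_component G S \<omega>'"
    have C: "C \<in> graph_components (delete_verts G S)" "has_tail_in r C"
      unfolding C_def using end_component_component[OF G \<omega>(1) S] r by blast+
    have C': "C' \<in> graph_components (delete_verts G S)" "has_tail_in r' C'"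
      unfolding C'_def using end_component_component[OF G \<omega>(2) S] r' by blast+
    have "C \<noteq> C'" using C C' no by blast
    then have dis: "C \<inter> C' = {}" using components_unique[OF C(1) C'(1)] by blast
    have CS: "C \<inter> S = {}" using components_subset[OF C(1)] by (auto simp: verts_delete)
    have "disjnt (end_nbhd G S \<omega> (\<lambda>_. 1/2)) (end_nbhd G S \<omega>' (\<lambda>_. 1/2))"
      unfolding disjnt_def
    proof (rule ccontr)
      assume "end_nbhd G S \<omega> (\<lambda>_. 1/2) \<inter> end_nbhd G S \<omega>' (\<lambda>_. 1/2) \<noteq> {}"
      then obtain x where x: "x \<in> end_nbhd G S \<omega> (\<lambda>_. 1/2)" "x \<in> end_nbhd G S \<omega>' (\<lambda>_. 1/2)" by blast
      show False
      proof (cases x)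
        case (Point p)
        then obtain c where "c \<in> C" "p c > 0" using x end_nbhd_support[OF G S \<omega>(1), of p] unfolding C_def by auto
        then have "c \<in> C' \<union> S" using x Point end_nbhd_support[OF G S \<omega>(2), of p] unfolding C'_def by auto
        then show False using \<open>c \<in> C\<close> dis CS by blast
      next
        case (End \<omega>'')
        then show False using x \<open>C \<noteq> C'\<close> unfolding C_def C'_def by (simp add: End_in_end_nbhd)
      qed
    qed
    moreover have "openin (freudenthal G) (end_nbhd G S \<omega> (\<lambda>_. 1/2))" "openin (freudenthal G) (end_nbhd G S \<omega>' (\<lambda>_. 1/2))"
      by (rule openin_end_nbhd[OF S]; simp add: \<omega>)+
    moreover have "End \<omega> \<in> end_nbhd G S \<omega> (\<lambda>_. 1/2)" "End \<omega>' \<in> end_nbhd G S \<omega>' (\<lambda>_. 1/2)"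
      using \<omega> by (simp_all add: End_in_end_nbhd)
    ultimately show ?thesis by blast
  qed
  have sw: "?sep y x" if "?sep x y" for x y using that by (metis disjnt_sym)
  show ?thesis
    unfolding Hausdorff_space_def topspace_freudenthal[OF G]
  proof (intro allI impI)
    fix x y :: "'a fpoint"
    assume xy: "x \<in> Point ` complex_pts G \<union> End ` graph_ends G \<and> y \<in> Point ` complex_pts G \<union> End ` graph_ends G \<and> x \<noteq> y"
    show "?sep x y"
    proof (cases x)
      case x: (Point p)
      show ?thesis
      proof (cases y)
        case y: (Point q)
        then have "p \<noteq> q" using x xy by simp
        then obtain w where "p w < q w \<or> q w < p w" by (metis ext linorder_less_linear)
        then show ?thesis using pp[of p q w] sw[OF pp[of q p w]] x y xy by auto
      next
        case y: (End \<omega>)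
        then show ?thesis using pe[of p \<omega>] x xy by auto
      qed
    next
      case x: (End \<omega>)
      show ?thesis
      proof (cases y)
        case y: (Point q)
        then show ?thesis using sw[OF pe[of q \<omega>]] x xy by auto
      next
        case y: (End \<omega>')
        then show ?thesis using ee[of \<omega> \<omega>'] x xy by auto
      qed
    qed
  qed
qed

section \<open>Curves through the vertices\<close>

text \<open>The curve that passes the vertex \<open>h i\<close> at time \<open>i\<close> and runs along the edges
with unit speed. Both double rays and, with a periodic \<open>h\<close>, finite cycles are of this
form.\<close>
definition traversal :: "(int \<Rightarrow> 'a) \<Rightarrow> real \<Rightarrow> 'a \<Rightarrow> real" where
  "traversal h t = edge_pt (h \<lfloor>t\<rfloor>) (h (\<lfloor>t\<rfloor> + 1)) (frac t)"

definition walk :: "'a sgraph \<Rightarrow> (int \<Rightarrow> 'a) \<Rightarrow> bool" where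
  "walk G h \<longleftrightarrow> (\<forall>i. {h i, h (i + 1)} \<in> edges G)"

lemma traversal_int: "traversal h (of_int i) = vert_pt (h i)"
  unfolding traversal_def by (simp add: edge_pt_0)

lemma traversal_on_edge:
  assumes "of_int j \<le> t" "t \<le> of_int j + 1"
  shows "traversal h t = edge_pt (h j) (h (j + 1)) (t - of_int j)"
proof (cases "t = of_int j + 1")
  case True
  then have "t = of_int (j + 1)" by simp
  then show ?thesis using traversal_int[of h "j + 1"] by (simp add: edge_pt_1)
next
  case False
  then have "\<lfloor>t\<rfloor> = j" using assms by (intro floor_unique) auto
  then show ?thesis unfolding traversal_def frac_def by simp
qed

lemma traversal_uminus: "traversal h (- t) = traversal (\<lambda>i. h (- i)) t"
proof -
  define j where "j = \<lfloor>t\<rfloor>"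
  have j: "of_int j \<le> t" "t \<le> of_int j + 1" unfolding j_def by linarith+
  have "traversal h (- t) = edge_pt (h (- j - 1)) (h (- j)) (1 - (t - of_int j))"
    using traversal_on_edge[of "- j - 1" "- t" h] j by (simp add: algebra_simps)
  also have "\<dots> = edge_pt (h (- j)) (h (- j - 1)) (t - of_int j)"
    using edge_pt_flip[of "h (- j)" "h (- j - 1)" "t - of_int j"] by simp
  also have "\<dots> = traversal (\<lambda>i. h (- i)) t"
    using traversal_on_edge[OF j, of "\<lambda>i. h (- i)"] by simp
  finally show ?thesis .
qed

lemma traversal_in_complex: "walk G h \<Longrightarrow> traversal h t \<in> complex_pts G"
  unfolding traversal_def walk_def by (rule edge_pt_in_complex) (auto simp: frac_ge_0 less_imp_le[OF frac_lt_1])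

lemma open_traversal_preimage:
  assumes w: "walk G h" and U: "complex_open G U"
  shows "open {t. traversal h t \<in> U}"
proof -
  have "\<forall>j. \<exists>T. open T \<and> {s \<in> {0..1}. edge_pt (h j) (h (j + 1)) s \<in> U} = {0..1} \<inter> T"
    using w U unfolding walk_def complex_open_def openin_open by blast
  from choice[OF this] obtain T where T: "\<And>j. open (T j)"
      "\<And>j. {s \<in> {0..1}. edge_pt (h j) (h (j + 1)) s \<in> U} = {0..1} \<inter> T j" by blast
  have tr: "traversal h t \<in> U \<longleftrightarrow> t - of_int j \<in> T j" if "of_int j \<le> t" "t \<le> of_int j + 1" for t j
  proof -
    have s: "t - of_int j \<in> {0..1}" using that by simp
    then have "edge_pt (h j) (h (j + 1)) (t - of_int j) \<in> U \<longleftrightarrow> t - of_int j \<in> T j" using T(2)[of j] by blast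
    then show ?thesis unfolding traversal_on_edge[OF that, of h] .
  qed
  have opT: "open {t. t - of_int j \<in> T j}" for j
  proof -
    have "open ((\<lambda>t. t - of_int j) -` T j)" by (rule open_vimage[OF T(1)]) (auto intro!: continuous_intros)
    then show ?thesis by (simp add: vimage_def)
  qed
  show ?thesis
  proof (subst open_subopen, intro ballI)
    fix t assume "t \<in> {t. traversal h t \<in> U}"
    then have t: "traversal h t \<in> U" by simp
    define j where "j = \<lfloor>t\<rfloor>"
    have j: "of_int j \<le> t" "t < of_int j + 1" unfolding j_def by linarith+
    show "\<exists>V. open V \<and> t \<in> V \<and> V \<subseteq> {t. traversal h t \<in> U}"
    proof (cases "t = of_int j")
      case False
      let ?V = "{of_int j<..<of_int j + 1} \<inter> {t. t - of_int j \<in> T j}"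
      have "open ?V" by (intro open_Int opT open_greaterThanLessThan)
      moreover have "t \<in> ?V" using False j t tr[of j t] by auto
      moreover have "?V \<subseteq> {t. traversal h t \<in> U}" using tr[of j] by auto
      ultimately show ?thesis by blast
    next
      case True
      \<comment> \<open>At an integer time the curve passes a vertex, and the traces on both edges have to be used.\<close>
      let ?V = "{of_int (j - 1)<..<of_int j + 1} \<inter> {t. t - of_int j \<in> T j} \<inter> {t. t - of_int (j - 1) \<in> T (j - 1)}"
      have "open ?V" by (intro open_Int opT open_greaterThanLessThan)
      moreover have "t \<in> ?V" using True t tr[of j t] tr[of "j - 1" t] by auto
      moreover have "?V \<subseteq> {t. traversal h t \<in> U}"
      proof
        fix s assume s: "s \<in> ?V"
        show "s \<in> {t. traversal h t \<in> U}"
        proof (cases "s \<ge> of_int j")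
          case True
          then show ?thesis using s tr[of j s] by auto
        next
          case False
          then show ?thesis using s tr[of "j - 1" s] by auto
        qed
      qed
      ultimately show ?thesis by blast
    qed
  qed
qed

lemma continuous_map_traversal:
  assumes G: "simple_graph G" and w: "walk G h"
  shows "continuous_map euclideanreal (freudenthal G) (\<lambda>t. Point (traversal h t))"
proof -
  have "continuous_map euclideanreal (topology_generated_by (basic_open G)) (\<lambda>t. Point (traversal h t))"
  proof (rule continuous_on_generated_topo)
    fix U assume "U \<in> basic_open G"
    then show "openin euclideanreal ((\<lambda>t. Point (traversal h t)) -` U \<inter> topspace euclideanreal)"
    proof (cases rule: basic_open_cases)
      case (1 V)
      then have "(\<lambda>t. Point (traversal h t)) -` U = {t. traversal h t \<in> V}" by auto
      then show ?thesis using open_traversal_preimage[OF w 1(2)] by simp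
    next
      case (2 S \<omega> l)
      have "(\<lambda>t. Point (traversal h t)) -` U = {t. traversal h t \<in> {p. Point p \<in> end_nbhd G S \<omega> l}}"
        unfolding 2(1) by auto
      then show ?thesis
        using open_traversal_preimage[OF w end_nbhd_Point_complex_open[OF G 2(2,3,4), of l]] 2(5) by simp
    qed
  next
    have "topspace (topology_generated_by (basic_open G)) = \<Union> (basic_open G)" by simp
    then have "\<Union> (basic_open G) = Point ` complex_pts G \<union> End ` graph_ends G"
      using topspace_freudenthal[OF G] unfolding freudenthal_basic by simp
    then show "(\<lambda>t. Point (traversal h t)) ` topspace euclideanreal \<subseteq> \<Union> (basic_open G)"
      using traversal_in_complex[OF w] by auto
  qed
  then show ?thesis unfolding freudenthal_basic .
qed

lemma walk_ray:
  assumes "simple_graph G" "walk G h" "inj h"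
  shows "(\<lambda>n. h (int n)) \<in> rays G" "(\<lambda>n. h (- int n)) \<in> rays G"
proof -
  have v: "h i \<in> verts G" for i using simple_graphD[OF assms(1), of "h i" "h (i + 1)"] assms(2) unfolding walk_def by blast
  have e: "{h (int n), h (int (Suc n))} \<in> edges G" for n
    using assms(2) unfolding walk_def by (metis of_nat_Suc add.commute)
  have e': "{h (- int n), h (- int (Suc n))} \<in> edges G" for n
  proof -
    have "{h (- int (Suc n)), h (- int (Suc n) + 1)} \<in> edges G" using assms(2) unfolding walk_def by blast
    then show ?thesis by (simp add: insert_commute)
  qed
  show "(\<lambda>n. h (int n)) \<in> rays G" "(\<lambda>n. h (- int n)) \<in> rays G"
    using v e e' assms(3) unfolding rays_def by (auto intro!: injI dest: injD)
qed

text \<open>It suffices to consider the generating sets. Those of the 1-complex contain no end, and for a basic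
neighbourhood of the end, a tail of the ray lies in the component in question.\<close>
lemma traversal_tends_to_end:
  assumes G: "simple_graph G" and w: "walk G h" and inj: "inj h"
    and U: "openin (freudenthal G) U" "End (end_of G (\<lambda>n. h (int n))) \<in> U"
  shows "\<exists>N. \<forall>t>N. Point (traversal h t) \<in> U"
proof -
  let ?r = "\<lambda>n. h (int n)"
  let ?\<omega> = "end_of G ?r"
  have r: "?r \<in> rays G" by (rule walk_ray[OF G w inj])
  note \<omega> = end_of_end[OF G r]
  have "generate_topology_on (basic_open G) U"
    using U(1) unfolding freudenthal_basic by (rule openin_topology_generated_by)
  then show ?thesis using U(2)
  proof (induction rule: generate_topology_on.induct)
    case (Int a b)
    then obtain N M where "\<forall>t>N. Point (traversal h t) \<in> a" "\<forall>t>M. Point (traversal h t) \<in> b" by blast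
    then show ?case by (intro exI[of _ "max N M"]) auto
  next
    case (UN K)
    then show ?case by blast
  next
    case (Basis s)
    from Basis(1) show ?case
    proof (cases rule: basic_open_cases)
      case (1 V)
      then show ?thesis using Basis(2) by auto
    next
      case (2 S \<omega>' l)
      define C where "C = end_component G S ?\<omega>"
      have C: "end_component G S \<omega>' = C" using Basis(2) unfolding 2(1) End_in_end_nbhd C_def by simp
      have "has_tail_in ?r C" unfolding C_def by (rule end_component_component(2)[OF G \<omega>(1) 2(2,3) \<omega>(2)])
      then obtain N where N: "\<And>n. n \<ge> N \<Longrightarrow> h (int n) \<in> C" unfolding has_tail_in_def by blast
      have "Point (traversal h t) \<in> s" if t: "t > of_nat N" for t
      proof -
        have fl: "\<lfloor>t\<rfloor> \<ge> int N" using t by linarith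
        have hC: "h i \<in> C" if "i \<ge> int N" for i using N[of "nat i"] that by simp
        have "traversal h t \<in> complex_pts (induced_subgraph G C)"
          unfolding traversal_def
          by (rule edge_pt_in_complex)
             (use w fl hC in \<open>auto simp: induced_subgraph_def walk_def frac_ge_0 less_imp_le[OF frac_lt_1]\<close>)
        then show ?thesis unfolding 2(1) Point_in_end_nbhd C by blast
      qed
      then show ?thesis by blast
    qed
  qed simp
qed

lemma walk_uminus: "walk G h \<Longrightarrow> walk G (\<lambda>i. h (- i))"
  unfolding walk_def
proof
  fix i assume "\<forall>i. {h i, h (i + 1)} \<in> edges G"
  then have "{h (- i - 1), h (- i - 1 + 1)} \<in> edges G" by blast
  then show "{h (- i), h (- (i + 1))} \<in> edges G" by (simp add: insert_commute)
qed

lemma traversal_tends_to_end_backward: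
  assumes G: "simple_graph G" and w: "walk G h" and inj: "inj h"
    and U: "openin (freudenthal G) U" "End (end_of G (\<lambda>n. h (- int n))) \<in> U"
  shows "\<exists>N. \<forall>t<N. Point (traversal h t) \<in> U"
proof -
  have "inj (\<lambda>i. h (- i))" using inj by (auto intro!: injI dest: injD)
  from traversal_tends_to_end[OF G walk_uminus[OF w] this U]
  obtain N where N: "\<And>t. t > N \<Longrightarrow> Point (traversal (\<lambda>i. h (- i)) t) \<in> U" by blast
  have "Point (traversal h t) \<in> U" if "t < - N" for t
    using N[of "- t"] that traversal_uminus[of h "- t"] by simp
  then show ?thesis by blast
qed

lemma traversal_support:
  assumes "simple_graph G" "walk G h"
  shows "traversal h t x > 0 \<longleftrightarrow> x = h \<lfloor>t\<rfloor> \<or> x = h (\<lfloor>t\<rfloor> + 1) \<and> frac t > 0"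
proof -
  have "h \<lfloor>t\<rfloor> \<noteq> h (\<lfloor>t\<rfloor> + 1)" using simple_graphD(3)[OF assms(1)] assms(2) unfolding walk_def by blast
  then show ?thesis using frac_lt_1[of t] unfolding traversal_def by (simp add: edge_pt_apply)
qed

text \<open>A point of the curve determines its edge by its support, and its position on the edge by a
coordinate. The two hypotheses on \<open>h\<close> say that no vertex and no edge is used twice,
which covers both injective and periodic sequences.\<close>
lemma traversal_eqD:
  assumes G: "simple_graph G" and w: "walk G h" and eq: "traversal h s = traversal h t"
    and inj: "h \<lfloor>s\<rfloor> = h \<lfloor>t\<rfloor> \<Longrightarrow> \<lfloor>s\<rfloor> = \<lfloor>t\<rfloor>"
    and edge: "\<not> (h \<lfloor>s\<rfloor> = h (\<lfloor>t\<rfloor> + 1) \<and> h (\<lfloor>s\<rfloor> + 1) = h \<lfloor>t\<rfloor>)"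
  shows "s = t"
proof -
  have ne: "h i \<noteq> h (i + 1)" for i using simple_graphD(3)[OF G] w unfolding walk_def by blast
  have sup: "x = h \<lfloor>s\<rfloor> \<or> x = h (\<lfloor>s\<rfloor> + 1) \<and> frac s > 0 \<longleftrightarrow> x = h \<lfloor>t\<rfloor> \<or> x = h (\<lfloor>t\<rfloor> + 1) \<and> frac t > 0" for x
    using traversal_support[OF G w, of s x] traversal_support[OF G w, of t x] eq by simp
  have h: "h \<lfloor>s\<rfloor> = h \<lfloor>t\<rfloor>"
    using sup[of "h \<lfloor>s\<rfloor>"] sup[of "h \<lfloor>t\<rfloor>"] edge by metis
  then have f: "\<lfloor>s\<rfloor> = \<lfloor>t\<rfloor>" using inj by simp
  have "traversal h s (h \<lfloor>s\<rfloor>) = 1 - frac s" "traversal h t (h \<lfloor>t\<rfloor>) = 1 - frac t"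
    using ne unfolding traversal_def by (simp_all add: edge_pt_apply)
  then have "frac s = frac t" using eq h by simp
  then show ?thesis using f unfolding frac_def by simp
qed

lemma inj_traversal:
  assumes "simple_graph G" "walk G h" "inj h"
  shows "inj (traversal h)"
proof (rule injI)
  fix s t assume eq: "traversal h s = traversal h t"
  show "s = t"
  proof (rule traversal_eqD[OF assms(1,2) eq])
    show "h \<lfloor>s\<rfloor> = h \<lfloor>t\<rfloor> \<Longrightarrow> \<lfloor>s\<rfloor> = \<lfloor>t\<rfloor>" using assms(3) by (simp add: inj_eq)
    show "\<not> (h \<lfloor>s\<rfloor> = h (\<lfloor>t\<rfloor> + 1) \<and> h (\<lfloor>s\<rfloor> + 1) = h \<lfloor>t\<rfloor>)" using assms(3) by (simp add: inj_eq)
  qed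
qed

lemma traversal_disjoint:
  assumes "simple_graph G" "walk G h" "walk G h'" "range h \<inter> range h' = {}"
  shows "traversal h s \<noteq> traversal h' t"
proof
  assume "traversal h s = traversal h' t"
  then have "traversal h' t (h \<lfloor>s\<rfloor>) > 0" using traversal_support[OF assms(1,2), of s "h \<lfloor>s\<rfloor>"] by simp
  then have "h \<lfloor>s\<rfloor> \<in> range h'" using traversal_support[OF assms(1,3)] by auto
  then show False using assms(4) by blast
qed

section \<open>Hamilton circles\<close>

lemma hamiltonian_curve:
  fixes f :: "real \<Rightarrow> 'a fpoint"
  assumes G: "simple_graph G" and f: "continuous_map (top_of_set {0..1}) (freudenthal G) f"
    and "f 0 = f 1" "inj_on f {0..<1}" and v: "\<And>v. v \<in> verts G \<Longrightarrow> Point (vert_pt v) \<in> f ` {0..1}"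
  shows "hamiltonian G"
proof -
  have "f ` {0..1} \<subseteq> topspace (freudenthal G)" using f unfolding continuous_map_def by auto
  then have "graph_circle G (f ` {0..1})"
    unfolding graph_circle_def
    using circle_of_closed_curve[OF f assms(3,4) Hausdorff_freudenthal[OF G]] by blast
  then show ?thesis using v unfolding hamiltonian_def by blast
qed

lemma hamiltonian_finite:
  assumes G: "simple_graph G" and xs: "distinct xs" "set xs = verts G" "length xs > 2"
    and e: "\<And>i. Suc i < length xs \<Longrightarrow> {xs ! i, xs ! Suc i} \<in> edges G" "{last xs, hd xs} \<in> edges G"
  shows "hamiltonian G"
proof -
  define n where "n = int (length xs)"
  have n: "n > 2" using xs unfolding n_def by simp
  define h where "h i = xs ! nat (i mod n)" for i
  have idx: "nat (i mod n) < length xs" for i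
    using n pos_mod_bound[of n i] pos_mod_sign[of n i] unfolding n_def by linarith
  have heq: "h i = h j \<longleftrightarrow> i mod n = j mod n" for i j
  proof -
    have "h i = h j \<longleftrightarrow> nat (i mod n) = nat (j mod n)"
      unfolding h_def using idx xs(1) by (simp add: nth_eq_iff_index_eq)
    then show ?thesis using n pos_mod_sign[of n i] pos_mod_sign[of n j] by (simp add: eq_nat_nat_iff)
  qed
  have w: "walk G h"
    unfolding walk_def
  proof
    fix i
    show "{h i, h (i + 1)} \<in> edges G"
    proof (cases "i mod n + 1 < n")
      case True
      have "(i + 1) mod n = (i mod n + 1) mod n" by (simp add: mod_add_left_eq)
      also have "\<dots> = i mod n + 1" using True n pos_mod_sign[of n i] by (intro mod_pos_pos_trivial) simp_all
      finally have "(i + 1) mod n = i mod n + 1" .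
      then have "nat ((i + 1) mod n) = Suc (nat (i mod n))" using n by (simp add: nat_add_distrib)
      then show ?thesis using e(1)[of "nat (i mod n)"] idx[of "i + 1"] unfolding h_def by simp
    next
      case False
      then have i: "i mod n = n - 1" using n pos_mod_bound[of n i] by linarith
      have "(i + 1) mod n = (i mod n + 1) mod n" by (simp add: mod_add_left_eq)
      also have "\<dots> = 0" using i by simp
      finally have "(i + 1) mod n = 0" .
      moreover have "nat (n - 1) = length xs - 1" unfolding n_def by simp
      moreover have "xs \<noteq> []" using xs by auto
      ultimately show ?thesis using e(2) i unfolding h_def by (simp add: last_conv_nth hd_conv_nth)
    qed
  qed
  define f where "f t = Point (traversal h (of_int n * t))" for t
  have "continuous_map (top_of_set {0..1}) euclideanreal (\<lambda>t. of_int n * t)" by (auto intro!: continuous_intros)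
  from continuous_map_compose[OF this continuous_map_traversal[OF G w]]
  have "continuous_map (top_of_set {0..1}) (freudenthal G) f" unfolding f_def o_def .
  moreover have "f 0 = f 1"
    using traversal_int[of h 0] traversal_int[of h n] heq[of 0 n] unfolding f_def by simp
  moreover have "inj_on f {0..<1}"
  proof (rule inj_onI)
    fix s t assume st: "s \<in> {0..<1}" "t \<in> {0..<1}" "f s = f t"
    have fl: "0 \<le> \<lfloor>of_int n * s\<rfloor>" "\<lfloor>of_int n * s\<rfloor> < n" "0 \<le> \<lfloor>of_int n * t\<rfloor>" "\<lfloor>of_int n * t\<rfloor> < n"
      using st n by (auto simp: floor_less_iff)
    have "of_int n * s = of_int n * t"
    proof (rule traversal_eqD[OF G w])
      show "traversal h (of_int n * s) = traversal h (of_int n * t)" using st unfolding f_def by simp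
      show "h \<lfloor>of_int n * s\<rfloor> = h \<lfloor>of_int n * t\<rfloor> \<Longrightarrow> \<lfloor>of_int n * s\<rfloor> = \<lfloor>of_int n * t\<rfloor>"
        using fl unfolding heq by simp
      define a where "a = \<lfloor>of_int n * s\<rfloor>"
      define b where "b = \<lfloor>of_int n * t\<rfloor>"
      have ab: "0 \<le> a" "a < n" "0 \<le> b" "b < n" using fl unfolding a_def b_def by auto
      have "\<not> (a mod n = (b + 1) mod n \<and> (a + 1) mod n = b mod n)"
      proof
        assume *: "a mod n = (b + 1) mod n \<and> (a + 1) mod n = b mod n"
        have "(b + 1) mod n = (if b + 1 = n then 0 else b + 1)" "(a + 1) mod n = (if a + 1 = n then 0 else a + 1)"
          using ab by auto
        moreover have "a mod n = a" "b mod n = b" using ab by simp_all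
        ultimately have "a = (if b + 1 = n then 0 else b + 1)" "b = (if a + 1 = n then 0 else a + 1)" using * by metis+
        then have "b + 1 = n \<and> a = 0 \<or> a = b + 1" "a + 1 = n \<and> b = 0 \<or> b = a + 1" by metis+
        then show False using n by linarith
      qed
      then show "\<not> (h \<lfloor>of_int n * s\<rfloor> = h (\<lfloor>of_int n * t\<rfloor> + 1) \<and> h (\<lfloor>of_int n * s\<rfloor> + 1) = h \<lfloor>of_int n * t\<rfloor>)"
        unfolding heq a_def b_def .
    qed
    then show "s = t" using n by simp
  qed
  moreover have "Point (vert_pt v) \<in> f ` {0..1}" if v: "v \<in> verts G" for v
  proof -
    obtain i where i: "i < length xs" "v = xs ! i" using v xs(2) by (metis in_set_conv_nth)
    then have "v = h (int i)" unfolding h_def n_def by simp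
    then have "Point (vert_pt v) = f (of_int (int i) / of_int n)"
      using traversal_int[of h "int i"] n unfolding f_def by simp
    moreover have "of_int (int i) / of_int n \<in> {0..1::real}"
      using i n unfolding n_def by (simp add: divide_le_eq)
    ultimately show ?thesis by blast
  qed
  ultimately show ?thesis by (rule hamiltonian_curve[OF G])
qed

lemma compactified_eqD:
  assumes g: "inj g" "\<And>t. g t \<noteq> p" "\<And>t. g t \<noteq> q"
    and st: "s \<in> {0..1}" "t \<in> {0..1}" "compactified g p q s = compactified g p q t"
  shows "s = t \<or> p = q \<and> s \<in> {0, 1} \<and> t \<in> {0, 1}"
proof (cases "s \<in> {0, 1} \<or> t \<in> {0, 1}")
  case True
  then show ?thesis using st g(2,3) g(2,3)[symmetric] unfolding compactified_def by (auto split: if_splits)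
next
  case False
  then have i: "s \<in> {0<..<1}" "t \<in> {0<..<1}" using st by auto
  then have "line_param s = line_param t" using st(3) g(1) unfolding compactified_def by (auto simp: inj_eq)
  then show ?thesis using line_param_inj i by (simp add: inj_on_eq_iff)
qed

lemma Point_traversal_at_vertex:
  "Point (vert_pt (h i)) = compactified (\<lambda>t. Point (traversal h t)) p q (unit_param (of_int i))"
  by (simp add: compactified_unit_param traversal_int)

lemma continuous_map_double_ray:
  assumes G: "simple_graph G" and w: "walk G h" and inj: "inj h"
  shows "continuous_map (top_of_set {0..1}) (freudenthal G)
    (compactified (\<lambda>t. Point (traversal h t)) (End (end_of G (\<lambda>n. h (- int n)))) (End (end_of G (\<lambda>n. h (int n)))))"
proof (rule continuous_map_compactified[OF continuous_map_traversal[OF G w]])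
  note r = walk_ray[OF G w inj]
  show "End (end_of G (\<lambda>n. h (- int n))) \<in> topspace (freudenthal G)"
    "End (end_of G (\<lambda>n. h (int n))) \<in> topspace (freudenthal G)"
    unfolding topspace_freudenthal[OF G] using end_of_end(1)[OF G r(1)] end_of_end(1)[OF G r(2)] by blast+
qed (use traversal_tends_to_end[OF G w inj] traversal_tends_to_end_backward[OF G w inj] in blast)+

lemma hamiltonian_one_double_ray:
  assumes G: "simple_graph G" and w: "walk G h" and inj: "inj h" and r: "range h = verts G"
    and e: "((\<lambda>n. h (- int n)), (\<lambda>n. h (int n))) \<in> ray_equiv G"
  shows "hamiltonian G"
proof -
  note rays = walk_ray[OF G w inj]
  define g where "g t = Point (traversal h t)" for t
  define p where "p = End (end_of G (\<lambda>n. h (int n)))"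
  have pe: "End (end_of G (\<lambda>n. h (- int n))) = p" unfolding p_def using end_of_eq_iff[OF G rays(2,1)] e by simp
  have c: "continuous_map (top_of_set {0..1}) (freudenthal G) (compactified g p p)"
    using continuous_map_double_ray[OF G w inj] unfolding pe unfolding p_def[symmetric] g_def .
  have gi: "inj g" using inj_traversal[OF G w inj] unfolding g_def inj_def by simp
  have gp: "g t \<noteq> p" for t unfolding g_def p_def by simp
  show ?thesis
  proof (rule hamiltonian_curve[OF G c])
    show "compactified g p p 0 = compactified g p p 1" unfolding compactified_def by simp
    show "inj_on (compactified g p p) {0..<1}"
    proof (rule inj_onI)
      fix s t :: real assume st: "s \<in> {0..<1}" "t \<in> {0..<1}" "compactified g p p s = compactified g p p t"
      then show "s = t" using compactified_eqD[OF gi gp gp, of s t] by auto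
    qed
    fix v assume "v \<in> verts G"
    then obtain i where "v = h i" using r by blast
    then have "Point (vert_pt v) = compactified g p p (unit_param (of_int i))"
      unfolding g_def by (simp only: Point_traversal_at_vertex[symmetric])
    then show "Point (vert_pt v) \<in> compactified g p p ` {0..1}" using unit_param_bounds[of "of_int i"] by force
  qed
qed

lemma hamiltonian_two_double_rays:
  assumes G: "simple_graph G" and w: "walk G h" "walk G h'" and inj: "inj h" "inj h'"
    and dis: "range h \<inter> range h' = {}" and r: "range h \<union> range h' = verts G"
    and fw: "((\<lambda>n. h (int n)), (\<lambda>n. h' (int n))) \<in> ray_equiv G"
    and bw: "((\<lambda>n. h (- int n)), (\<lambda>n. h' (- int n))) \<in> ray_equiv G"
    and ne: "((\<lambda>n. h (- int n)), (\<lambda>n. h (int n))) \<notin> ray_equiv G"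
  shows "hamiltonian G"
proof -
  note rays = walk_ray[OF G w(1) inj(1)]
  note rays' = walk_ray[OF G w(2) inj(2)]
  define g where "g t = Point (traversal h t)" for t
  define g' where "g' t = Point (traversal h' t)" for t
  define p where "p = End (end_of G (\<lambda>n. h (- int n)))"
  define q where "q = End (end_of G (\<lambda>n. h (int n)))"
  have pe: "End (end_of G (\<lambda>n. h' (- int n))) = p" unfolding p_def using end_of_eq_iff[OF G rays(2) rays'(2)] bw by simp
  have qe: "End (end_of G (\<lambda>n. h' (int n))) = q" unfolding q_def using end_of_eq_iff[OF G rays(1) rays'(1)] fw by simp
  have pq: "p \<noteq> q" unfolding p_def q_def using end_of_eq_iff[OF G rays(2,1)] ne by simp
  have c: "continuous_map (top_of_set {0..1}) (freudenthal G) (compactified g p q)"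
    using continuous_map_double_ray[OF G w(1) inj(1)] unfolding p_def[symmetric] q_def[symmetric] g_def .
  have c': "continuous_map (top_of_set {0..1}) (freudenthal G) (compactified g' p q)"
    using continuous_map_double_ray[OF G w(2) inj(2)] unfolding pe qe g'_def .
  have gi: "inj g" "inj g'" using inj_traversal[OF G w(1) inj(1)] inj_traversal[OF G w(2) inj(2)]
    unfolding g_def g'_def inj_def by simp_all
  have gp: "g t \<noteq> p" "g t \<noteq> q" "g' t \<noteq> p" "g' t \<noteq> q" for t unfolding g_def g'_def p_def q_def by simp_all
  have gg: "g s \<noteq> g' t" for s t using traversal_disjoint[OF G w dis] unfolding g_def g'_def by simp
  let ?a = "compactified g p q" and ?a' = "compactified g' p q"
  have a: "s = t" if "s \<in> {0..1}" "t \<in> {0..1}" "?a s = ?a t" for s t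
    using compactified_eqD[OF gi(1) gp(1,2) that] pq by blast
  have a': "s = t" if "s \<in> {0..1}" "t \<in> {0..1}" "?a' s = ?a' t" for s t
    using compactified_eqD[OF gi(2) gp(3,4) that] pq by blast
  have aa: "?a s \<noteq> ?a' t" if "0 < t" "t < 1" for s t
    using that gg[of "line_param s" "line_param t"] gp(3,4)[of "line_param t"] unfolding compactified_def by auto
  show ?thesis
  proof (rule hamiltonian_curve[OF G])
    show "continuous_map (top_of_set {0..1}) (freudenthal G) (two_arcs ?a ?a')"
      by (rule continuous_map_two_arcs[OF c c']) (simp add: compactified_def)
    show "two_arcs ?a ?a' 0 = two_arcs ?a ?a' 1" unfolding two_arcs_def compactified_def by simp
    show "inj_on (two_arcs ?a ?a') {0..<1}"
    proof (rule inj_onI)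
      fix s t :: real assume st: "s \<in> {0..<1}" "t \<in> {0..<1}" "two_arcs ?a ?a' s = two_arcs ?a ?a' t"
      consider "s \<le> 1/2" "t \<le> 1/2" | "s > 1/2" "t > 1/2" | "s \<le> 1/2" "t > 1/2" | "s > 1/2" "t \<le> 1/2" by linarith
      then show "s = t"
      proof cases
        case 1
        then show ?thesis using a[of "2 * s" "2 * t"] st unfolding two_arcs_def by simp
      next
        case 2
        then show ?thesis using a'[of "2 - 2 * s" "2 - 2 * t"] st unfolding two_arcs_def by simp
      next
        case 3
        then show ?thesis using aa[of "2 - 2 * t" "2 * s"] st unfolding two_arcs_def by simp
      next
        case 4
        then show ?thesis using aa[of "2 - 2 * s" "2 * t"] st unfolding two_arcs_def by simp
      qed
    qed
    fix v assume "v \<in> verts G"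
    then consider i where "v = h i" | i where "v = h' i" using r by blast
    then show "Point (vert_pt v) \<in> two_arcs ?a ?a' ` {0..1}"
    proof cases
      case 1
      have b: "0 < unit_param (of_int i)" "unit_param (of_int i) < 1" by (rule unit_param_bounds)+
      have "Point (vert_pt v) = ?a (unit_param (of_int i))"
        unfolding g_def 1 by (simp only: Point_traversal_at_vertex[symmetric])
      also have "\<dots> = two_arcs ?a ?a' (unit_param (of_int i) / 2)" using b unfolding two_arcs_def by simp
      finally show ?thesis using b by force
    next
      case 2
      have b: "0 < unit_param (of_int i)" "unit_param (of_int i) < 1" by (rule unit_param_bounds)+
      have "Point (vert_pt v) = ?a' (unit_param (of_int i))"
        unfolding g'_def 2 by (simp only: Point_traversal_at_vertex[symmetric])
      also have "\<dots> = two_arcs ?a ?a' (1 - unit_param (of_int i) / 2)" using b unfolding two_arcs_def by simp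
      finally show ?thesis using b by force
    qed
  qed
qed

definition adj :: "'a sgraph \<Rightarrow> 'a \<Rightarrow> 'a \<Rightarrow> bool" where
  "adj G u v \<longleftrightarrow> {u, v} \<in> edges G"

lemma claw_net_free_adj:
  assumes G: "simple_graph G" and c: "induced_free claw G" and n: "induced_free net G"
  shows "claw_net_free (adj G)"
proof
  have loop: "{x} \<notin> edges G" for x using G unfolding simple_graph_def by force
  show "adj G y x" if "adj G x y" for x y using that unfolding adj_def by (simp add: insert_commute)
  show "\<not> adj G x x" for x using loop unfolding adj_def by simp
  have V: "x \<in> verts G" "y \<in> verts G" "x \<noteq> y" if "adj G x y" for x y
    using simple_graphD[OF G] that unfolding adj_def by blast+
  have flip: "{x, y} \<in> edges G \<longleftrightarrow> {y, x} \<in> edges G" for x y by (simp add: insert_commute)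
  show False
    if e: "adj G x a" "adj G x b" "adj G x c" "a \<noteq> b" "a \<noteq> c" "b \<noteq> c" "\<not> adj G a b" "\<not> adj G a c" "\<not> adj G b c" for x a b c
  proof -
    define W where "W = {x, a, b, c}"
    define f :: "'a \<Rightarrow> nat" where "f v = (if v = x then 0 else if v = a then 1 else if v = b then 2 else 3)" for v
    have ne: "x \<noteq> a" "x \<noteq> b" "x \<noteq> c" using V(3)[OF e(1)] V(3)[OF e(2)] V(3)[OF e(3)] by auto
    have fv: "f x = 0" "f a = 1" "f b = 2" "f c = 3" using ne e unfolding f_def by auto
    have "W \<subseteq> verts G" unfolding W_def using V(1)[OF e(1)] V(2)[OF e(1)] V(2)[OF e(2)] V(2)[OF e(3)] by simp
    moreover have "bij_betw f W {0, 1, 2, 3}"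
      unfolding bij_betw_def W_def inj_on_def using fv by auto
    moreover have "\<forall>u\<in>W. \<forall>v\<in>W. {u, v} \<in> edges G \<longleftrightarrow> {f u, f v} \<in> {{0, 1}, {0, 2}, {0, 3::nat}}"
      using e loop unfolding W_def adj_def
      by (simp add: fv doubleton_eq_iff flip[of a x] flip[of b x] flip[of c x] flip[of b a] flip[of c a] flip[of c b])
    ultimately have "graph_isomorphic (induced_subgraph G W) claw"
      unfolding graph_isomorphic_def induced_subgraph_def claw_def
      by (intro exI[of _ f]) auto
    then show False using c \<open>W \<subseteq> verts G\<close> unfolding induced_free_def by blast
  qed
  show False
    if e: "adj G a b" "adj G b c" "adj G a c" "adj G a x" "adj G b y" "adj G c z"
      and o: "\<not> adj G x b" "\<not> adj G x c" "\<not> adj G y a" "\<not> adj G y c" "\<not> adj G z a" "\<not> adj G z b"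
        "\<not> adj G x y" "\<not> adj G x z" "\<not> adj G y z" for a b c x y z
  proof -
    define W where "W = {a, b, c, x, y, z}"
    have sy: "adj G u v \<longleftrightarrow> adj G v u" for u v unfolding adj_def by (rule flip)
    have ne: "a \<noteq> b" "b \<noteq> c" "a \<noteq> c" "a \<noteq> x" "b \<noteq> y" "c \<noteq> z" using V(3) e by blast+
    have ne': "x \<noteq> b" "x \<noteq> c" "y \<noteq> a" "y \<noteq> c" "z \<noteq> a" "z \<noteq> b" "x \<noteq> y" "x \<noteq> z" "y \<noteq> z"
      using e o sy by metis+
    define f :: "'a \<Rightarrow> nat" where "f v = (if v = a then 0 else if v = b then 1 else if v = c then 2
        else if v = x then 3 else if v = y then 4 else 5)" for v
    have fv: "f a = 0" "f b = 1" "f c = 2" "f x = 3" "f y = 4" "f z = 5"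
      using ne ne' unfolding f_def by auto
    have "W \<subseteq> verts G" unfolding W_def using V(1,2)[OF e(1)] V(2)[OF e(2)] V(2)[OF e(4)] V(2)[OF e(5)] V(2)[OF e(6)] by simp
    moreover have "bij_betw f W {0, 1, 2, 3, 4, 5}"
      unfolding bij_betw_def W_def inj_on_def using fv by auto
    moreover have "\<forall>u\<in>W. \<forall>v\<in>W. {u, v} \<in> edges G \<longleftrightarrow>
        {f u, f v} \<in> {{0, 1}, {1, 2}, {0, 2}, {0, 3}, {1, 4}, {2, 5::nat}}"
      using e o loop unfolding W_def adj_def
      by (simp add: fv doubleton_eq_iff flip[of b a] flip[of c b] flip[of c a] flip[of x a] flip[of y b] flip[of z c]
          flip[of b x] flip[of c x] flip[of a y] flip[of c y] flip[of a z] flip[of b z] flip[of y x] flip[of z x] flip[of z y])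
    ultimately have "graph_isomorphic (induced_subgraph G W) net"
      unfolding graph_isomorphic_def induced_subgraph_def net_def
      by (intro exI[of _ f]) auto
    then show False using n \<open>W \<subseteq> verts G\<close> unfolding induced_free_def by blast
  qed
qed

lemma linked_delete:
  assumes cn: "claw_net_free (adj G)" and c: "graph_connected (delete_verts G S)"
  shows "claw_net_free.linked (adj G) (verts G - S)"
  unfolding claw_net_free.linked_def[OF cn]
proof (intro ballI)
  fix x y assume "x \<in> verts G - S" "y \<in> verts G - S"
  then have "(x, y) \<in> {(x, y). {x, y} \<in> edges (delete_verts G S)}\<^sup>*"
    using c unfolding graph_connected_def conn_rel_def by (auto simp: verts_delete)
  moreover have "{(x, y). {x, y} \<in> edges (delete_verts G S)} = {(a, b). adj G a b \<and> a \<in> verts G - S \<and> b \<in> verts G - S}"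
    unfolding edges_delete adj_def by auto
  ultimately show "(\<lambda>a b. adj G a b \<and> a \<in> verts G - S \<and> b \<in> verts G - S)\<^sup>*\<^sup>* x y"
    by (simp add: Enum.rtranclp_rtrancl_eq)
qed

context clique_levels begin

lemma level_cases:
  assumes "V \<noteq> {}"
  obtains "\<And>k. level k \<noteq> {}" | M where "level M \<noteq> {}" "level (M + 1) = {}"
proof (cases "\<exists>M. level M \<noteq> {} \<and> level (M + 1) = {}")
  case True
  then show ?thesis using that(2) by blast
next
  case False
  obtain x where "x \<in> V" using assms by blast
  then have x: "level (b x) \<noteq> {}" unfolding level_def by blast
  have "level k \<noteq> {}" for k
  proof (cases "k \<le> b x")
    case True
    then show ?thesis using level_downs[OF x] by blast
  next
    case nle: False
    then have "b x \<le> k" by simp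
    then show ?thesis
    proof (induction k rule: int_ge_induct)
      case (step i)
      then show ?case using False by blast
    qed (use x in blast)
  qed
  then show ?thesis using that(1) by blast
qed

end

lemma rays_meeting_levels_equiv:
  assumes G: "simple_graph G" and L: "clique_levels (adj G) (verts G) b" and r: "r \<in> rays G" "r' \<in> rays G"
    and meet: "\<And>N. \<exists>m\<ge>N. \<exists>n\<ge>N. b (r m) = b (r' n)"
  shows "(r, r') \<in> ray_equiv G"
proof (rule ray_equivI[OF G r])
  fix N
  obtain m n where mn: "m \<ge> N" "n \<ge> N" "b (r m) = b (r' n)" using meet by blast
  have "r m \<in> verts G" "r' n \<in> verts G" using r unfolding rays_def by auto
  then have "r m = r' n \<or> {r m, r' n} \<in> edges G"
    using clique_levels.cl[OF L _ _ mn(3)] unfolding adj_def by blast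
  then show "\<exists>m\<ge>N. \<exists>n\<ge>N. r m = r' n \<or> {r m, r' n} \<in> edges G" using mn by blast
qed

text \<open>Rays that visit the same levels again and again are equivalent, because levels are cliques. If the
levels are unbounded above, deleting level 0 separates the tails that run upwards from those that
run downwards, so there are two different ends for the two arcs to share.\<close>
lemma hamiltonian_clique_levels:
  assumes G: "simple_graph G" and ne: "verts G \<noteq> {}" and L: "clique_levels (adj G) (verts G) b"
  shows "hamiltonian G"
proof -
  interpret clique_levels "adj G" "verts G" b by (rule L)
  show ?thesis
  proof (cases rule: level_cases[OF ne])
    case 1
    obtain h h' :: "int \<Rightarrow> 'a" and f f' :: "int \<Rightarrow> int" where h: "inj h" "inj h'" "range h \<inter> range h' = {}"
      "range h \<union> range h' = verts G" "\<And>i. adj G (h i) (h (i + 1))" "\<And>i. adj G (h' i) (h' (i + 1))"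
      and f: "mono f" "surj f" "mono f'" "surj f'" and bf: "\<And>i. b (h i) = - f i" "\<And>i. b (h' i) = - f' i"
      by (rule two_double_rays[OF 1]) (rule that)
    have w: "walk G h" "walk G h'" using h(5,6) unfolding walk_def adj_def by blast+
    note r = walk_ray[OF G w(1) h(1)]
    note r' = walk_ray[OF G w(2) h(2)]
    show ?thesis
    proof (rule hamiltonian_two_double_rays[OF G w h(1-4)])
      show "((\<lambda>n. h (int n)), (\<lambda>n. h' (int n))) \<in> ray_equiv G"
      proof (rule rays_meeting_levels_equiv[OF G L r(1) r'(1)])
        fix N :: nat
        obtain J where J: "\<forall>j\<ge>J. \<exists>m\<ge>N. f (int m) = j" using mono_surj_reaches_forward[OF f(1,2)] by blast
        obtain J' where J': "\<forall>j\<ge>J'. \<exists>m\<ge>N. f' (int m) = j" using mono_surj_reaches_forward[OF f(3,4)] by blast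
        obtain m where m: "m \<ge> N" "f (int m) = max J J'" using J by (meson max.cobounded1)
        obtain n where n: "n \<ge> N" "f' (int n) = max J J'" using J' by (meson max.cobounded2)
        show "\<exists>m\<ge>N. \<exists>n\<ge>N. b (h (int m)) = b (h' (int n))" using m n bf by metis
      qed
      show "((\<lambda>n. h (- int n)), (\<lambda>n. h' (- int n))) \<in> ray_equiv G"
      proof (rule rays_meeting_levels_equiv[OF G L r(2) r'(2)])
        fix N :: nat
        obtain J where J: "\<forall>j\<le>J. \<exists>m\<ge>N. f (- int m) = j" using mono_surj_reaches_backward[OF f(1,2)] by blast
        obtain J' where J': "\<forall>j\<le>J'. \<exists>m\<ge>N. f' (- int m) = j" using mono_surj_reaches_backward[OF f(3,4)] by blast
        obtain m where m: "m \<ge> N" "f (- int m) = min J J'" using J by (meson min.cobounded1)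
        obtain n where n: "n \<ge> N" "f' (- int n) = min J J'" using J' by (meson min.cobounded2)
        show "\<exists>m\<ge>N. \<exists>n\<ge>N. b (h (- int m)) = b (h' (- int n))" using m n bf by metis
      qed
      show "((\<lambda>n. h (- int n)), (\<lambda>n. h (int n))) \<notin> ray_equiv G"
      proof
        assume "((\<lambda>n. h (- int n)), (\<lambda>n. h (int n))) \<in> ray_equiv G"
        moreover have "finite (level 0)" "level 0 \<subseteq> verts G" using finite_level unfolding level_def by auto
        ultimately obtain C where C: "C \<in> graph_components (delete_verts G (level 0))"
          "has_tail_in (\<lambda>n. h (- int n)) C" "has_tail_in (\<lambda>n. h (int n)) C"
          unfolding ray_equiv_def by blast
        obtain N where N: "\<And>n. n \<ge> N \<Longrightarrow> h (- int n) \<in> C" "\<And>n. n \<ge> N \<Longrightarrow> h (int n) \<in> C"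
        proof -
          obtain M M' where "\<And>n. n \<ge> M \<Longrightarrow> h (- int n) \<in> C" "\<And>n. n \<ge> M' \<Longrightarrow> h (int n) \<in> C"
            using C(2,3) unfolding has_tail_in_def by blast
          then show thesis using that[of "max M M'"] by simp
        qed
        obtain J where J: "\<forall>j\<ge>J. \<exists>m\<ge>N. f (int m) = j" using mono_surj_reaches_forward[OF f(1,2)] by blast
        obtain m where m: "m \<ge> N" "f (int m) = max J 1" using J by (meson max.cobounded1)
        obtain J' where J': "\<forall>j\<le>J'. \<exists>m\<ge>N. f (- int m) = j" using mono_surj_reaches_backward[OF f(1,2)] by blast
        obtain n where n: "n \<ge> N" "f (- int n) = min J' (-1)" using J' by (meson min.cobounded1)
        define x where "x = h (int m)"
        define y where "y = h (- int n)"
        have x: "x \<in> C" "b x < 0" using N m bf(1) unfolding x_def by auto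
        have y: "y \<in> C" "b y > 0" using N n bf(1) unfolding y_def by auto
        have "(x, y) \<in> conn_rel (delete_verts G (level 0))"
          using in_quotient_imp_in_rel[OF conn_rel_equiv, of C "delete_verts G (level 0)" x y] C(1) x y
          unfolding graph_components_def by simp
        then have "(x, y) \<in> {(x, y). {x, y} \<in> edges (delete_verts G (level 0))}\<^sup>*" unfolding conn_rel_def by simp
        then have "b y < 0"
        proof (induction rule: rtrancl_induct)
          case (step u v)
          then have "adj G u v" "v \<in> verts G" "v \<notin> level 0" unfolding edges_delete adj_def by auto
          then show ?case using lip[of u v] step(3) unfolding level_def by auto
        qed (rule x)
        then show False using y by simp
      qed
    qed
  next
    case (2 M)
    obtain h :: "int \<Rightarrow> 'a" and f :: "int \<Rightarrow> int" where h: "inj h" "range h = verts G" "\<And>i. adj G (h i) (h (i + 1))"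
      and f: "mono f" "surj f" and bf: "\<And>i. b (h i) = M - \<bar>f i\<bar>"
      by (rule one_double_ray[OF 2]) (rule that)
    have w: "walk G h" using h(3) unfolding walk_def adj_def by blast
    note r = walk_ray[OF G w h(1)]
    show ?thesis
    proof (rule hamiltonian_one_double_ray[OF G w h(1,2)], rule rays_meeting_levels_equiv[OF G L r(2,1)])
      fix N :: nat
      obtain J where J: "\<forall>j\<ge>J. \<exists>m\<ge>N. f (int m) = j" using mono_surj_reaches_forward[OF f] by blast
      obtain J' where J': "\<forall>j\<le>J'. \<exists>m\<ge>N. f (- int m) = j" using mono_surj_reaches_backward[OF f] by blast
      define j where "j = max J (- J')"
      obtain m where m: "m \<ge> N" "f (int m) = j" using J unfolding j_def by (meson max.cobounded1)
      have "- j \<le> J'" unfolding j_def by simp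
      then obtain n where n: "n \<ge> N" "f (- int n) = - j" using J' by blast
      show "\<exists>n\<ge>N. \<exists>m\<ge>N. b (h (- int n)) = b (h (int m))" using m n bf by (metis abs_minus_cancel)
    qed
  qed
qed

theorem theorem1p3:
  fixes G :: "'a sgraph"
  assumes "simple_graph G"
    and "locally_finite G"
    and "two_connected G"
    and "induced_free claw G"
    and "induced_free net G"
  shows "hamiltonian G"
proof -
  note G = assms(1)
  have cn: "claw_net_free (adj G)" by (rule claw_net_free_adj[OF assms(1,4,5)])
  interpret claw_net_free "adj G" by (rule cn)
  have del: "linked (verts G - S)" if "S \<subseteq> verts G" "finite S" "card S < 2" for S
    using linked_delete[OF cn, of S] assms(3) that unfolding two_connected_def by blast
  have con: "linked (verts G)" using del[of "{}"] by simp
  have cut: "linked (verts G - {c})" if "c \<in> verts G" for c using del[of "{c}"] that by simp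
  have EV: "x \<in> verts G \<and> y \<in> verts G" if "adj G x y" for x y
    using simple_graphD[OF G] that unfolding adj_def by blast
  have lf: "finite {y. adj G x y}" if "x \<in> verts G" for x
    using assms(2) that unfolding locally_finite_def adj_def by blast
  show ?thesis
  proof (cases "finite (verts G)")
    case True
    then have card: "card (verts G) > 2" using assms(3) unfolding two_connected_def by blast
    then obtain xs where xs: "cycle_on (verts G) xs" using finite_hamilton_cycle[OF True _ con cut] by auto
    note xs = xs[unfolded cycle_on_def path_on_def]
    have "length xs > 2" using card xs distinct_card[of xs] by auto
    moreover have "{xs ! i, xs ! Suc i} \<in> edges G" if "Suc i < length xs" for i
      using successively_nth[of "adj G" xs i] xs that unfolding adj_def by blast
    moreover have "{last xs, hd xs} \<in> edges G" using xs unfolding adj_def by blast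
    ultimately show ?thesis using hamiltonian_finite[OF G, of xs] xs by blast
  next
    case False
    obtain b :: "'a \<Rightarrow> int" where b: "\<And>x y. adj G x y \<Longrightarrow> \<bar>b x - b y\<bar> \<le> 1"
      "\<And>x. x \<in> verts G \<Longrightarrow> \<exists>p. adj G x p \<and> b p = b x - 1"
      "\<And>x y. x \<in> verts G \<Longrightarrow> y \<in> verts G \<Longrightarrow> b x = b y \<Longrightarrow> x \<noteq> y \<Longrightarrow> adj G x y"
    proof (rule clique_levels_exist[of "verts G"])
      show "x \<in> verts G \<and> y \<in> verts G" if "adj G x y" for x y using EV that .
      show "finite {y. adj G x y}" if "x \<in> verts G" for x using lf that .
    qed (rule False con that; assumption)+
    have "clique_levels (adj G) (verts G) b"
      by unfold_locales (fact EV b lf cut)+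
    moreover have "verts G \<noteq> {}" using False by auto
    ultimately show ?thesis using hamiltonian_clique_levels[OF G] by blast
  qed
qed

end
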